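(* Let $\Phi\subset T^*M_1\times(-T^*M_2)$ be a canonical relation with (even) generating function $S=S(x,q)$, and let $g\in \mathbf{C}^{\infty}(M_2)$ be an even function with $\Lambda_g=\{(y^i,q_i)\mid q_i=\frac{\partial g}{\partial y^i}(y)\}\subset T^*M_2$. Put $$\Lambda:=\Phi\circ\Lambda_g=p_1\bigl(\Phi\cap p_2^{-1}(\Lambda_g)\bigr)\subset T^*M_1 ,$$ i.e., in coordinates $$\Lambda=\Bigl\{(x^a,p_a)\ \Bigl|\ p_a=\frac{\partial S}{\partial x^a}(x,q),\ q_i=\frac{\partial g}{\partial y^i}(y),\ y^i=(-1)^{\tilde\imath}\frac{\partial S}{\partial q_i}(x,q)\Bigr\}.$$ Then the submanifold $\Lambda\subset T^*M_1$ is Lagrangian and is the graph of the derivative of a function $f\in\mathbf{C}^{\infty}(M_1)$, i.e. $\Lambda=\Lambda_f=\{(x^a,p_a)\mid p_a=\frac{\partial f}{\partial x^a}(x)\}$, where $f$ is given by $$f(x)=g(y)+S(x,q)-y^iq_i ,$$ with $q_i$ and $y^i$ determined from the equations $$q_i=\frac{\partial g}{\partial y^i}(y),\qquad y^i=(-1)^{\tilde\imath}\frac{\partial S}{\partial q_i}\Bigl(x,\frac{\partial g}{\partial y}(y)\Bigr).$$ (The function $f$ is called the generalized pullback of $g$ with respect to $\Phi$, written $f=\Phi^*[g]$.)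
   Context: $M_1$ and $M_2$ are smooth manifolds or supermanifolds with local coordinates $x^a$ and $y^i$; $p_a$ and $q_i$ are the conjugate momenta on $T^*M_1$ and $T^*M_2$. The parity of a coordinate with index $a$ (resp. $i$) and of its conjugate momentum is $\tilde a$ (resp. $\tilde\imath$). Derivatives are left derivatives; repeated indices are summed. The symplectic forms are $\omega_1=dp_adx^a$, $\omega_2=dq_idy^i$. $T^*M_1\times(-T^*M_2)$ denotes $T^*M_1\times T^*M_2$ with symplectic form $p_1^*\omega_1-p_2^*\omega_2$, where $p_1,p_2$ are the projections to the two factors. A canonical relation is a Lagrangian submanifold of $T^*M_1\times(-T^*M_2)$. $\mathbf{C}^{\infty}(M)$ denotes the space of smooth functions regarded as an infinite-dimensional (super)manifold; its points are even functions on $M$ (possibly depending on auxiliary odd parameters). Canonical relation with generating function: $\Phi$ is specified by an even function $S=S(x,q)$ of positions on $M_1$ and momenta on $M_2$ as $$\Phi=\Bigl\{(x^a,p_a,y^i,q_i)\ \Bigl|\ p_a=\frac{\partial S}{\partial x^a}(x,q),\ y^i=(-1)^{\tilde\imath}\frac{\partial S}{\partial q_i}(x,q)\Bigr\}.$$ $S$ is regarded as part of the structure (so there is no ambiguity of additive constants) and as a formal power series in the $q_i$: $S(x,q)=S_0(x)+\varphi^i(x)q_i+\frac12S^{ij}(x)q_jq_i+\dots$, where $y^i=\varphi^i(x)$ is a smooth map $\varphi:M_1\to M_2$; thus $\Phi$ is a formal relation. Under changes of coordinates $x^a=x^a(x')$, $y^i=y^i(y')$, the function $S$ is replaced by $S'(x',q')=S(x,q)-y^iq_i+y^{i'}q_{i'}$,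 where $x^a=x^a(x')$, $y^{i'}=y^{i'}(y)$, $q_i=\frac{\partial y^{i'}}{\partial y^i}(y)q_{i'}$ and $y^i=(-1)^{\tilde\imath}\frac{\partial S}{\partial q_i}(x,q)$. The equation for $y$ is solved by iterations: replacing $g$ by $\varepsilon g$ with a formal parameter $\varepsilon$, there is a unique solution $y=\varphi(x)+\varepsilon y_1+\varepsilon^2y_2+\dots$, with $y_N$ homogeneous of order $N$ in $g$ and its derivatives at $\varphi(x)$. Accordingly all assertions about $f$ and $\Lambda$ are understood as identities of formal power series in $g$ (i.e. in $\varepsilon$). *)

theory Defs
  imports "HOL-Analysis.Analysis" "HOL-Computational_Algebra.Formal_Power_Series"
begin

section \<open>The Grassmann algebra of odd parameters\<close>

text \<open>
  The real Grassmann algebra on odd generators \<open>\<theta>\<^sub>0, \<theta>\<^sub>1, \<dots>\<close> (completed: infinite sums are allowed).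
  The coefficient at a finite set \<open>J\<close> belongs to the product of the \<open>\<theta>\<^sub>j\<close>, \<open>j \<in> J\<close>, taken in
  increasing order; \<open>gsign T U\<close> is the sign of the shuffle sorting the word \<open>T U\<close>.
\<close>

typedef grass = "{f :: nat set \<Rightarrow> real. \<forall>J. infinite J \<longrightarrow> f J = 0}"
  by (rule exI[of _ "\<lambda>_. 0"]) simp

setup_lifting type_definition_grass

definition inversions :: "nat set \<Rightarrow> nat set \<Rightarrow> nat" where
  "inversions T U = card {(t, u). t \<in> T \<and> u \<in> U \<and> u < t}"

definition gsign :: "nat set \<Rightarrow> nat set \<Rightarrow> real" where
  "gsign T U = (- 1) ^ inversions T U"

lemma inversions_finite:
  "finite T \<Longrightarrow> finite U \<Longrightarrow> finite {(t, u). t \<in> T \<and> u \<in> U \<and> u < (t::nat)}"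
  by (rule finite_subset[of _ "T \<times> U"]) auto

lemma gsign_Un_right:
  assumes "finite T" "finite U" "finite V" "U \<inter> V = {}"
  shows "gsign T (U \<union> V) = gsign T U * gsign T V"
proof -
  have "{(t, u). t \<in> T \<and> u \<in> U \<union> V \<and> u < t} =
      {(t, u). t \<in> T \<and> u \<in> U \<and> u < t} \<union> {(t, u). t \<in> T \<and> u \<in> V \<and> u < t}" by auto
  moreover have "{(t, u). t \<in> T \<and> u \<in> U \<and> u < t} \<inter> {(t, u). t \<in> T \<and> u \<in> V \<and> u < t} = {}"
    using assms(4) by auto
  ultimately have "inversions T (U \<union> V) = inversions T U + inversions T V"
    unfolding inversions_def using assms by (simp add: card_Un_disjoint inversions_finite)
  thus ?thesis by (simp add: gsign_def power_add)
qed

lemma gsign_Un_left: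
  assumes "finite T" "finite U" "finite V" "T \<inter> U = {}"
  shows "gsign (T \<union> U) V = gsign T V * gsign U V"
proof -
  have "{(t, u). t \<in> T \<union> U \<and> u \<in> V \<and> u < t} =
      {(t, u). t \<in> T \<and> u \<in> V \<and> u < t} \<union> {(t, u). t \<in> U \<and> u \<in> V \<and> u < t}" by auto
  moreover have "{(t, u). t \<in> T \<and> u \<in> V \<and> u < t} \<inter> {(t, u). t \<in> U \<and> u \<in> V \<and> u < t} = {}"
    using assms(4) by auto
  ultimately have "inversions (T \<union> U) V = inversions T V + inversions U V"
    unfolding inversions_def using assms by (simp add: card_Un_disjoint inversions_finite)
  thus ?thesis by (simp add: gsign_def power_add)
qed

lemma gsign_empty [simp]: "gsign {} U = 1" "gsign T {} = 1"
  by (simp_all add: gsign_def inversions_def)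

instantiation grass :: real_algebra_1
begin

lift_definition zero_grass :: grass is "\<lambda>_. 0" by simp
lift_definition one_grass :: grass is "\<lambda>J. if J = {} then 1 else 0" by auto
lift_definition plus_grass :: "grass \<Rightarrow> grass \<Rightarrow> grass" is "\<lambda>f g J. f J + g J" by simp
lift_definition minus_grass :: "grass \<Rightarrow> grass \<Rightarrow> grass" is "\<lambda>f g J. f J - g J" by simp
lift_definition uminus_grass :: "grass \<Rightarrow> grass" is "\<lambda>f J. - f J" by simp
lift_definition scaleR_grass :: "real \<Rightarrow> grass \<Rightarrow> grass" is "\<lambda>r f J. r * f J" by simp
lift_definition times_grass :: "grass \<Rightarrow> grass \<Rightarrow> grass" is
  "\<lambda>f g J. if finite J then \<Sum>T\<in>Pow J. gsign T (J - T) * f T * g (J - T) else 0"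
  by simp

lemma grass_times_assoc_aux:
  fixes f g h :: "nat set \<Rightarrow> real"
  assumes "finite J"
  shows "(\<Sum>W\<in>Pow J. gsign W (J - W) * (\<Sum>T\<in>Pow W. gsign T (W - T) * f T * g (W - T)) * h (J - W))
       = (\<Sum>T\<in>Pow J. gsign T (J - T) * f T *
            (\<Sum>U\<in>Pow (J - T). gsign U (J - T - U) * g U * h (J - T - U)))"
proof -
  let ?L = "\<lambda>W T. gsign W (J - W) * (gsign T (W - T) * f T * g (W - T)) * h (J - W)"
  let ?R = "\<lambda>T U. gsign T (J - T) * f T * (gsign U (J - T - U) * g U * h (J - T - U))"
  have fin: "X \<subseteq> J \<Longrightarrow> finite X" for X using assms finite_subset by blast
  have "(\<Sum>W\<in>Pow J. gsign W (J - W) * (\<Sum>T\<in>Pow W. gsign T (W - T) * f T * g (W - T)) * h (J - W))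
      = (\<Sum>W\<in>Pow J. \<Sum>T\<in>Pow W. ?L W T)"
    by (simp add: sum_distrib_left sum_distrib_right)
  also have "\<dots> = (\<Sum>(W, T)\<in>Sigma (Pow J) Pow. ?L W T)"
    using assms fin by (subst sum.Sigma) auto
  also have "\<dots> = (\<Sum>(T, U)\<in>Sigma (Pow J) (\<lambda>T. Pow (J - T)). ?R T U)"
  proof (rule sum.reindex_bij_witness[of _ "\<lambda>(T, U). (T \<union> U, T)" "\<lambda>(W, T). (T, W - T)"])
    fix a assume "a \<in> Sigma (Pow J) Pow"
    then obtain W T where a: "a = (W, T)" "W \<subseteq> J" "T \<subseteq> W" by auto
    have f: "finite W" "finite T" "finite (W - T)" "finite (J - W)" using a fin by auto
    have e1: "J - T - (W - T) = J - W" using a by auto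
    have e2: "gsign W (J - W) = gsign T (J - W) * gsign (W - T) (J - W)"
      using gsign_Un_left[of T "W - T" "J - W"] f a by (simp add: Un_absorb1)
    have "(W - T) \<union> (J - W) = J - T" using a by auto
    hence e3: "gsign T (J - T) = gsign T (W - T) * gsign T (J - W)"
      using gsign_Un_right[of T "W - T" "J - W"] f by auto
    show "(case case a of (W, T) \<Rightarrow> (T, W - T) of (T, U) \<Rightarrow> ?R T U) = (case a of (W, T) \<Rightarrow> ?L W T)"
      by (simp add: a(1) e1 e2 e3)
  qed auto
  also have "\<dots> = (\<Sum>T\<in>Pow J. \<Sum>U\<in>Pow (J - T). ?R T U)"
    using assms fin by (subst sum.Sigma) auto
  finally show ?thesis by (simp add: sum_distrib_left)
qed

instance
proof
  fix a b c :: grass and r s :: real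
  show "a + b + c = a + (b + c)" by transfer (simp add: add.assoc)
  show "a + b = b + a" by transfer (simp add: add.commute)
  show "0 + a = a" by transfer simp
  show "- a + a = 0" by transfer simp
  show "a - b = a + - b" by transfer simp
  show "r *\<^sub>R (a + b) = r *\<^sub>R a + r *\<^sub>R b" by transfer (simp add: distrib_left)
  show "(r + s) *\<^sub>R a = r *\<^sub>R a + s *\<^sub>R a" by transfer (simp add: distrib_right)
  show "r *\<^sub>R s *\<^sub>R a = (r * s) *\<^sub>R a" by transfer (simp add: mult.assoc)
  show "1 *\<^sub>R a = a" by transfer simp
  show "a * b * c = a * (b * c)"
  proof transfer
    fix f g h :: "nat set \<Rightarrow> real"
    let ?m = "\<lambda>f g J. if finite J then \<Sum>T\<in>Pow J. gsign T (J - T) * f T * g (J - T) else 0"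
    show "?m (?m f g) h = ?m f (?m g h)"
    proof
      fix J :: "nat set"
      show "?m (?m f g) h J = ?m f (?m g h) J"
      proof (cases "finite J")
        case True
        have "?m (?m f g) h J = (\<Sum>W\<in>Pow J. gsign W (J - W) *
            (\<Sum>T\<in>Pow W. gsign T (W - T) * f T * g (W - T)) * h (J - W))"
          using True by (auto intro!: sum.cong dest: finite_subset)
        also have "\<dots> = (\<Sum>T\<in>Pow J. gsign T (J - T) * f T *
            (\<Sum>U\<in>Pow (J - T). gsign U (J - T - U) * g U * h (J - T - U)))"
          by (rule grass_times_assoc_aux[OF True])
        also have "\<dots> = ?m f (?m g h) J"
          using True by simp
        finally show ?thesis .
      qed simp
    qed
  qed
  show "1 * a = a"
  proof transfer
    fix f :: "nat set \<Rightarrow> real" assume f: "\<forall>J. infinite J \<longrightarrow> f J = 0"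
    show "(\<lambda>J. if finite J then \<Sum>T\<in>Pow J. gsign T (J - T) * (if T = {} then 1 else 0) * f (J - T) else 0) = f"
    proof
      fix J
      have "finite J \<Longrightarrow> (\<Sum>T\<in>Pow J. gsign T (J - T) * (if T = {} then 1 else 0) * f (J - T))
          = (\<Sum>T\<in>{{}}. gsign T (J - T) * (if T = {} then 1 else 0) * f (J - T))"
        by (rule sum.mono_neutral_right) auto
      thus "(if finite J then \<Sum>T\<in>Pow J. gsign T (J - T) * (if T = {} then 1 else 0) * f (J - T) else 0) = f J"
        using f by simp
    qed
  qed
  show "a * 1 = a"
  proof transfer
    fix f :: "nat set \<Rightarrow> real" assume f: "\<forall>J. infinite J \<longrightarrow> f J = 0"
    show "(\<lambda>J. if finite J then \<Sum>T\<in>Pow J. gsign T (J - T) * f T * (if J - T = {} then 1 else 0) else 0) = f"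
    proof
      fix J
      have "finite J \<Longrightarrow> (\<Sum>T\<in>Pow J. gsign T (J - T) * f T * (if J - T = {} then 1 else 0))
          = (\<Sum>T\<in>{J}. gsign T (J - T) * f T * (if J - T = {} then 1 else 0))"
        by (rule sum.mono_neutral_right) auto
      thus "(if finite J then \<Sum>T\<in>Pow J. gsign T (J - T) * f T * (if J - T = {} then 1 else 0) else 0) = f J"
        using f by simp
    qed
  qed
  show "(a + b) * c = a * c + b * c"
    by transfer (auto simp: fun_eq_iff algebra_simps sum.distrib)
  show "a * (b + c) = a * b + a * c"
    by transfer (auto simp: fun_eq_iff algebra_simps sum.distrib)
  show "r *\<^sub>R a * b = r *\<^sub>R (a * b)"
    by transfer (auto simp: fun_eq_iff sum_distrib_left ac_simps intro!: sum.cong)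
  show "a * r *\<^sub>R b = r *\<^sub>R (a * b)"
    by transfer (auto simp: fun_eq_iff sum_distrib_left ac_simps intro!: sum.cong)
  show "(0::grass) \<noteq> 1"
    by transfer (auto simp: fun_eq_iff)
qed

end

section \<open>Scalars: Grassmann numbers with a formal parameter\<close>

text \<open>
  All objects live over the supercommutative algebra of formal power series in the even formal
  parameter \<open>\<epsilon>\<close> (\<open>fps_X\<close>) with Grassmann coefficients. Formal power series in a function \<open>g\<close> are
  expressed by replacing \<open>g\<close> by \<open>\<epsilon> g\<close>.
  Supermanifolds are handled through their points with values in this algebra. As it has infinitely
  many odd generators, a function is determined by its values at such points.
\<close>

type_synonym scalar = "grass fps"

definition scoeff :: "scalar \<Rightarrow> nat \<Rightarrow> nat set \<Rightarrow> real" where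
  "scoeff a k J = Rep_grass (fps_nth a k) J"

definition mk_scalar :: "(nat \<Rightarrow> nat set \<Rightarrow> real) \<Rightarrow> scalar" where
  "mk_scalar h = Abs_fps (\<lambda>k. Abs_grass (\<lambda>J. if finite J then h k J else 0))"

definition real_scalar :: "real \<Rightarrow> scalar" where
  "real_scalar r = fps_const (of_real r)"

definition sbody :: "scalar \<Rightarrow> real" where
  "sbody a = scoeff a 0 {}"

definition has_parity :: "bool \<Rightarrow> scalar \<Rightarrow> bool" where
  "has_parity is_odd a \<longleftrightarrow> (\<forall>k J. scoeff a k J \<noteq> 0 \<longrightarrow> odd (card J) = is_odd)"

section \<open>Superfunctions in coordinates\<close>

text \<open>
  A list of kinds describes a coordinate system: ordinary even coordinates, odd coordinates, and
  formal even coordinates (in which functions are formal power series only). The underlying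
  ordinary space consists of real sequences vanishing away from the positions of kind \<open>Even\<close>.
\<close>

datatype kind = Even | Odd | Formal

definition even_idx :: "kind list \<Rightarrow> nat set" where
  "even_idx ks = {i. i < length ks \<and> ks ! i = Even}"

definition odd_idx :: "kind list \<Rightarrow> nat set" where
  "odd_idx ks = {i. i < length ks \<and> ks ! i = Odd}"

definition par :: "kind list \<Rightarrow> nat \<Rightarrow> nat" where
  "par ks i = of_bool (ks ! i = Odd)"

definition body_space :: "kind list \<Rightarrow> (nat \<Rightarrow> real) set" where
  "body_space ks = {x. \<forall>i. i \<notin> even_idx ks \<longrightarrow> x i = 0}"

text \<open>
  \<open>F x m\<close> is the coefficient, depending on the underlying point \<open>x\<close>, of the monomial
  \<open>\<zeta>\<^sup>m = \<zeta>\<^sub>0\<^sup>m\<^sup>0 \<zeta>\<^sub>1\<^sup>m\<^sup>1 \<dots>\<close> in the odd and the formal coordinates (factors in increasing order):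
  \<open>F = \<Sum>\<^sub>m \<zeta>\<^sup>m F\<^sub>m(x)\<close>. Writing the scalar coefficients on the right makes left derivatives free of
  signs caused by auxiliary odd parameters. Only the exponents in \<open>admissible\<close> matter.
\<close>

type_synonym sfun = "(nat \<Rightarrow> real) \<Rightarrow> (nat \<Rightarrow> nat) \<Rightarrow> scalar"

definition admissible :: "kind list \<Rightarrow> (nat \<Rightarrow> nat) set" where
  "admissible ks = {m. (\<forall>i. i \<ge> length ks \<or> i \<in> even_idx ks \<longrightarrow> m i = 0) \<and> (\<forall>i\<in>odd_idx ks. m i \<le> 1)}"

definition partial_deriv :: "nat \<Rightarrow> ((nat \<Rightarrow> real) \<Rightarrow> real) \<Rightarrow> (nat \<Rightarrow> real) \<Rightarrow> real" where
  "partial_deriv i h x = deriv (\<lambda>t. h (x(i := t))) (x i)"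

text \<open>Smoothness: all iterated partial derivatives exist and are continuous.\<close>

definition smooth_real :: "kind list \<Rightarrow> (nat \<Rightarrow> real) set \<Rightarrow> ((nat \<Rightarrow> real) \<Rightarrow> real) \<Rightarrow> bool" where
  "smooth_real ks U h \<longleftrightarrow> (\<forall>is. set is \<subseteq> even_idx ks \<longrightarrow>
      continuous_on U (foldr partial_deriv is h) \<and>
      (\<forall>i\<in>even_idx ks. \<forall>x\<in>U. (\<lambda>t. foldr partial_deriv is h (x(i := t))) differentiable at (x i)))"

definition smooth_sfun :: "kind list \<Rightarrow> (nat \<Rightarrow> real) set \<Rightarrow> sfun \<Rightarrow> bool" where
  "smooth_sfun ks U F \<longleftrightarrow>
     (\<forall>m\<in>admissible ks. \<forall>k J. smooth_real ks U (\<lambda>x. scoeff (F x m) k J))"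

definition sfun_parity :: "kind list \<Rightarrow> (nat \<Rightarrow> real) set \<Rightarrow> bool \<Rightarrow> sfun \<Rightarrow> bool" where
  "sfun_parity ks U is_odd F \<longleftrightarrow>
     (\<forall>m\<in>admissible ks. \<forall>x\<in>U. has_parity (is_odd \<noteq> odd (\<Sum>i\<in>odd_idx ks. m i)) (F x m))"

text \<open>No dependence on \<open>\<epsilon>\<close>; respectively, no dependence on \<open>\<epsilon>\<close> and on auxiliary odd parameters.\<close>

definition eps_free :: "kind list \<Rightarrow> (nat \<Rightarrow> real) set \<Rightarrow> sfun \<Rightarrow> bool" where
  "eps_free ks U F \<longleftrightarrow> (\<forall>m\<in>admissible ks. \<forall>x\<in>U. \<forall>k J. k > 0 \<longrightarrow> scoeff (F x m) k J = 0)"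

definition real_sfun :: "kind list \<Rightarrow> (nat \<Rightarrow> real) set \<Rightarrow> sfun \<Rightarrow> bool" where
  "real_sfun ks U F \<longleftrightarrow>
     (\<forall>m\<in>admissible ks. \<forall>x\<in>U. \<forall>k J. (k, J) \<noteq> (0, {}) \<longrightarrow> scoeff (F x m) k J = 0)"

text \<open>The left derivative with respect to the \<open>i\<close>-th coordinate.\<close>

definition left_deriv :: "kind list \<Rightarrow> nat \<Rightarrow> sfun \<Rightarrow> sfun" where
  "left_deriv ks i F = (\<lambda>x m.
     (case ks ! i of
        Even \<Rightarrow> mk_scalar (\<lambda>k J. partial_deriv i (\<lambda>z. scoeff (F z m) k J) x)
      | Formal \<Rightarrow> of_nat (m i + 1) * F x (m(i := m i + 1))
      | Odd \<Rightarrow> (if m i = 0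
                then (- 1) ^ (\<Sum>j\<in>odd_idx ks \<inter> {..<i}. m j) * F x (m(i := 1)) else 0)))"

section \<open>Points with values in the scalars, and evaluation\<close>

definition body_vec :: "kind list \<Rightarrow> (nat \<Rightarrow> scalar) \<Rightarrow> nat \<Rightarrow> real" where
  "body_vec ks X = (\<lambda>i. if i \<in> even_idx ks then sbody (X i) else 0)"

definition coord_tuples :: "kind list \<Rightarrow> (nat \<Rightarrow> scalar) set" where
  "coord_tuples ks = {X. (\<forall>i<length ks. has_parity (ks ! i = Odd) (X i)) \<and> (\<forall>i\<ge>length ks. X i = 0)}"

definition spoints :: "kind list \<Rightarrow> (nat \<Rightarrow> real) set \<Rightarrow> (nat \<Rightarrow> scalar) set" where
  "spoints ks U = {X \<in> coord_tuples ks. body_vec ks X \<in> U \<and>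
     (\<forall>i<length ks. ks ! i = Formal \<longrightarrow> sbody (X i) = 0)}"

text \<open>
  Evaluation by the Taylor expansion at the underlying point \<open>x\<^sub>0\<close>:
  \<open>F(X) = \<Sum>\<^sub>e (X - x\<^sub>0)\<^sup>e / e! (\<partial>\<^sup>e F\<^sub>m)(x\<^sub>0)\<close>, where \<open>e\<close> runs over exponents for all coordinates, the
  derivatives and factorials concern the ordinary even coordinates, and \<open>m\<close> is the remaining part
  of \<open>e\<close>. Since every \<open>X\<^sub>i - x\<^sub>0\<^sub>i\<close> has vanishing body, only exponents of total degree at most
  \<open>k + card J\<close> contribute to the coefficient at \<open>\<epsilon>\<^sup>k \<theta>\<^sup>J\<close>, so that coefficient is a finite sum.
\<close>

definition exponents :: "kind list \<Rightarrow> nat \<Rightarrow> (nat \<Rightarrow> nat) set" where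
  "exponents ks N = {e. (\<forall>i\<ge>length ks. e i = 0) \<and> (\<forall>i\<in>odd_idx ks. e i \<le> 1) \<and>
     (\<Sum>i<length ks. e i) \<le> N}"

definition soul_monomial :: "kind list \<Rightarrow> (nat \<Rightarrow> nat) \<Rightarrow> (nat \<Rightarrow> scalar) \<Rightarrow> scalar" where
  "soul_monomial ks e X =
     prod_list (map (\<lambda>i. (X i - real_scalar (sbody (X i))) ^ e i) [0..<length ks])"

definition taylor_coeff :: "kind list \<Rightarrow> (nat \<Rightarrow> nat) \<Rightarrow> sfun \<Rightarrow> (nat \<Rightarrow> real) \<Rightarrow> scalar" where
  "taylor_coeff ks e F x =
     real_scalar (1 / (\<Prod>i\<in>even_idx ks. fact (e i))) *
     (foldr (\<lambda>i. left_deriv ks i ^^ e i) (filter (\<lambda>i. i \<in> even_idx ks) [0..<length ks]) F)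
       x (\<lambda>i. if i \<in> even_idx ks then 0 else e i)"

definition seval :: "kind list \<Rightarrow> sfun \<Rightarrow> (nat \<Rightarrow> scalar) \<Rightarrow> scalar" where
  "seval ks F X = mk_scalar (\<lambda>k J. scoeff
     (\<Sum>e\<in>exponents ks (k + card J). soul_monomial ks e X * taylor_coeff ks e F (body_vec ks X)) k J)"

section \<open>Supermanifolds\<close>

text \<open>
  A supermanifold is given by an underlying space with an atlas whose transition maps are
  superfunctions: \<open>mf_trans M c c' a\<close> is the new coordinate \<open>x'\<^sup>a\<close> as a function of the coordinates
  of \<open>c\<close>. An ordinary manifold is the case without coordinates of kind \<open>Odd\<close>.
\<close>

record ('p, 'c) smanifold =
  mf_top :: "'p topology"
  mf_kinds :: "kind list"
  mf_charts :: "'c set"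
  mf_dom :: "'c \<Rightarrow> 'p set"
  mf_coord :: "'c \<Rightarrow> 'p \<Rightarrow> nat \<Rightarrow> real"
  mf_trans :: "'c \<Rightarrow> 'c \<Rightarrow> nat \<Rightarrow> sfun"

definition mf_dim :: "('p, 'c) smanifold \<Rightarrow> nat" where
  "mf_dim M = length (mf_kinds M)"

definition charts_at :: "('p, 'c) smanifold \<Rightarrow> 'p \<Rightarrow> 'c set" where
  "charts_at M m = {c \<in> mf_charts M. m \<in> mf_dom M c}"

definition change_coords ::
  "('p, 'c) smanifold \<Rightarrow> 'c \<Rightarrow> 'c \<Rightarrow> (nat \<Rightarrow> scalar) \<Rightarrow> nat \<Rightarrow> scalar" where
  "change_coords M c c' X =
     (\<lambda>a. if a < mf_dim M then seval (mf_kinds M) (mf_trans M c c' a) X else 0)"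

definition supermanifold :: "('p, 'c) smanifold \<Rightarrow> bool" where
  "supermanifold M \<longleftrightarrow>
     Hausdorff_space (mf_top M) \<and> second_countable (mf_top M) \<and>
     Formal \<notin> set (mf_kinds M) \<and>
     (\<Union>c\<in>mf_charts M. mf_dom M c) = topspace (mf_top M) \<and>
     (\<forall>c\<in>mf_charts M.
        openin (mf_top M) (mf_dom M c) \<and>
        openin (top_of_set (body_space (mf_kinds M))) (mf_coord M c ` mf_dom M c) \<and>
        homeomorphic_map (subtopology (mf_top M) (mf_dom M c))
          (top_of_set (mf_coord M c ` mf_dom M c)) (mf_coord M c)) \<and>
     (\<forall>c\<in>mf_charts M. \<forall>c'\<in>mf_charts M.
        let U = mf_coord M c ` (mf_dom M c \<inter> mf_dom M c') in
        \<forall>a<mf_dim M.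
          smooth_sfun (mf_kinds M) U (mf_trans M c c' a) \<and>
          sfun_parity (mf_kinds M) U (mf_kinds M ! a = Odd) (mf_trans M c c' a) \<and>
          real_sfun (mf_kinds M) U (mf_trans M c c' a) \<and>
          (a \<in> even_idx (mf_kinds M) \<longrightarrow> (\<forall>m\<in>mf_dom M c \<inter> mf_dom M c'.
             sbody (mf_trans M c c' a (mf_coord M c m) (\<lambda>_. 0)) = mf_coord M c' m a))) \<and>
     (\<forall>m\<in>topspace (mf_top M). \<forall>c\<in>charts_at M m. \<forall>c'\<in>charts_at M m. \<forall>c''\<in>charts_at M m.
        \<forall>X\<in>spoints (mf_kinds M) {mf_coord M c m}.
          change_coords M c c X = X \<and>
          change_coords M c' c'' (change_coords M c c' X) = change_coords M c c'' X)"

text \<open>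
  A (scalar-valued) point of \<open>M\<close> is an underlying point together with its coordinates in every
  chart around it; a point of \<open>T\<^sup>*M\<close> carries in addition the conjugate momenta, with
  \<open>p\<^sub>a = \<partial>x'\<^sup>b/\<partial>x\<^sup>a p'\<^sub>b\<close>. Families indexed by charts are 0 at charts not containing the
  underlying point.
\<close>

type_synonym ('p, 'c) spoint = "'p \<times> ('c \<Rightarrow> nat \<Rightarrow> scalar)"
type_synonym ('p, 'c) cotpoint = "'p \<times> ('c \<Rightarrow> nat \<Rightarrow> scalar) \<times> ('c \<Rightarrow> nat \<Rightarrow> scalar)"

definition mf_points :: "('p, 'c) smanifold \<Rightarrow> ('p, 'c) spoint set" where
  "mf_points M = {(m, X). m \<in> topspace (mf_top M) \<and>
     (\<forall>c\<in>charts_at M m. X c \<in> spoints (mf_kinds M) {mf_coord M c m}) \<and>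
     (\<forall>c\<in>charts_at M m. \<forall>c'\<in>charts_at M m. X c' = change_coords M c c' (X c)) \<and>
     (\<forall>c. c \<notin> charts_at M m \<longrightarrow> X c = (\<lambda>_. 0))}"

definition cotangent_bundle :: "('p, 'c) smanifold \<Rightarrow> ('p, 'c) cotpoint set" where
  "cotangent_bundle M = {(m, X, P). (m, X) \<in> mf_points M \<and>
     (\<forall>c\<in>charts_at M m. P c \<in> coord_tuples (mf_kinds M)) \<and>
     (\<forall>c\<in>charts_at M m. \<forall>c'\<in>charts_at M m. \<forall>a<mf_dim M.
        P c a = (\<Sum>b<mf_dim M.
          seval (mf_kinds M) (left_deriv (mf_kinds M) a (mf_trans M c c' b)) (X c) * P c' b)) \<and>
     (\<forall>c. c \<notin> charts_at M m \<longrightarrow> P c = (\<lambda>_. 0))}"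

text \<open>
  Even functions on \<open>M\<close>, given by their coordinate expressions in the charts. They may depend on
  the auxiliary odd parameters and on \<open>\<epsilon>\<close>.
\<close>

definition smooth_function :: "('p, 'c) smanifold \<Rightarrow> ('c \<Rightarrow> sfun) \<Rightarrow> bool" where
  "smooth_function M f \<longleftrightarrow>
     (\<forall>c\<in>mf_charts M.
        smooth_sfun (mf_kinds M) (mf_coord M c ` mf_dom M c) (f c) \<and>
        sfun_parity (mf_kinds M) (mf_coord M c ` mf_dom M c) False (f c)) \<and>
     (\<forall>(m, X)\<in>mf_points M. \<forall>c\<in>charts_at M m. \<forall>c'\<in>charts_at M m.
        seval (mf_kinds M) (f c) (X c) = seval (mf_kinds M) (f c') (X c'))"

definition eps_free_function :: "('p, 'c) smanifold \<Rightarrow> ('c \<Rightarrow> sfun) \<Rightarrow> bool" where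
  "eps_free_function M f \<longleftrightarrow>
     (\<forall>c\<in>mf_charts M. eps_free (mf_kinds M) (mf_coord M c ` mf_dom M c) (f c))"

definition eps_times :: "('c \<Rightarrow> sfun) \<Rightarrow> 'c \<Rightarrow> sfun" where
  "eps_times g = (\<lambda>c x m. fps_X * g c x m)"

text \<open>\<open>\<Lambda>\<^sub>f\<close>, the graph of the derivative of \<open>f\<close>.\<close>

definition graph_deriv :: "('p, 'c) smanifold \<Rightarrow> ('c \<Rightarrow> sfun) \<Rightarrow> ('p, 'c) cotpoint set" where
  "graph_deriv M f = {(m, X, P) \<in> cotangent_bundle M. \<forall>c\<in>charts_at M m. \<forall>a<mf_dim M.
     P c a = seval (mf_kinds M) (left_deriv (mf_kinds M) a (f c)) (X c)}"

section \<open>Lagrangian submanifolds of the cotangent bundle\<close>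

text \<open>
  \<open>pullback_omega ks x p s r\<close> is the coefficient of \<open>dt\<^sup>s dt\<^sup>r\<close> in the pullback of \<open>dp\<^sub>a dx\<^sup>a\<close> along
  \<open>x\<^sup>a = x\<^sup>a(t)\<close>, \<open>p\<^sub>a = p\<^sub>a(t)\<close>. Here \<open>dp\<^sub>a = dt\<^sup>s \<partial>p\<^sub>a/\<partial>t\<^sup>s\<close>, \<open>dt\<^sup>r\<close> has parity opposite to \<open>t\<^sup>r\<close>,
  and the sign comes from moving \<open>\<partial>p\<^sub>a/\<partial>t\<^sup>s\<close> past \<open>dt\<^sup>r\<close>. The form vanishes iff its coefficients
  vanish after symmetrization with \<open>dt\<^sup>s dt\<^sup>r = (-1)\<^sup>(\<^sup>s\<^sup>+\<^sup>1\<^sup>)\<^sup>(\<^sup>r\<^sup>+\<^sup>1\<^sup>) dt\<^sup>r dt\<^sup>s\<close>.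
\<close>

definition pullback_omega ::
  "kind list \<Rightarrow> (nat \<Rightarrow> sfun) \<Rightarrow> (nat \<Rightarrow> sfun) \<Rightarrow> nat \<Rightarrow> nat \<Rightarrow> (nat \<Rightarrow> scalar) \<Rightarrow> scalar" where
  "pullback_omega ks x p s r T = (\<Sum>a<length ks.
     (- 1) ^ ((par ks s + par ks a) * (par ks r + 1)) *
     seval ks (left_deriv ks s (p a)) T * seval ks (left_deriv ks r (x a)) T)"

definition isotropic_param ::
  "kind list \<Rightarrow> (nat \<Rightarrow> real) set \<Rightarrow> (nat \<Rightarrow> sfun) \<Rightarrow> (nat \<Rightarrow> sfun) \<Rightarrow> bool" where
  "isotropic_param ks W x p \<longleftrightarrow> (\<forall>T\<in>spoints ks W. \<forall>s<length ks. \<forall>r<length ks.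
     pullback_omega ks x p s r T +
     (- 1) ^ ((par ks s + 1) * (par ks r + 1)) * pullback_omega ks x p r s T = 0)"

definition body_map :: "kind list \<Rightarrow> (nat \<Rightarrow> sfun) \<Rightarrow> (nat \<Rightarrow> real) \<Rightarrow> nat \<Rightarrow> real" where
  "body_map ks x t = (\<lambda>a. if a \<in> even_idx ks then sbody (x a t (\<lambda>_. 0)) else 0)"

text \<open>
  An embedding into \<open>T\<^sup>*\<close> of a coordinate domain with the same kinds of coordinates: a topological
  embedding whose Jacobian (with its even-even and odd-odd blocks) is injective at all underlying
  points.
\<close>

definition embedding_param ::
  "kind list \<Rightarrow> (nat \<Rightarrow> real) set \<Rightarrow> (nat \<Rightarrow> sfun) \<Rightarrow> (nat \<Rightarrow> sfun) \<Rightarrow> bool" where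
  "embedding_param ks W x p \<longleftrightarrow>
     (\<forall>a<length ks. \<forall>F\<in>{x a, p a}. smooth_sfun ks W F \<and> sfun_parity ks W (ks ! a = Odd) F) \<and>
     (let j = (\<lambda>t. (body_map ks x t, body_map ks p t)) in \<exists>h. homeomorphism W (j ` W) j h) \<and>
     (\<forall>t\<in>W. \<forall>v :: nat \<Rightarrow> real.
        (\<forall>a<length ks. \<forall>F\<in>{x a, p a}.
           (\<Sum>s<length ks. v s * sbody (left_deriv ks s F t (\<lambda>_. 0))) = 0) \<longrightarrow>
        (\<forall>s<length ks. v s = 0))"

text \<open>
  \<open>L\<close> is a Lagrangian submanifold if, near each of its points and in every chart, it is an embedded
  submanifold of the same dimension (even and odd) as \<open>M\<close> on which the symplectic form vanishes.
\<close>

definition lagrangian_submanifold :: "('p, 'c) smanifold \<Rightarrow> ('p, 'c) cotpoint set \<Rightarrow> bool" where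
  "lagrangian_submanifold M L \<longleftrightarrow> L \<subseteq> cotangent_bundle M \<and>
     (\<forall>(m, X, P)\<in>L. \<forall>c\<in>charts_at M m.
        let ks = mf_kinds M; B = body_space ks in
        \<exists>N W x p.
          openin (top_of_set (B \<times> B)) N \<and> N \<subseteq> (mf_coord M c ` mf_dom M c) \<times> B \<and>
          (body_vec ks (X c), body_vec ks (P c)) \<in> N \<and>
          openin (top_of_set B) W \<and>
          embedding_param ks W x p \<and> isotropic_param ks W x p \<and>
          {(X' c, P' c) | m' X' P'. (m', X', P') \<in> L \<and> c \<in> charts_at M m' \<and>
             (body_vec ks (X' c), body_vec ks (P' c)) \<in> N} =
          {(\<lambda>a. if a < length ks then seval ks (x a) T else 0,
            \<lambda>a. if a < length ks then seval ks (p a) T else 0) | T. T \<in> spoints ks W})"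

section \<open>Canonical relations with a generating function\<close>

text \<open>
  A generating function in charts \<open>c\<close> of \<open>M\<^sub>1\<close> and \<open>d\<close> of \<open>M\<^sub>2\<close> is a superfunction of the
  coordinates \<open>x\<close>, followed by the momenta \<open>q\<close> (in which it is a formal power series).
\<close>

definition gf_kinds :: "('p, 'c) smanifold \<Rightarrow> ('q, 'd) smanifold \<Rightarrow> kind list" where
  "gf_kinds M1 M2 = mf_kinds M1 @ map (\<lambda>k. if k = Odd then Odd else Formal) (mf_kinds M2)"

definition gf_args :: "('p, 'c) smanifold \<Rightarrow> (nat \<Rightarrow> scalar) \<Rightarrow> (nat \<Rightarrow> scalar) \<Rightarrow> nat \<Rightarrow> scalar" where
  "gf_args M1 x q = (\<lambda>i. if i < mf_dim M1 then x i else q (i - mf_dim M1))"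

definition gf_eval :: "('p, 'c) smanifold \<Rightarrow> ('q, 'd) smanifold \<Rightarrow> sfun \<Rightarrow>
    (nat \<Rightarrow> scalar) \<Rightarrow> (nat \<Rightarrow> scalar) \<Rightarrow> scalar" where
  "gf_eval M1 M2 S x q = seval (gf_kinds M1 M2) S (gf_args M1 x q)"

definition gf_dx :: "('p, 'c) smanifold \<Rightarrow> ('q, 'd) smanifold \<Rightarrow> nat \<Rightarrow> sfun \<Rightarrow> sfun" where
  "gf_dx M1 M2 a S = left_deriv (gf_kinds M1 M2) a S"

definition gf_dq :: "('p, 'c) smanifold \<Rightarrow> ('q, 'd) smanifold \<Rightarrow> nat \<Rightarrow> sfun \<Rightarrow> sfun" where
  "gf_dq M1 M2 i S = left_deriv (gf_kinds M1 M2) (mf_dim M1 + i) S"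

text \<open>The right-hand side of \<open>y\<^sup>i = (-1)\<^sup>i \<partial>S/\<partial>q\<^sub>i(x, q)\<close>.\<close>

definition gf_y :: "('p, 'c) smanifold \<Rightarrow> ('q, 'd) smanifold \<Rightarrow> sfun \<Rightarrow>
    (nat \<Rightarrow> scalar) \<Rightarrow> (nat \<Rightarrow> scalar) \<Rightarrow> nat \<Rightarrow> scalar" where
  "gf_y M1 M2 S x q i = (- 1) ^ par (mf_kinds M2) i * gf_eval M1 M2 (gf_dq M1 M2 i S) x q"

text \<open>
  \<open>S\<close> is defined for every pair of charts. \<open>\<phi>\<close> is the underlying map of \<open>y\<^sup>i = \<phi>\<^sup>i(x)\<close>, the
  coefficients of the first-order terms of \<open>S\<close> in \<open>q\<close>; it determines where \<open>S c d\<close> is defined. The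
  last clause is the transformation law \<open>S' = S - y\<^sup>i q\<^sub>i + y'\<^sup>i q'\<^sub>i\<close>: the relations between
  \<open>x, x'\<close>, \<open>y, y'\<close> and \<open>q, q'\<close> are part of the notion of a point of \<open>M\<^sub>1\<close> and of \<open>T\<^sup>*M\<^sub>2\<close>.
\<close>

definition generating_function :: "('p, 'c) smanifold \<Rightarrow> ('q, 'd) smanifold \<Rightarrow>
    ('p \<Rightarrow> 'q) \<Rightarrow> ('c \<Rightarrow> 'd \<Rightarrow> sfun) \<Rightarrow> bool" where
  "generating_function M1 M2 \<phi> S \<longleftrightarrow>
     continuous_map (mf_top M1) (mf_top M2) \<phi> \<and>
     (\<forall>c\<in>mf_charts M1. \<forall>d\<in>mf_charts M2.
        let D = {m \<in> mf_dom M1 c. \<phi> m \<in> mf_dom M2 d}; U = mf_coord M1 c ` D in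
        smooth_sfun (gf_kinds M1 M2) U (S c d) \<and>
        sfun_parity (gf_kinds M1 M2) U False (S c d) \<and>
        eps_free (gf_kinds M1 M2) U (S c d) \<and>
        (\<forall>m\<in>D. \<forall>i\<in>even_idx (mf_kinds M2).
           sbody (gf_dq M1 M2 i (S c d) (mf_coord M1 c m) (\<lambda>_. 0)) = mf_coord M2 d (\<phi> m) i)) \<and>
     (\<forall>(m, X)\<in>mf_points M1. \<forall>(n, Y, Q)\<in>cotangent_bundle M2.
        \<forall>c\<in>charts_at M1 m. \<forall>c'\<in>charts_at M1 m. \<forall>d\<in>charts_at M2 n. \<forall>d'\<in>charts_at M2 n.
        n = \<phi> m \<and> (\<forall>i<mf_dim M2. sbody (Q d i) = 0) \<and>
        (\<forall>i<mf_dim M2. Y d i = gf_y M1 M2 (S c d) (X c) (Q d) i) \<longrightarrow>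
        gf_eval M1 M2 (S c' d') (X c') (Q d') =
          gf_eval M1 M2 (S c d) (X c) (Q d)
          - (\<Sum>i<mf_dim M2. Y d i * Q d i) + (\<Sum>i<mf_dim M2. Y d' i * Q d' i))"

text \<open>
  The relation \<open>\<Phi>\<close> between \<open>T\<^sup>*M\<^sub>1\<close> and \<open>T\<^sup>*M\<^sub>2\<close> specified by \<open>S\<close>: in any coordinates it is given by
  \<open>p\<^sub>a = \<partial>S/\<partial>x\<^sup>a\<close>, \<open>y\<^sup>i = (-1)\<^sup>i \<partial>S/\<partial>q\<^sub>i\<close> (the transformation law of \<open>S\<close> makes this description
  consistent across charts). It is a formal relation: the momenta \<open>q\<close> have zero body, so the
  underlying points are related by \<open>n = \<phi> m\<close>.
\<close>

definition canonical_relation :: "('p, 'c) smanifold \<Rightarrow> ('q, 'd) smanifold \<Rightarrow>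
    ('p \<Rightarrow> 'q) \<Rightarrow> ('c \<Rightarrow> 'd \<Rightarrow> sfun) \<Rightarrow> (('p, 'c) cotpoint \<times> ('q, 'd) cotpoint) set \<Rightarrow> bool" where
  "canonical_relation M1 M2 \<phi> S \<Phi> \<longleftrightarrow>
     generating_function M1 M2 \<phi> S \<and>
     \<Phi> \<subseteq> cotangent_bundle M1 \<times> cotangent_bundle M2 \<and>
     (\<forall>(m, X, P)\<in>cotangent_bundle M1. \<forall>(n, Y, Q)\<in>cotangent_bundle M2.
        \<forall>c\<in>charts_at M1 m. \<forall>d\<in>charts_at M2 n.
        ((m, X, P), (n, Y, Q)) \<in> \<Phi> \<longleftrightarrow>
          n = \<phi> m \<and> (\<forall>i<mf_dim M2. sbody (Q d i) = 0) \<and>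
          (\<forall>a<mf_dim M1. P c a = gf_eval M1 M2 (gf_dx M1 M2 a (S c d)) (X c) (Q d)) \<and>
          (\<forall>i<mf_dim M2. Y d i = gf_y M1 M2 (S c d) (X c) (Q d) i))"

text \<open>The composition \<open>p\<^sub>1(\<Phi> \<inter> p\<^sub>2\<^sup>-\<^sup>1(L))\<close>.\<close>

definition relation_image :: "('a \<times> 'b) set \<Rightarrow> 'b set \<Rightarrow> 'a set" where
  "relation_image \<Phi> L = fst ` (\<Phi> \<inter> snd -` L)"

text \<open>
  The equations \<open>q\<^sub>i = \<partial>g/\<partial>y\<^sup>i(y)\<close>, \<open>y\<^sup>i = (-1)\<^sup>i \<partial>S/\<partial>q\<^sub>i(x, q)\<close> in charts \<open>c\<close>, \<open>d\<close>.
\<close>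

definition pullback_equations :: "('p, 'c) smanifold \<Rightarrow> ('q, 'd) smanifold \<Rightarrow>
    ('c \<Rightarrow> 'd \<Rightarrow> sfun) \<Rightarrow> ('d \<Rightarrow> sfun) \<Rightarrow> 'c \<Rightarrow> 'd \<Rightarrow>
    (nat \<Rightarrow> scalar) \<Rightarrow> (nat \<Rightarrow> scalar) \<Rightarrow> (nat \<Rightarrow> scalar) \<Rightarrow> bool" where
  "pullback_equations M1 M2 S g c d x y q \<longleftrightarrow>
     y \<in> spoints (mf_kinds M2) (mf_coord M2 d ` mf_dom M2 d) \<and> q \<in> coord_tuples (mf_kinds M2) \<and>
     (\<forall>i<mf_dim M2. q i = seval (mf_kinds M2) (left_deriv (mf_kinds M2) i (g d)) y) \<and>
     (\<forall>i<mf_dim M2. y i = gf_y M1 M2 (S c d) x q i)"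

end

theory Submission
  imports Defs
begin

text \<open>
  Everything is computed along real curves of scalar-valued points. A superfunction obeys the chain
  rule along such curves, and conversely a map of points whose partial derivatives of all orders
  exist in this sense is a superfunction; hence superfunctions are closed under composition. As
  \<open>q = \<epsilon> \<partial>g/\<partial>y(y)\<close> gains one order in \<open>\<epsilon>\<close>, the equations for \<open>y\<close> and \<open>q\<close> are a contraction in the
  \<open>\<epsilon>\<close>-adic sense: their solution is unique, and it is a superfunction of \<open>x\<close> as the limit of the
  iterates. In the derivative of \<open>f = g(y) + S(x, q) - y\<^sup>i q\<^sub>i\<close> the variations of \<open>y\<close> and \<open>q\<close> cancel, so
  \<open>\<partial>f/\<partial>x = \<partial>S/\<partial>x(x, q)\<close>. Independence of the charts follows from the transformation law of \<open>S\<close>, and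
  a graph of a derivative is Lagrangian because second derivatives supercommute.
\<close>

section \<open>Scalars\<close>

subsection \<open>Coefficients\<close>

text \<open>Composing superfunctions through their Taylor series would require a multivariate chain
  rule of every order, with all its factorials and signs. Avoiding it shapes the proof: only the
  first-order chain rule (\<open>has_partials_seval\<close>) is read off from the series, and all
  higher orders come from classes of maps that are closed under partial derivatives. Real curves
  suffice because a scalar is a family of real coefficients and each coefficient of a product is a
  finite sum, so one-variable calculus applies to every coefficient. Moving the coordinate
  \<open>a\<close> of \<open>X\<close> by \<open>s\<close> times \<eta>, with \<eta> a generator or
  a product of two generators, gives the derivative \<open>\<eta> * D a X\<close>, and \<eta> can be
  cancelled since there are infinitely many generators. Such curves do not move the underlying
  point; so even derivatives in ordinary even directions can be compared over one underlying point.
  The momenta are formal coordinates, but every map that has to be recognised as a superfunction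
  depends on points of \<open>M1\<close> only, where no formal coordinates occur; \<open>q\<close>
  enters through substitution into \<open>S\<close>.\<close>

lemma scoeff_infinite [simp]: "infinite J \<Longrightarrow> scoeff a k J = 0"
  using Rep_grass[of "fps_nth a k"] by (simp add: scoeff_def)

lemma scalar_eqI:
  assumes "\<And>k J. finite J \<Longrightarrow> scoeff a k J = scoeff b k J"
  shows "a = b"
proof (rule fps_ext)
  fix k
  have "scoeff a k J = scoeff b k J" for J
    by (cases "finite J") (simp_all add: assms)
  hence "Rep_grass (fps_nth a k) = Rep_grass (fps_nth b k)"
    by (auto simp: scoeff_def fun_eq_iff)
  thus "fps_nth a k = fps_nth b k" by (simp add: Rep_grass_inject)
qed

lemma scoeff_0 [simp]: "scoeff 0 k J = 0"
  by (simp add: scoeff_def zero_grass.rep_eq)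

lemma scoeff_1: "scoeff 1 k J = (if k = 0 \<and> J = {} then 1 else 0)"
  by (simp add: scoeff_def zero_grass.rep_eq one_grass.rep_eq)

lemma scoeff_add [simp]: "scoeff (a + b) k J = scoeff a k J + scoeff b k J"
  by (simp add: scoeff_def plus_grass.rep_eq)

lemma scoeff_diff [simp]: "scoeff (a - b) k J = scoeff a k J - scoeff b k J"
  by (simp add: scoeff_def minus_grass.rep_eq)

lemma scoeff_minus [simp]: "scoeff (- a) k J = - scoeff a k J"
  by (simp add: scoeff_def uminus_grass.rep_eq)

lemma scoeff_sum: "scoeff (sum f A) k J = (\<Sum>x\<in>A. scoeff (f x) k J)"
  by (induction A rule: infinite_finite_induct) simp_all

lemma scoeff_mk_scalar [simp]: "scoeff (mk_scalar h) k J = (if finite J then h k J else 0)"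
  by (simp add: scoeff_def mk_scalar_def Abs_grass_inverse)

lemma Rep_grass_sum: "Rep_grass (sum f A) J = (\<Sum>x\<in>A. Rep_grass (f x) J)"
  by (induction A rule: infinite_finite_induct) (simp_all add: zero_grass.rep_eq plus_grass.rep_eq)

lemma scoeff_mult:
  assumes "finite J"
  shows "scoeff (a * b) k J =
    (\<Sum>i\<le>k. \<Sum>T\<in>Pow J. gsign T (J - T) * scoeff a i T * scoeff b (k - i) (J - T))"
  using assms by (simp add: scoeff_def fps_mult_nth Rep_grass_sum times_grass.rep_eq atLeast0AtMost)

text \<open>Multiplication adds degrees and joins sets of generators, so the coefficient at
  \<open>(k, J)\<close> sees only coefficients with \<open>i \<le> k\<close> and \<open>T\<close>
  inside \<open>J\<close>. This lets a truncated evaluation replace the full one inside a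
  product.\<close>

lemma scoeff_mult_cong:
  assumes "\<And>i T. i \<le> k \<Longrightarrow> T \<subseteq> J \<Longrightarrow> scoeff a i T = scoeff a' i T"
    and "\<And>i T. i \<le> k \<Longrightarrow> T \<subseteq> J \<Longrightarrow> scoeff b i T = scoeff b' i T"
  shows "scoeff (a * b) k J = scoeff (a' * b') k J"
  by (cases "finite J") (auto simp: scoeff_mult assms intro!: sum.cong)

lemma scoeff_real_scalar: "scoeff (real_scalar r) k J = (if k = 0 \<and> J = {} then r else 0)"
  by (simp add: scoeff_def real_scalar_def of_real_def zero_grass.rep_eq scaleR_grass.rep_eq one_grass.rep_eq)

lemma real_scalar_0 [simp]: "real_scalar 0 = 0"
  by (simp add: real_scalar_def)

lemma real_scalar_1 [simp]: "real_scalar 1 = 1"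
  by (simp add: real_scalar_def)

lemma real_scalar_add: "real_scalar (a + b) = real_scalar a + real_scalar b"
  by (simp add: real_scalar_def)

lemma real_scalar_minus: "real_scalar (- a) = - real_scalar a"
  by (simp add: real_scalar_def)

lemma real_scalar_mult: "real_scalar (a * b) = real_scalar a * real_scalar b"
  by (simp add: real_scalar_def)

lemma real_scalar_of_nat: "real_scalar (of_nat n) = of_nat n"
  by (simp add: real_scalar_def fps_of_nat)

lemma real_scalar_sign: "real_scalar ((- 1) ^ n) = (- 1) ^ n"
  by (induction n) (simp_all add: real_scalar_mult real_scalar_minus)

lemma scoeff_real_scalar_mult [simp]: "scoeff (real_scalar r * a) k J = r * scoeff a k J"
proof -
  have "fps_nth (real_scalar r * a) k = r *\<^sub>R fps_nth a k"
    by (simp add: real_scalar_def scaleR_conv_of_real)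
  thus ?thesis by (simp add: scoeff_def scaleR_grass.rep_eq)
qed

lemma real_scalar_commute: "a * real_scalar r = real_scalar r * a"
proof -
  have "x * of_real r = of_real r * x" for x :: grass
    by (simp add: of_real_def)
  thus ?thesis by (simp add: real_scalar_def fps_eq_iff)
qed

lemma scoeff_of_nat_mult [simp]: "scoeff (of_nat n * a) k J = of_nat n * scoeff a k J"
  by (metis real_scalar_of_nat scoeff_real_scalar_mult)

lemma scoeff_sign_mult [simp]: "scoeff ((- 1) ^ n * a) k J = (- 1) ^ n * scoeff a k J"
  by (metis real_scalar_sign scoeff_real_scalar_mult)

lemma sign_mult_commute: "a * (- 1) ^ n = (- 1) ^ n * (a :: scalar)"
  by (metis real_scalar_sign real_scalar_commute)

lemma scoeff_eps_mult: "scoeff (fps_X * a) k J = (if k = 0 then 0 else scoeff a (k - 1) J)"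
  by (simp add: scoeff_def zero_grass.rep_eq)

lemma eps_commute: "a * fps_X = fps_X * (a :: scalar)"
  by (rule fps_mult_fps_X_commute [symmetric])

lemma sbody_simps [simp]:
  "sbody 0 = 0" "sbody 1 = 1" "sbody (a + b) = sbody a + sbody b" "sbody (a - b) = sbody a - sbody b"
  "sbody (- a) = - sbody a" "sbody (real_scalar r) = r" "sbody (fps_X * a) = 0"
  by (simp_all add: sbody_def scoeff_1 scoeff_real_scalar scoeff_eps_mult)

lemma sbody_mult [simp]: "sbody (a * b) = sbody a * sbody b"
  by (simp add: sbody_def scoeff_mult)

subsection \<open>Parity\<close>

lemma has_parity_scoeff: "has_parity p a \<Longrightarrow> odd (card J) \<noteq> p \<Longrightarrow> scoeff a k J = 0"
  by (auto simp: has_parity_def)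

lemma has_parityI:
  assumes "\<And>k J. finite J \<Longrightarrow> odd (card J) \<noteq> p \<Longrightarrow> scoeff a k J = 0"
  shows "has_parity p a"
  unfolding has_parity_def by (metis assms scoeff_infinite)

lemma has_parity_0 [simp]: "has_parity p 0"
  by (simp add: has_parity_def)

lemma has_parity_1 [simp]: "has_parity False 1"
  by (simp add: has_parity_def scoeff_1)

lemma has_parity_real_scalar [simp]: "has_parity False (real_scalar r)"
  by (simp add: has_parity_def scoeff_real_scalar)

lemma has_parity_add: "has_parity p a \<Longrightarrow> has_parity p b \<Longrightarrow> has_parity p (a + b)"
  by (rule has_parityI) (simp add: has_parity_scoeff)

lemma has_parity_diff: "has_parity p a \<Longrightarrow> has_parity p b \<Longrightarrow> has_parity p (a - b)"
  by (rule has_parityI) (simp add: has_parity_scoeff)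

lemma has_parity_sum: "(\<And>x. x \<in> A \<Longrightarrow> has_parity p (f x)) \<Longrightarrow> has_parity p (sum f A)"
  by (rule has_parityI) (auto intro!: has_parity_scoeff sum.neutral simp: scoeff_sum)

lemma card_split: "finite J \<Longrightarrow> T \<subseteq> J \<Longrightarrow> card J = card T + card (J - T)"
  using card_Diff_subset[of T J] card_mono[of J T] finite_subset[of T J] by simp

lemma has_parity_mult:
  assumes "has_parity p a" "has_parity q b"
  shows "has_parity (p \<noteq> q) (a * b)"
proof (rule has_parityI)
  fix k J assume J: "finite (J :: nat set)" "odd (card J) \<noteq> (p \<noteq> q)"
  have "scoeff a i T * scoeff b l (J - T) = 0" if "T \<subseteq> J" for i l T
  proof -
    have "card J = card T + card (J - T)"
      using that J(1) by (intro card_split)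
    hence "odd (card T) \<noteq> p \<or> odd (card (J - T)) \<noteq> q" using J(2) by auto
    thus ?thesis using has_parity_scoeff[OF assms(1)] has_parity_scoeff[OF assms(2)] by auto
  qed
  thus "scoeff (a * b) k J = 0"
    unfolding scoeff_mult[OF J(1)] mult.assoc by (intro sum.neutral ballI) (auto simp del: mult_eq_0_iff)
qed

lemma has_parity_mult_even: "has_parity False a \<Longrightarrow> has_parity q b \<Longrightarrow> has_parity q (a * b)"
  using has_parity_mult[of False a q b] by simp

lemma has_parity_real_scalar_mult: "has_parity p a \<Longrightarrow> has_parity p (real_scalar r * a)"
  by (rule has_parity_mult_even) simp_all

lemma has_parity_sign_mult: "has_parity p a \<Longrightarrow> has_parity p ((- 1) ^ n * a)"
  by (metis has_parity_real_scalar_mult real_scalar_sign)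

lemma has_parity_eps_mult: "has_parity p a \<Longrightarrow> has_parity p (fps_X * a)"
  by (rule has_parityI) (simp add: has_parity_scoeff scoeff_eps_mult)

lemma has_parity_power: "has_parity False a \<Longrightarrow> has_parity False (a ^ n)"
  by (induction n) (simp_all add: has_parity_mult_even)

lemma sbody_odd: "has_parity True a \<Longrightarrow> sbody a = 0"
  by (simp add: has_parity_scoeff sbody_def)

text \<open>For disjoint \<open>T\<close> and \<open>U\<close> each pair in
  \<open>T \<times> U\<close> is an inversion of exactly one of the words \<open>T U\<close> and
  \<open>U T\<close>, so the two inversion numbers add up to \<open>card T * card U\<close>.\<close>

lemma gsign_swap:
  assumes "finite T" "finite U" "T \<inter> U = {}"
  shows "gsign T U = (- 1) ^ (card T * card U) * gsign U T"
proof -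
  have "bij_betw prod.swap {(u, t). u \<in> U \<and> t \<in> T \<and> t < u} {(t, u). t \<in> T \<and> u \<in> U \<and> t < u}"
    by (rule bij_betwI[of _ _ _ prod.swap]) auto
  hence "inversions U T = card {(t, u). t \<in> T \<and> u \<in> U \<and> t < u}"
    unfolding inversions_def by (rule bij_betw_same_card)
  moreover have "T \<times> U = {(t, u). t \<in> T \<and> u \<in> U \<and> t < u} \<union> {(t, u). t \<in> T \<and> u \<in> U \<and> u < t}"
    using assms(3) by (auto simp: neq_iff)
  moreover have "finite {(t, u). t \<in> T \<and> u \<in> U \<and> t < u}"
    by (rule finite_subset[of _ "T \<times> U"]) (use assms in auto)
  moreover have "{(t, u). t \<in> T \<and> u \<in> U \<and> t < u} \<inter> {(t, u). t \<in> T \<and> u \<in> U \<and> u < t} = {}"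
    by auto
  ultimately have "card (T \<times> U) = inversions U T + inversions T U"
    using inversions_finite[OF assms(1,2)] by (simp add: card_Un_disjoint) (simp add: inversions_def)
  hence e: "card T * card U = inversions U T + inversions T U"
    by (simp add: card_cartesian_product)
  have "((- 1) ^ inversions U T * (- 1) ^ inversions U T :: real) = 1"
    by (simp flip: power_mult_distrib)
  thus ?thesis by (simp add: e gsign_def power_add)
qed

text \<open>In every nonzero term \<open>card T\<close> and \<open>card (J - T)\<close> have the
  parities \<open>p\<close> and \<open>q\<close>, so the shuffle signs of both orders differ by the
  same factor throughout. Reflecting the indices, \<open>i\<close> to \<open>k - i\<close> and
  \<open>T\<close> to its complement in \<open>J\<close>, then exchanges the two products.\<close>

lemma supercommute:
  assumes "has_parity p a" "has_parity q b"
  shows "a * b = (- 1) ^ (of_bool p * of_bool q) * (b * a)"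
proof (rule scalar_eqI)
  fix k J assume J: "finite (J :: nat set)"
  let ?s = "(- 1) ^ (of_bool p * of_bool q) :: real"
  have *: "gsign T (J - T) * scoeff a i T * scoeff b l (J - T)
      = ?s * (gsign (J - T) T * scoeff b l (J - T) * scoeff a i T)" if "T \<subseteq> J" for i l T
  proof (cases "scoeff a i T = 0 \<or> scoeff b l (J - T) = 0")
    case False
    hence "odd (card T) = p" "odd (card (J - T)) = q" using assms by (auto simp: has_parity_def)
    hence "(- 1 :: real) ^ (card T * card (J - T)) = ?s" by (auto simp: uminus_power_if)
    thus ?thesis using gsign_swap[of T "J - T"] that J finite_subset by fastforce
  qed auto
  have "scoeff (a * b) k J = (\<Sum>i\<le>k. \<Sum>T\<in>Pow J. ?s * (gsign (J - T) T * scoeff b (k - i) (J - T) * scoeff a i T))"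
    unfolding scoeff_mult[OF J] by (intro sum.cong refl *) auto
  also have "\<dots> = (\<Sum>i\<le>k. \<Sum>T\<in>Pow J. ?s * (gsign T (J - T) * scoeff b i T * scoeff a (k - i) (J - T)))"
  proof (rule sum.reindex_bij_witness[of _ "\<lambda>i. k - i" "\<lambda>i. k - i"], goal_cases)
    case (5 i)
    show ?case
      by (rule sum.reindex_bij_witness[of _ "\<lambda>T. J - T" "\<lambda>T. J - T"]) (use 5 in \<open>auto simp: double_diff\<close>)
  qed auto
  also have "\<dots> = scoeff ((- 1) ^ (of_bool p * of_bool q) * (b * a)) k J"
    unfolding scoeff_sign_mult scoeff_mult[OF J, of b a] by (simp add: sum_distrib_left)
  finally show "scoeff (a * b) k J = scoeff ((- 1) ^ (of_bool p * of_bool q) * (b * a)) k J" .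
qed

text \<open>\<open>b\<close> may be inhomogeneous: it is split into its even and odd parts, and
  \<open>a\<close> commutes with each.\<close>

lemma even_commute: "has_parity False a \<Longrightarrow> a * b = b * a"
proof -
  assume a: "has_parity False a"
  define b0 b1 where "b0 = mk_scalar (\<lambda>k J. if odd (card J) then 0 else scoeff b k J)"
    and "b1 = mk_scalar (\<lambda>k J. if odd (card J) then scoeff b k J else 0)"
  have b: "b = b0 + b1" by (rule scalar_eqI) (simp add: b0_def b1_def)
  have p: "has_parity False b0" "has_parity True b1" by (auto intro!: has_parityI simp: b0_def b1_def)
  show ?thesis using supercommute[OF a p(1)] supercommute[OF a p(2)]
    by (simp add: b distrib_left distrib_right)
qed

lemma odd_square: "has_parity True a \<Longrightarrow> a * a = 0"
proof -
  assume a: "has_parity True a"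
  have "a * a = - (a * a)" using supercommute[OF a a] by simp
  hence "scoeff (a * a) k J = - scoeff (a * a) k J" for k J by (metis scoeff_minus)
  thus ?thesis by (intro scalar_eqI) (simp add: eq_neg_iff_add_eq_0)
qed

subsection \<open>Generators\<close>

definition theta :: "nat \<Rightarrow> scalar" where
  "theta N = mk_scalar (\<lambda>k J. if k = 0 \<and> J = {N} then 1 else 0)"

lemma scoeff_theta: "scoeff (theta N) k J = (if k = 0 \<and> J = {N} then 1 else 0)"
  by (auto simp: theta_def)

lemma has_parity_theta [simp]: "has_parity True (theta N)"
  by (auto simp: has_parity_def scoeff_theta)

lemma scoeff_theta_mult:
  assumes "finite J" "N \<notin> J"
  shows "scoeff (theta N * a) k (insert N J) = gsign {N} J * scoeff a k J"
proof -
  have "scoeff (theta N * a) k (insert N J) = (\<Sum>i\<le>k. \<Sum>T\<in>Pow (insert N J).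
      gsign T (insert N J - T) * scoeff (theta N) i T * scoeff a (k - i) (insert N J - T))"
    using assms by (simp add: scoeff_mult)
  also have "\<dots> = (\<Sum>i\<le>k. \<Sum>T\<in>{{N}}.
      gsign T (insert N J - T) * scoeff (theta N) i T * scoeff a (k - i) (insert N J - T))"
    using assms by (intro sum.cong refl sum.mono_neutral_right) (auto simp: scoeff_theta)
  also have "\<dots> = (\<Sum>i\<le>k. gsign {N} J * scoeff (theta N) i {N} * scoeff a (k - i) J)"
    using assms by (simp add: insert_Diff_if)
  also have "\<dots> = (\<Sum>i\<in>{0}. gsign {N} J * scoeff (theta N) i {N} * scoeff a (k - i) J)"
    by (rule sum.mono_neutral_right) (auto simp: scoeff_theta)
  finally show ?thesis by (simp add: scoeff_theta)
qed

lemma gsign_nonzero: "gsign T U \<noteq> 0"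
  by (simp add: gsign_def)

text \<open>Here the infinite supply of generators is used: some \<open>N\<close> lies outside the
  finite \<open>J\<close>, and multiplication by \<open>theta N\<close> moves the coefficient at
  \<open>J\<close> to \<open>insert N J\<close>, up to a sign.\<close>

lemma theta_cancel_coeff:
  assumes "\<And>N J. scoeff (theta N * a) k J = 0"
  shows "scoeff a k J = 0"
proof (cases "finite J")
  case True
  then obtain N where "N \<notin> J" using ex_new_if_finite infinite_UNIV_nat by blast
  thus ?thesis using scoeff_theta_mult[OF True, of N a k] assms gsign_nonzero by simp
qed simp

text \<open>Perturbation parameters that do not move the underlying point.\<close>

definition soul_param :: "bool \<Rightarrow> scalar \<Rightarrow> bool" where
  "soul_param p \<eta> \<longleftrightarrow> has_parity p \<eta> \<and> sbody \<eta> = 0 \<and> \<eta> * \<eta> = 0"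

lemma soul_param_theta: "soul_param True (theta N)"
  by (simp add: soul_param_def sbody_def scoeff_theta odd_square)

text \<open>Even directions call for an even parameter with zero body and zero square; a product of
  two generators is one.\<close>

lemma soul_param_theta_theta: "soul_param False (theta N * theta M)"
proof -
  have p: "has_parity False (theta N * theta M)" using has_parity_mult[of True "theta N" True "theta M"] by simp
  have "theta N * theta M * (theta N * theta M) = theta N * theta M * theta N * theta M"
    by (simp only: mult.assoc)
  also have "theta N * theta M * theta N = theta N * (theta N * theta M)"
    by (rule even_commute[OF p])
  also have "\<dots> * theta M = theta N * theta N * (theta M * theta M)"
    by (simp only: mult.assoc)
  finally have "theta N * theta M * (theta N * theta M) = 0"
    by (simp add: odd_square)
  thus ?thesis using p by (simp add: soul_param_def sbody_def[of "theta _"] scoeff_theta)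
qed

text \<open>In the even case the two generators of \<open>theta N * theta M\<close> are cancelled
  one after the other. The degree \<open>k\<close> stays fixed while \<open>J\<close> varies, so the
  lemma also serves congruences modulo powers of \<epsilon>.\<close>

lemma soul_param_cancel_coeff:
  assumes "\<And>\<eta> J. soul_param p \<eta> \<Longrightarrow> scoeff (\<eta> * a) k J = 0"
  shows "scoeff a k J = 0"
proof (cases p)
  case True
  thus ?thesis using assms soul_param_theta theta_cancel_coeff by metis
next
  case False
  show ?thesis
    by (rule theta_cancel_coeff, rule theta_cancel_coeff)
      (use False assms soul_param_theta_theta in \<open>simp add: mult.assoc [symmetric]\<close>)
qed

lemma soul_param_cancel:
  assumes "\<And>\<eta>. soul_param p \<eta> \<Longrightarrow> \<eta> * a = \<eta> * b"
  shows "a = b"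
proof (rule scalar_eqI)
  fix k J
  have "scoeff (a - b) k J = 0"
    by (rule soul_param_cancel_coeff[of p]) (simp add: assms right_diff_distrib)
  thus "scoeff a k J = scoeff b k J" by simp
qed

subsection \<open>The filtration by degree in \<open>\<epsilon>\<close> and \<open>\<theta>\<close>\<close>

text \<open>The degree counts \<epsilon> and each generator once. A scalar without body has order at
  least 1, so products of souls have growing order and Taylor sums are finite in each
  coefficient.\<close>

definition sord :: "nat \<Rightarrow> scalar \<Rightarrow> bool" where
  "sord n a \<longleftrightarrow> (\<forall>k J. finite J \<longrightarrow> k + card J < n \<longrightarrow> scoeff a k J = 0)"

lemma sord_0 [simp]: "sord 0 a"
  by (simp add: sord_def)

lemma sord_1: "sbody a = 0 \<Longrightarrow> sord 1 a"
  by (simp add: sord_def sbody_def)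

lemma sord_mult:
  assumes "sord m a" "sord n b"
  shows "sord (m + n) (a * b)"
  unfolding sord_def
proof (intro allI impI)
  fix k J assume J: "finite (J :: nat set)" "k + card J < m + n"
  have "scoeff a i T * scoeff b (k - i) (J - T) = 0" if "T \<subseteq> J" "i \<le> k" for i T
  proof -
    have "card J = card T + card (J - T)"
      using that J(1) by (intro card_split)
    hence "i + card T < m \<or> (k - i) + card (J - T) < n" using J(2) that by linarith
    moreover have "finite T" "finite (J - T)" using J that finite_subset by auto
    ultimately show ?thesis using assms unfolding sord_def by auto
  qed
  thus "scoeff (a * b) k J = 0"
    unfolding scoeff_mult[OF J(1)] mult.assoc by (intro sum.neutral ballI) (auto simp del: mult_eq_0_iff)
qed

lemma sord_power: "sord 1 a \<Longrightarrow> sord n (a ^ n)"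
  by (induction n) (use sord_mult[of 1 a] in auto)

lemma sord_prod_list:
  "(\<And>i. i \<in> set is \<Longrightarrow> sord (e i) (f i)) \<Longrightarrow> sord (sum_list (map e is)) (prod_list (map f is))"
  by (induction "is") (auto intro!: sord_mult)

subsection \<open>Congruence modulo powers of \<open>\<epsilon>\<close>\<close>

definition eps_cong :: "nat \<Rightarrow> scalar \<Rightarrow> scalar \<Rightarrow> bool" where
  "eps_cong K a b \<longleftrightarrow> (\<forall>k<K. \<forall>J. scoeff a k J = scoeff b k J)"

lemma eps_cong_refl [simp]: "eps_cong K a a"
  by (simp add: eps_cong_def)

lemma eps_cong_sym: "eps_cong K a b \<Longrightarrow> eps_cong K b a"
  by (simp add: eps_cong_def)

lemma eps_cong_trans: "eps_cong K a b \<Longrightarrow> eps_cong K b c \<Longrightarrow> eps_cong K a c"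
  by (simp add: eps_cong_def)

lemma eps_cong_mono: "eps_cong K a b \<Longrightarrow> L \<le> K \<Longrightarrow> eps_cong L a b"
  by (simp add: eps_cong_def)

lemma eps_cong_diff: "eps_cong K a a' \<Longrightarrow> eps_cong K b b' \<Longrightarrow> eps_cong K (a - b) (a' - b')"
  by (simp add: eps_cong_def)

lemma eps_cong_sum: "(\<And>x. x \<in> A \<Longrightarrow> eps_cong K (f x) (g x)) \<Longrightarrow> eps_cong K (sum f A) (sum g A)"
  by (simp add: eps_cong_def scoeff_sum)

lemma eps_cong_mult:
  "eps_cong K a a' \<Longrightarrow> eps_cong K b b' \<Longrightarrow> eps_cong K (a * b) (a' * b')"
  unfolding eps_cong_def by (intro allI impI scoeff_mult_cong) auto

lemma eps_cong_power: "eps_cong K a a' \<Longrightarrow> eps_cong K (a ^ n) (a' ^ n)"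
  by (induction n) (auto intro: eps_cong_mult)

lemma eps_cong_prod_list:
  "(\<And>i. i \<in> set is \<Longrightarrow> eps_cong K (f i) (g i)) \<Longrightarrow> eps_cong K (prod_list (map f is)) (prod_list (map g is))"
  by (induction "is") (auto intro!: eps_cong_mult)

lemma eps_cong_eps_mult: "eps_cong K a b \<Longrightarrow> eps_cong (Suc K) (fps_X * a) (fps_X * b)"
  by (auto simp: eps_cong_def scoeff_eps_mult)

lemma eps_cong_sbody: "eps_cong K a b \<Longrightarrow> 0 < K \<Longrightarrow> sbody a = sbody b"
  by (simp add: eps_cong_def sbody_def)

lemma eps_cong_eqI: "(\<And>K. eps_cong K a b) \<Longrightarrow> a = b"
  by (rule scalar_eqI) (auto simp: eps_cong_def)

subsection \<open>Derivatives of scalar-valued curves\<close>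

text \<open>Differentiability is asked of each real coefficient separately, so the scalars carry no
  topology; products respect it because their coefficients are finite sums.\<close>

definition has_sderiv :: "(real \<Rightarrow> scalar) \<Rightarrow> scalar \<Rightarrow> real \<Rightarrow> bool" where
  "has_sderiv a a' t \<longleftrightarrow>
     (\<forall>k J. ((\<lambda>s. scoeff (a s) k J) has_real_derivative scoeff a' k J) (at t))"

lemma has_sderivI:
  assumes "\<And>k J. finite J \<Longrightarrow> ((\<lambda>s. scoeff (a s) k J) has_real_derivative scoeff a' k J) (at t)"
  shows "has_sderiv a a' t"
  unfolding has_sderiv_def
proof (intro allI)
  fix k J show "((\<lambda>s. scoeff (a s) k J) has_real_derivative scoeff a' k J) (at t)"
    by (cases "finite J") (simp_all add: assms)
qed

lemma has_sderivD: "has_sderiv a a' t \<Longrightarrow> ((\<lambda>s. scoeff (a s) k J) has_real_derivative scoeff a' k J) (at t)"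
  by (simp add: has_sderiv_def)

lemma has_sderiv_const [simp]: "has_sderiv (\<lambda>_. c) 0 t"
  by (simp add: has_sderiv_def)

lemma has_sderiv_add: "has_sderiv a a' t \<Longrightarrow> has_sderiv b b' t \<Longrightarrow> has_sderiv (\<lambda>s. a s + b s) (a' + b') t"
  by (auto simp: has_sderiv_def intro!: derivative_intros)

lemma has_sderiv_diff: "has_sderiv a a' t \<Longrightarrow> has_sderiv b b' t \<Longrightarrow> has_sderiv (\<lambda>s. a s - b s) (a' - b') t"
  by (auto simp: has_sderiv_def intro!: derivative_intros)

lemma has_sderiv_sum:
  "(\<And>i. i \<in> A \<Longrightarrow> has_sderiv (a i) (a' i) t) \<Longrightarrow> has_sderiv (\<lambda>s. \<Sum>i\<in>A. a i s) (\<Sum>i\<in>A. a' i) t"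
  by (auto simp: has_sderiv_def scoeff_sum intro!: derivative_intros)

lemma has_sderiv_mult:
  assumes "has_sderiv a a' t" "has_sderiv b b' t"
  shows "has_sderiv (\<lambda>s. a s * b s) (a' * b t + a t * b') t"
proof (rule has_sderivI)
  fix k J assume J: "finite (J :: nat set)"
  have "((\<lambda>s. \<Sum>i\<le>k. \<Sum>T\<in>Pow J. gsign T (J - T) * (scoeff (a s) i T * scoeff (b s) (k - i) (J - T)))
      has_real_derivative (\<Sum>i\<le>k. \<Sum>T\<in>Pow J. gsign T (J - T) *
        (scoeff a' i T * scoeff (b t) (k - i) (J - T) + scoeff b' (k - i) (J - T) * scoeff (a t) i T))) (at t)"
    by (intro DERIV_sum DERIV_cmult DERIV_mult has_sderivD assms)
  thus "((\<lambda>s. scoeff (a s * b s) k J) has_real_derivative scoeff (a' * b t + a t * b') k J) (at t)"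
    using J by (simp add: scoeff_mult sum.distrib algebra_simps)
qed

lemma has_sderiv_cmult: "has_sderiv a a' t \<Longrightarrow> has_sderiv (\<lambda>s. c * a s) (c * a') t"
  using has_sderiv_mult[OF has_sderiv_const, of a a' t c] by simp

lemma has_sderiv_real_scalar:
  "(r has_real_derivative r') (at t) \<Longrightarrow> has_sderiv (\<lambda>s. real_scalar (r s)) (real_scalar r') t"
  by (auto simp: has_sderiv_def scoeff_real_scalar)

lemma has_sderiv_sbody: "has_sderiv a a' t \<Longrightarrow> ((\<lambda>s. sbody (a s)) has_real_derivative sbody a') (at t)"
  by (simp add: has_sderiv_def sbody_def)

lemma has_sderiv_linear: "has_sderiv (\<lambda>s. c + real_scalar s * \<eta>) \<eta> t"
  using has_sderiv_add[OF has_sderiv_const has_sderiv_mult[OF has_sderiv_real_scalar[OF DERIV_ident] has_sderiv_const]]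
  by simp

text \<open>Coefficients of the wrong parity vanish on a neighbourhood of \<open>t\<close>, hence so
  do their derivatives. Velocities of curves of points thereby become subject to
  \<open>supercommute\<close>.\<close>

lemma has_sderiv_parity:
  assumes "has_sderiv a a' t" "eventually (\<lambda>s. has_parity p (a s)) (nhds t)"
  shows "has_parity p a'"
proof (rule has_parityI)
  fix k J assume J: "finite (J :: nat set)" "odd (card J) \<noteq> p"
  have "eventually (\<lambda>s. scoeff (a s) k J = 0) (nhds t)"
    using assms(2) by eventually_elim (simp add: J has_parity_scoeff)
  hence "((\<lambda>s. scoeff (a s) k J) has_real_derivative 0) (at t) = ((\<lambda>_. 0) has_real_derivative (0::real)) (at t)"
    by (rule DERIV_cong_ev[OF refl _ refl])
  thus "scoeff a' k J = 0" using has_sderivD[OF assms(1), of k J] DERIV_unique by auto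
qed

lemma has_sderiv_cong:
  assumes "eventually (\<lambda>s. a s = b s) (nhds t)"
  shows "has_sderiv a c t \<longleftrightarrow> has_sderiv b c t"
proof -
  have "((\<lambda>s. scoeff (a s) k J) has_real_derivative scoeff c k J) (at t) =
     ((\<lambda>s. scoeff (b s) k J) has_real_derivative scoeff c k J) (at t)" for k J
    by (rule DERIV_cong_ev[OF refl _ refl]) (use assms in eventually_elim, simp)
  thus ?thesis by (simp add: has_sderiv_def)
qed

text \<open>Evenness of \<open>a t\<close> allows \<open>a'\<close> to be collected in front. For
  \<open>n = 0\<close> the factor \<open>of_nat n\<close> makes the truncated exponent
  \<open>n - 1\<close> harmless.\<close>

lemma has_sderiv_power_even:
  assumes "has_sderiv a a' t" "has_parity False (a t)"
  shows "has_sderiv (\<lambda>s. a s ^ n) (of_nat n * (a' * a t ^ (n - 1))) t"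
proof (induction n)
  case (Suc n)
  have c: "a t * a' = a' * a t" using even_commute[OF assms(2)] .
  have "has_sderiv (\<lambda>s. a s * a s ^ n) (a' * a t ^ n + a t * (of_nat n * (a' * a t ^ (n - 1)))) t"
    by (rule has_sderiv_mult[OF assms(1) Suc])
  moreover have "a t * (of_nat n * (a' * a t ^ (n - 1))) = of_nat n * (a' * a t ^ n)"
  proof (cases n)
    case (Suc m)
    have "a t * (of_nat n * (a' * a t ^ m)) = of_nat n * (a t * a') * a t ^ m"
      by (metis mult.assoc mult_of_nat_commute)
    thus ?thesis using Suc c by (simp add: mult.assoc)
  qed simp
  ultimately show ?case by (simp add: distrib_right)
qed simp

section \<open>Smooth functions of the ordinary coordinates\<close>

abbreviation openin_body :: "kind list \<Rightarrow> (nat \<Rightarrow> real) set \<Rightarrow> bool" where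
  "openin_body ks U \<equiv> openin (top_of_set (body_space ks)) U"

section \<open>Box neighbourhoods in the underlying space\<close>

lemma finite_even_idx [simp]: "finite (even_idx ks)"
  by (simp add: even_idx_def)

lemma finite_odd_idx [simp]: "finite (odd_idx ks)"
  by (simp add: odd_idx_def)

lemma openin_body_subset: "openin_body ks U \<Longrightarrow> x \<in> U \<Longrightarrow> x \<in> body_space ks"
  using openin_imp_subset by blast

lemma body_space_upd: "x \<in> body_space ks \<Longrightarrow> i \<in> even_idx ks \<Longrightarrow> x(i := t) \<in> body_space ks"
  by (auto simp: body_space_def)

text \<open>Points of \<open>body_space ks\<close> differ only in the finitely many coordinates of
  \<open>even_idx ks\<close>, so the radii provided by a basic open set of the product topology have
  a positive minimum.\<close>

lemma openin_body_box:
  assumes U: "openin_body ks U" and x: "x \<in> U"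
  obtains \<delta> where "\<delta> > 0"
    "\<And>z. z \<in> body_space ks \<Longrightarrow> (\<And>i. i \<in> even_idx ks \<Longrightarrow> \<bar>z i - x i\<bar> < \<delta>) \<Longrightarrow> z \<in> U"
proof -
  obtain T where T: "open T" "U = body_space ks \<inter> T"
    using U by (auto simp: openin_open)
  have "openin (product_topology (\<lambda>_. euclidean) UNIV) T" "x \<in> T"
    using T x by (auto simp: open_fun_def)
  then obtain X where X: "x \<in> Pi\<^sub>E UNIV X" "\<And>i. open (X i)" "Pi\<^sub>E UNIV X \<subseteq> T"
    using product_topology_open_contains_basis[of "\<lambda>_. euclidean" UNIV T x] by auto
  have "\<exists>d>0. \<forall>r. \<bar>r - x i\<bar> < d \<longrightarrow> r \<in> X i" for i
  proof -
    have "x i \<in> X i" using X(1) by (auto simp: PiE_def Pi_def)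
    thus ?thesis using X(2)[of i] by (auto simp: open_dist dist_real_def)
  qed
  then obtain d where d: "\<And>i. d i > 0" "\<And>i r. \<bar>r - x i\<bar> < d i \<Longrightarrow> r \<in> X i"
    by metis
  \<comment> \<open>The extra element 1 keeps the set nonempty when there are no even
    coordinates.\<close>
  define \<delta> where "\<delta> = Min (insert 1 (d ` even_idx ks))"
  have \<delta>: "\<delta> > 0" "\<And>i. i \<in> even_idx ks \<Longrightarrow> \<delta> \<le> d i"
    by (auto simp: \<delta>_def d(1) Min_gr_iff)
  show thesis
  proof (rule that[OF \<delta>(1)])
    fix z assume z: "z \<in> body_space ks" "\<And>i. i \<in> even_idx ks \<Longrightarrow> \<bar>z i - x i\<bar> < \<delta>"
    have "z i \<in> X i" for i
    proof (cases "i \<in> even_idx ks")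
      case True thus ?thesis using z(2)[OF True] \<delta>(2)[OF True] d(2)[of "z i" i] by simp
    next
      case False
      hence "z i = x i" using z(1) openin_body_subset[OF U x] by (auto simp: body_space_def)
      thus ?thesis using d(1)[of i] d(2)[of "z i" i] by simp
    qed
    hence "z \<in> T" using X(3) by (auto simp: PiE_def)
    thus "z \<in> U" using z T by simp
  qed
qed

lemma continuous_on_body_box:
  fixes g :: "(nat \<Rightarrow> real) \<Rightarrow> real"
  assumes U: "openin_body ks U" and x: "x \<in> U" and g: "continuous_on U g" and e: "e > 0"
  obtains \<delta> where "\<delta> > 0"
    "\<And>z. z \<in> body_space ks \<Longrightarrow> (\<And>i. i \<in> even_idx ks \<Longrightarrow> \<bar>z i - x i\<bar> < \<delta>) \<Longrightarrow> z \<in> U \<and> \<bar>g z - g x\<bar> < e"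
proof -
  have "openin (top_of_set U) (U \<inter> g -` ball (g x) e)"
    by (rule continuous_openin_preimage_gen[OF g]) auto
  hence "openin_body ks (U \<inter> g -` ball (g x) e)"
    by (rule openin_trans) (rule U)
  then obtain \<delta> where "\<delta> > 0" and d: "\<And>z. z \<in> body_space ks \<Longrightarrow> (\<And>i. i \<in> even_idx ks \<Longrightarrow> \<bar>z i - x i\<bar> < \<delta>)
      \<Longrightarrow> z \<in> U \<inter> g -` ball (g x) e"
    using openin_body_box[of ks "U \<inter> g -` ball (g x) e" x] x e by auto
  thus thesis using that[of \<delta>] by (force simp: dist_real_def)
qed

lemma eventually_body_curve:
  assumes U: "openin_body ks U" and x: "x t \<in> U"
    and B: "eventually (\<lambda>s. x s \<in> body_space ks) (nhds t)"
    and c: "\<And>i. i \<in> even_idx ks \<Longrightarrow> isCont (\<lambda>s. x s i) t"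
  shows "eventually (\<lambda>s. x s \<in> U) (nhds t)"
proof -
  obtain \<delta> where \<delta>: "\<delta> > 0"
    "\<And>z. z \<in> body_space ks \<Longrightarrow> (\<And>i. i \<in> even_idx ks \<Longrightarrow> \<bar>z i - x t i\<bar> < \<delta>) \<Longrightarrow> z \<in> U"
    using openin_body_box[OF U x] by metis
  have "eventually (\<lambda>s. \<bar>x s i - x t i\<bar> < \<delta>) (nhds t)" if "i \<in> even_idx ks" for i
    using c[OF that] \<delta>(1) unfolding isCont_def tendsto_iff dist_real_def
    by (auto simp: eventually_nhds_conv_at)
  hence "eventually (\<lambda>s. \<forall>i\<in>even_idx ks. \<bar>x s i - x t i\<bar> < \<delta>) (nhds t)"
    by (intro eventually_ball_finite) auto
  thus ?thesis using B by eventually_elim (auto intro: \<delta>(2))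
qed

lemma eventually_body_upd:
  assumes "openin_body ks U" "x \<in> U" "i \<in> even_idx ks"
  shows "eventually (\<lambda>t. x(i := t) \<in> U) (nhds (x i))"
proof (rule eventually_body_curve[OF assms(1)])
  show "isCont (\<lambda>t. (x(i := t)) j) (x i)" for j
    by (cases "j = i") simp_all
qed (use assms openin_body_subset in \<open>auto intro!: body_space_upd always_eventually\<close>)

section \<open>Locality of continuity, iterated partial derivatives and smoothness\<close>

lemma continuous_on_local:
  assumes "\<And>x. x \<in> U \<Longrightarrow> \<exists>V. openin (top_of_set U) V \<and> x \<in> V \<and> continuous_on V f"
  shows "continuous_on U f"
  unfolding continuous_on_def
proof
  fix x assume x: "x \<in> U"
  obtain V T where V: "x \<in> V" "continuous_on V f" "open T" "V = U \<inter> T"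
    using assms[OF x] by (auto simp: openin_open)
  have "at x within V = at x within U"
    by (rule at_within_nhd[of x T]) (use V in auto)
  thus "(f \<longlongrightarrow> f x) (at x within U)"
    using V unfolding continuous_on_def by metis
qed

lemma smooth_real_continuous: "smooth_real ks U h \<Longrightarrow> continuous_on U h"
  unfolding smooth_real_def by (drule spec[of _ "[]"]) simp

lemma foldr_partial_zero: "foldr partial_deriv w (\<lambda>_. 0) = (\<lambda>_. 0)"
  by (induction w) (auto simp: partial_deriv_def fun_eq_iff)

lemma smooth_real_zero: "smooth_real ks U (\<lambda>_. 0)"
  by (simp add: smooth_real_def foldr_partial_zero)

lemma smooth_real_partial:
  assumes "smooth_real ks U h" "i \<in> even_idx ks"
  shows "smooth_real ks U (partial_deriv i h)"
  unfolding smooth_real_def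
proof (intro allI impI)
  fix "is" assume "set is \<subseteq> even_idx ks"
  hence "set (is @ [i]) \<subseteq> even_idx ks" using assms by simp
  thus "continuous_on U (foldr partial_deriv is (partial_deriv i h)) \<and>
     (\<forall>j\<in>even_idx ks. \<forall>x\<in>U. (\<lambda>t. foldr partial_deriv is (partial_deriv i h) (x(j := t))) differentiable at (x j))"
    using assms(1)[unfolded smooth_real_def, rule_format, of "is @ [i]"] by simp
qed

lemma smooth_real_foldr:
  "smooth_real ks U h \<Longrightarrow> set is \<subseteq> even_idx ks \<Longrightarrow> smooth_real ks U (foldr partial_deriv is h)"
  by (induction "is") (auto intro: smooth_real_partial)

lemma smooth_real_has_deriv:
  assumes "smooth_real ks U h" "i \<in> even_idx ks" "x(i := r) \<in> U"
  shows "((\<lambda>t. h (x(i := t))) has_real_derivative partial_deriv i h (x(i := r))) (at r)"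
proof -
  have "(\<lambda>t. h ((x(i := r))(i := t))) differentiable at ((x(i := r)) i)"
    using assms(1)[unfolded smooth_real_def, rule_format, of "[]"] assms(2,3) by fastforce
  thus ?thesis by (simp add: partial_deriv_def flip: DERIV_deriv_iff_real_differentiable)
qed

lemma partial_deriv_cong:
  assumes "openin_body ks U" "i \<in> even_idx ks" "x \<in> U" "\<And>z. z \<in> U \<Longrightarrow> h z = h' z"
  shows "partial_deriv i h x = partial_deriv i h' x"
proof -
  have "eventually (\<lambda>t. x(i := t) \<in> U) (nhds (x i))"
    by (rule eventually_body_upd[OF assms(1,3,2)])
  hence "eventually (\<lambda>t. h (x(i := t)) = h' (x(i := t))) (nhds (x i))"
    by eventually_elim (simp add: assms(4))
  thus ?thesis unfolding partial_deriv_def by (rule deriv_cong_ev) simp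
qed

lemma foldr_partial_cong:
  assumes "openin_body ks U" "set is \<subseteq> even_idx ks" "\<And>z. z \<in> U \<Longrightarrow> h z = h' z" "x \<in> U"
  shows "foldr partial_deriv is h x = foldr partial_deriv is h' x"
  using assms(2,4)
proof (induction "is" arbitrary: x)
  case (Cons i "is")
  thus ?case by (auto intro!: partial_deriv_cong[OF assms(1)])
qed (simp add: assms(3))

lemma smooth_realI:
  assumes "\<And>is. set is \<subseteq> even_idx ks \<Longrightarrow> continuous_on U (foldr partial_deriv is h)"
    and "\<And>is i x. set is \<subseteq> even_idx ks \<Longrightarrow> i \<in> even_idx ks \<Longrightarrow> x \<in> U \<Longrightarrow>
      (\<lambda>t. foldr partial_deriv is h (x(i := t))) differentiable at (x i)"
  shows "smooth_real ks U h"
  using assms unfolding smooth_real_def by blast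

text \<open>Iterated partial derivatives depend only on the function near the point, so for every
  word of derivatives \<open>h\<close> may be replaced by its local model \<open>h'\<close>. The
  gluing of superfunctions rests on this.\<close>

lemma smooth_real_local:
  assumes U: "openin_body ks U"
    and loc: "\<And>x. x \<in> U \<Longrightarrow> \<exists>V h'. openin_body ks V \<and> x \<in> V \<and> V \<subseteq> U \<and> smooth_real ks V h' \<and> (\<forall>z\<in>V. h z = h' z)"
  shows "smooth_real ks U h"
proof (rule smooth_realI)
  fix "is" assume is': "set is \<subseteq> even_idx ks"
  have ex: "\<exists>V h'. openin_body ks V \<and> x \<in> V \<and> V \<subseteq> U \<and> smooth_real ks V h' \<and>
      (\<forall>z\<in>V. foldr partial_deriv is h z = foldr partial_deriv is h' z)" if "x \<in> U" for x
    using loc[OF that] foldr_partial_cong[OF _ is'] by metis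
  then obtain V h' where V: "\<And>x. x \<in> U \<Longrightarrow> openin_body ks (V x) \<and> x \<in> V x \<and> V x \<subseteq> U \<and> smooth_real ks (V x) (h' x) \<and>
      (\<forall>z\<in>V x. foldr partial_deriv is h z = foldr partial_deriv is (h' x) z)"
    by metis
  have cont: "continuous_on (V x) (foldr partial_deriv is h)" if "x \<in> U" for x
    using smooth_real_continuous[OF smooth_real_foldr[OF _ is']] V[OF that] continuous_on_cong[OF refl] by (metis (no_types, lifting))
  have "openin (top_of_set U) (V x)" if "x \<in> U" for x
    using V[OF that] U openin_imp_subset openin_subset_trans by metis
  thus "continuous_on U (foldr partial_deriv is h)"
    using cont V by (intro continuous_on_local) blast
  fix i x assume i: "i \<in> even_idx ks" and x: "x \<in> U"
  have "smooth_real ks (V x) (foldr partial_deriv is (h' x))"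
    using V[OF x] smooth_real_foldr[OF _ is'] by blast
  from smooth_real_has_deriv[OF this i, of x "x i"]
  have d: "((\<lambda>t. foldr partial_deriv is (h' x) (x(i := t))) has_real_derivative
      partial_deriv i (foldr partial_deriv is (h' x)) x) (at (x i))"
    using V[OF x] by simp
  have "eventually (\<lambda>t. x(i := t) \<in> V x) (nhds (x i))"
    by (rule eventually_body_upd) (use V[OF x] i in auto)
  hence ev: "eventually (\<lambda>t. foldr partial_deriv is h (x(i := t)) = foldr partial_deriv is (h' x) (x(i := t))) (nhds (x i))"
    by eventually_elim (use V[OF x] in blast)
  have "((\<lambda>t. foldr partial_deriv is h (x(i := t))) has_real_derivative
      partial_deriv i (foldr partial_deriv is (h' x)) x) (at (x i))"
    using d DERIV_cong_ev[OF refl ev refl] by blast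
  thus "(\<lambda>t. foldr partial_deriv is h (x(i := t))) differentiable at (x i)"
    using real_differentiable_def by blast
qed

lemma smooth_real_subset:
  assumes "openin_body ks V" "V \<subseteq> U" "smooth_real ks U h"
  shows "smooth_real ks V h"
  using assms unfolding smooth_real_def by (meson continuous_on_subset subsetD)

lemma foldr_partial_cmult:
  assumes "openin_body ks U" "smooth_real ks U h" "set is \<subseteq> even_idx ks" "x \<in> U"
  shows "foldr partial_deriv is (\<lambda>z. c * h z) x = c * foldr partial_deriv is h x"
  using assms(3,4)
proof (induction "is" arbitrary: x)
  case (Cons i "is")
  have "partial_deriv i (foldr partial_deriv is (\<lambda>z. c * h z)) x =
      partial_deriv i (\<lambda>z. c * foldr partial_deriv is h z) x"
    by (rule partial_deriv_cong[OF assms(1)]) (use Cons in auto)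
  also have "((\<lambda>t. c * foldr partial_deriv is h (x(i := t))) has_real_derivative
      c * partial_deriv i (foldr partial_deriv is h) (x(i := x i))) (at (x i))"
    by (intro DERIV_cmult smooth_real_has_deriv[OF smooth_real_foldr[OF assms(2)]]) (use Cons in auto)
  hence "partial_deriv i (\<lambda>z. c * foldr partial_deriv is h z) x = c * partial_deriv i (foldr partial_deriv is h) x"
    unfolding partial_deriv_def[of _ "\<lambda>z. c * _ z"] by (simp add: DERIV_imp_deriv)
  finally show ?case by simp
qed simp

lemma smooth_real_cmult:
  assumes U: "openin_body ks U" and h: "smooth_real ks U h"
  shows "smooth_real ks U (\<lambda>x. c * h x)"
proof (rule smooth_realI)
  fix "is" assume is': "set is \<subseteq> even_idx ks"
  show "continuous_on U (foldr partial_deriv is (\<lambda>x. c * h x))"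
    by (subst continuous_on_cong[OF refl foldr_partial_cmult[OF U h is']])
      (auto intro: continuous_on_mult_left smooth_real_continuous[OF smooth_real_foldr[OF h is']])
  fix i x assume i: "i \<in> even_idx ks" and x: "x \<in> U"
  have "eventually (\<lambda>t. x(i := t) \<in> U) (nhds (x i))"
    by (rule eventually_body_upd[OF U x i])
  hence ev: "eventually (\<lambda>t. foldr partial_deriv is (\<lambda>x. c * h x) (x(i := t)) = c * foldr partial_deriv is h (x(i := t))) (nhds (x i))"
    by eventually_elim (rule foldr_partial_cmult[OF U h is'])
  have "((\<lambda>t. c * foldr partial_deriv is h (x(i := t))) has_real_derivative
      c * partial_deriv i (foldr partial_deriv is h) (x(i := x i))) (at (x i))"
    by (intro DERIV_cmult smooth_real_has_deriv[OF smooth_real_foldr[OF h is'] i]) (use x in auto)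
  hence "((\<lambda>t. foldr partial_deriv is (\<lambda>x. c * h x) (x(i := t))) has_real_derivative
      c * partial_deriv i (foldr partial_deriv is h) (x(i := x i))) (at (x i))"
    using DERIV_cong_ev[OF refl ev refl] by blast
  thus "(\<lambda>t. foldr partial_deriv is (\<lambda>x. c * h x) (x(i := t))) differentiable at (x i)"
    using real_differentiable_def by blast
qed

text \<open>Exchanging \<open>i\<close> and \<open>j\<close> leaves the second difference unchanged.\<close>

lemma mixed_difference:
  assumes U: "openin_body ks U" and h: "smooth_real ks U h"
    and ij: "i \<in> even_idx ks" "j \<in> even_idx ks" "i \<noteq> j" and s: "s > 0"
    and box: "\<And>a b. 0 \<le> a \<Longrightarrow> a \<le> s \<Longrightarrow> 0 \<le> b \<Longrightarrow> b \<le> s \<Longrightarrow> x(i := x i + a, j := x j + b) \<in> U"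
  shows "\<exists>a b. 0 < a \<and> a < s \<and> 0 < b \<and> b < s \<and>
    h (x(i := x i + s, j := x j + s)) - h (x(i := x i + s)) - h (x(j := x j + s)) + h x =
    s * s * partial_deriv j (partial_deriv i h) (x(i := x i + a, j := x j + b))"
proof -
  have di: "((\<lambda>a. h (x(i := x i + a, j := c))) has_real_derivative partial_deriv i h (x(i := x i + a, j := c))) (at a)"
    if "x(i := x i + a, j := c) \<in> U" for a c
  proof -
    have "((\<lambda>t. h ((x(j := c))(i := t))) has_real_derivative partial_deriv i h ((x(j := c))(i := x i + a))) (at (x i + a))"
      by (rule smooth_real_has_deriv[OF h ij(1)]) (use that ij in \<open>simp add: fun_upd_twist\<close>)
    from DERIV_shift[THEN iffD1, OF this[unfolded add.commute[of "x i"]]] show ?thesis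
      using ij by (simp add: fun_upd_twist[of i j] add.commute)
  qed
  \<comment> \<open>The second difference is the increment of \<open>u\<close> over
    \<open>[0, s]\<close>. The mean value theorem is applied to \<open>u\<close> in direction
    \<open>i\<close>, then to the resulting difference in direction \<open>j\<close>.\<close>
  define u where "u = (\<lambda>a. h (x(i := x i + a, j := x j + s)) - h (x(i := x i + a, j := x j + 0)))"
  have "\<exists>z>0. z < s \<and> u s - u 0 = (s - 0) * (partial_deriv i h (x(i := x i + z, j := x j + s))
      - partial_deriv i h (x(i := x i + z, j := x j + 0)))"
    unfolding u_def by (rule MVT2[OF s]) (intro DERIV_diff di box; use s in simp)
  then obtain a where a: "0 < a" "a < s" and ua: "u s - u 0 = s * (partial_deriv i h (x(i := x i + a, j := x j + s))
      - partial_deriv i h (x(i := x i + a, j := x j + 0)))" by auto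
  have dj: "((\<lambda>b. partial_deriv i h (x(i := x i + a, j := x j + b))) has_real_derivative
      partial_deriv j (partial_deriv i h) (x(i := x i + a, j := x j + b))) (at b)"
    if "x(i := x i + a, j := x j + b) \<in> U" for b
  proof -
    from smooth_real_has_deriv[OF smooth_real_partial[OF h ij(1)] ij(2) that]
    show ?thesis using DERIV_shift[of _ _ b "x j"] by (simp add: add.commute)
  qed
  have "\<exists>z>0. z < s \<and> partial_deriv i h (x(i := x i + a, j := x j + s)) - partial_deriv i h (x(i := x i + a, j := x j + 0))
     = (s - 0) * partial_deriv j (partial_deriv i h) (x(i := x i + a, j := x j + z))"
    by (rule MVT2[OF s]) (rule dj[OF box]; use a in simp)
  then obtain b where "0 < b" "b < s" "partial_deriv i h (x(i := x i + a, j := x j + s)) - partial_deriv i h (x(i := x i + a, j := x j + 0))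
     = s * partial_deriv j (partial_deriv i h) (x(i := x i + a, j := x j + b))" by auto
  moreover have "u s - u 0 = h (x(i := x i + s, j := x j + s)) - h (x(i := x i + s)) - h (x(j := x j + s)) + h x"
    using ij by (simp add: u_def fun_upd_twist)
  ultimately show ?thesis using a ua by (intro exI[of _ a] exI[of _ b]) simp
qed

text \<open>Schwarz's theorem: the same second difference over a small square is
  \<open>s * s\<close> times one mixed derivative at some point of the square and
  \<open>s * s\<close> times the other at another point. Continuity at \<open>x\<close> makes both
  values close to those at \<open>x\<close>.\<close>

lemma partial_deriv_commute:
  assumes U: "openin_body ks U" and h: "smooth_real ks U h"
    and ij: "i \<in> even_idx ks" "j \<in> even_idx ks" and x: "x \<in> U"
  shows "partial_deriv i (partial_deriv j h) x = partial_deriv j (partial_deriv i h) x"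
proof (cases "i = j")
  case False
  let ?A = "partial_deriv i (partial_deriv j h)" and ?B = "partial_deriv j (partial_deriv i h)"
  have xB: "x \<in> body_space ks" using openin_body_subset[OF U x] .
  have "\<bar>?A x - ?B x\<bar> < e" if e: "e > 0" for e
  proof -
    have cA: "continuous_on U ?A" and cB: "continuous_on U ?B"
      using h ij by (auto intro!: smooth_real_continuous smooth_real_partial)
    have e2: "e / 2 > 0" using e by simp
    obtain d1 where d1: "d1 > 0" "\<And>z. z \<in> body_space ks \<Longrightarrow> (\<And>i. i \<in> even_idx ks \<Longrightarrow> \<bar>z i - x i\<bar> < d1)
        \<Longrightarrow> z \<in> U \<and> \<bar>?A z - ?A x\<bar> < e / 2"
      using continuous_on_body_box[OF U x cA e2] by metis
    obtain d2 where d2: "d2 > 0" "\<And>z. z \<in> body_space ks \<Longrightarrow> (\<And>i. i \<in> even_idx ks \<Longrightarrow> \<bar>z i - x i\<bar> < d2)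
        \<Longrightarrow> z \<in> U \<and> \<bar>?B z - ?B x\<bar> < e / 2"
      using continuous_on_body_box[OF U x cB e2] by metis
    \<comment> \<open>Half of the smaller radius, so that the closed square lies strictly inside
      both boxes.\<close>
    define s where "s = min d1 d2 / 2"
    have s: "s > 0" "s < d1" "s < d2" using d1(1) d2(1) by (auto simp: s_def min_def)
    have boxA: "x(i := x i + a, j := x j + b) \<in> U \<and> \<bar>?A (x(i := x i + a, j := x j + b)) - ?A x\<bar> < e / 2"
      if "0 \<le> a" "a \<le> s" "0 \<le> b" "b \<le> s" for a b
      by (rule d1(2)) (use that s ij d1(1) in \<open>auto intro!: body_space_upd xB\<close>)
    have boxB: "\<bar>?B (x(i := x i + a, j := x j + b)) - ?B x\<bar> < e / 2"
      if "0 \<le> a" "a \<le> s" "0 \<le> b" "b \<le> s" for a b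
      by (rule d2(2)[THEN conjunct2]) (use that s ij d2(1) in \<open>auto intro!: body_space_upd xB\<close>)
    obtain a b where ab: "0 < a" "a < s" "0 < b" "b < s"
      "h (x(i := x i + s, j := x j + s)) - h (x(i := x i + s)) - h (x(j := x j + s)) + h x =
      s * s * ?B (x(i := x i + a, j := x j + b))"
      using mixed_difference[OF U h ij False s(1)] boxA by meson
    have boxA': "x(j := x j + a, i := x i + b) \<in> U" if "0 \<le> a" "a \<le> s" "0 \<le> b" "b \<le> s" for a b
      using boxA[of b a] that False by (simp add: fun_upd_twist)
    obtain b' a' where ab': "0 < a'" "a' < s" "0 < b'" "b' < s"
      "h (x(j := x j + s, i := x i + s)) - h (x(j := x j + s)) - h (x(i := x i + s)) + h x =
      s * s * ?A (x(j := x j + b', i := x i + a'))"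
      using mixed_difference[OF U h ij(2,1) _ s(1), of x] boxA' False by metis
    have "s * s * ?A (x(i := x i + a', j := x j + b')) = s * s * ?B (x(i := x i + a, j := x j + b))"
      using ab(5) ab'(5) False by (auto simp: fun_upd_twist[of j i] algebra_simps)
    hence "?A (x(i := x i + a', j := x j + b')) = ?B (x(i := x i + a, j := x j + b))" using s by simp
    thus ?thesis using boxA[of a' b'] boxB[of a b] ab ab' by linarith
  qed
  hence "\<not> \<bar>?A x - ?B x\<bar> > 0" by (metis less_irrefl)
  thus ?thesis by simp
qed simp

lemma foldr_partial_move:
  assumes U: "openin_body ks U" and h: "smooth_real ks U h"
    and "set as \<subseteq> even_idx ks" "set bs \<subseteq> even_idx ks" "i \<in> even_idx ks" "x \<in> U"
  shows "foldr partial_deriv (as @ i # bs) h x = foldr partial_deriv (i # as @ bs) h x"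
  using assms(3,6)
proof (induction as arbitrary: x)
  case (Cons a as)
  have "foldr partial_deriv ((a # as) @ i # bs) h x = partial_deriv a (foldr partial_deriv (i # as @ bs) h) x"
    unfolding append_Cons foldr_Cons comp_def by (rule partial_deriv_cong[OF U]) (use Cons in auto)
  also have "\<dots> = foldr partial_deriv (i # (a # as) @ bs) h x"
    using partial_deriv_commute[OF U smooth_real_foldr[OF h, of "as @ bs"], of a i x] Cons assms by simp
  finally show ?case .
qed simp

text \<open>\<open>taylor_coeff\<close> takes derivatives in one fixed order; this lemma lets an
  additional derivative be sorted into place. The first letter of one word is located in the other
  word and moved to its front.\<close>

lemma foldr_partial_perm:
  assumes U: "openin_body ks U" and h: "smooth_real ks U h"
    and "mset as = mset bs" "set as \<subseteq> even_idx ks" "x \<in> U"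
  shows "foldr partial_deriv as h x = foldr partial_deriv bs h x"
  using assms(3-)
proof (induction as arbitrary: bs x)
  case (Cons i as)
  hence "i \<in> set bs" by (metis list.set_intros(1) mset_eq_setD)
  then obtain cs ds where bs: "bs = cs @ i # ds" by (meson split_list)
  have m: "mset as = mset (cs @ ds)" using Cons.prems(1) by (simp add: bs)
  have sub: "set cs \<subseteq> even_idx ks" "set ds \<subseteq> even_idx ks" "i \<in> even_idx ks" "set as \<subseteq> even_idx ks"
    using Cons.prems(2) mset_eq_setD[OF Cons.prems(1)] by (auto simp: bs)
  have "foldr partial_deriv (i # as) h x = foldr partial_deriv (i # cs @ ds) h x"
    unfolding foldr_Cons comp_def
    by (rule partial_deriv_cong[OF U]) (use sub Cons.prems Cons.IH[OF m] in auto)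
  also have "\<dots> = foldr partial_deriv bs h x"
    unfolding bs by (rule foldr_partial_move[OF U h, symmetric]) (use sub Cons.prems in auto)
  finally show ?case .
qed simp

text \<open>The coordinates move from \<open>x t\<close> to \<open>x s\<close> one at a time, so the
  mean value theorem in a single coordinate and continuity of the partial derivatives suffice; no
  total derivative on the sequence space appears.\<close>

lemma smooth_real_chain:
  assumes U: "openin_body ks U" and h: "smooth_real ks U h"
    and x: "x t \<in> U" and B: "eventually (\<lambda>s. x s \<in> body_space ks) (nhds t)"
    and d: "\<And>i. i \<in> even_idx ks \<Longrightarrow> ((\<lambda>s. x s i) has_real_derivative x' i) (at t)"
  shows "((\<lambda>s. h (x s)) has_real_derivative (\<Sum>i\<in>even_idx ks. x' i * partial_deriv i h (x t))) (at t)"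
proof -
  have xB: "x t \<in> body_space ks" using openin_body_subset[OF U x] .
  \<comment> \<open>In \<open>z A s\<close> the coordinates in \<open>A\<close> have already moved
    to time \<open>s\<close>, the others are still at time \<open>t\<close>.\<close>
  define z where "z = (\<lambda>A s i. if i \<in> A then x s i else x t i)"
  have zt: "z A t = x t" for A by (auto simp: z_def)
  have zB: "z A s \<in> body_space ks" if "A \<subseteq> even_idx ks" for A s
    using that xB by (auto simp: body_space_def z_def)
  have "((\<lambda>s. h (z A s)) has_real_derivative (\<Sum>i\<in>A. x' i * partial_deriv i h (x t))) (at t)"
    if "finite A" "A \<subseteq> even_idx ks" for A
    using that
  proof (induction A rule: finite_induct)
    case empty
    show ?case by (simp add: z_def)
  next
    case (insert j A)
    have j: "j \<in> even_idx ks" "A \<subseteq> even_idx ks" using insert by auto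
    let ?g = "partial_deriv j h"
    \<comment> \<open>Caratheodory's form of differentiability: the difference quotient
      \<open>c\<close> is continuous at \<open>t\<close>, so its product with another factor
      continuous at \<open>t\<close> is again a difference quotient of this kind.\<close>
    obtain c where c: "\<And>s. x s j - x t j = c s * (s - t)" "isCont c t" "c t = x' j"
      using d[OF j(1)] unfolding CARAT_DERIV by auto
    have zj: "z (insert j A) s = (z A s)(j := x s j)" "(z A s)(j := x t j) = z A s" for s
      using insert by (auto simp: z_def)
    have mvt: "\<exists>r. \<bar>r - x t j\<bar> \<le> \<bar>x s j - x t j\<bar> \<and> h (z (insert j A) s) - h (z A s) = (x s j - x t j) * ?g ((z A s)(j := r))"
      if "\<And>r. \<bar>r - x t j\<bar> \<le> \<bar>x s j - x t j\<bar> \<Longrightarrow> (z A s)(j := r) \<in> U" for s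
    proof -
      have D: "((\<lambda>r. h ((z A s)(j := r))) has_real_derivative ?g ((z A s)(j := r))) (at r)"
        if "\<bar>r - x t j\<bar> \<le> \<bar>x s j - x t j\<bar>" for r
        by (rule smooth_real_has_deriv[OF h j(1)]) (use that \<open>\<And>r. _ \<Longrightarrow> (z A s)(j := r) \<in> U\<close> in blast)
      consider "x s j = x t j" | "x t j < x s j" | "x s j < x t j" by linarith
      thus ?thesis
      proof cases
        case 1 thus ?thesis by (intro exI[of _ "x t j"]) (simp add: zj(1), simp add: zj(2))
      next
        case 2
        obtain r where "r > x t j" "r < x s j" "h ((z A s)(j := x s j)) - h ((z A s)(j := x t j)) = (x s j - x t j) * ?g ((z A s)(j := r))"
          using MVT2[OF 2, of "\<lambda>r. h ((z A s)(j := r))" "\<lambda>r. ?g ((z A s)(j := r))"] D by auto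
        thus ?thesis by (intro exI[of _ r]) (simp add: zj)
      next
        case 3
        obtain r where "r > x s j" "r < x t j" "h ((z A s)(j := x t j)) - h ((z A s)(j := x s j)) = (x t j - x s j) * ?g ((z A s)(j := r))"
          using MVT2[OF 3, of "\<lambda>r. h ((z A s)(j := r))" "\<lambda>r. ?g ((z A s)(j := r))"] D by auto
        thus ?thesis by (intro exI[of _ r]) (simp add: zj algebra_simps)
      qed
    qed
    \<comment> \<open>The mean value point, chosen for every \<open>s\<close>. Its property is
      established only near \<open>t\<close>, where the segment in direction \<open>j\<close> stays
      in \<open>U\<close>.\<close>
    define r where "r = (\<lambda>s. SOME r. \<bar>r - x t j\<bar> \<le> \<bar>x s j - x t j\<bar> \<and>
      h (z (insert j A) s) - h (z A s) = (x s j - x t j) * ?g ((z A s)(j := r)))"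
    have cont: "continuous_on U ?g" using h j by (auto intro!: smooth_real_continuous smooth_real_partial)
    have ev: "eventually (\<lambda>s. \<forall>i\<in>even_idx ks. \<bar>x s i - x t i\<bar> < \<delta>) (nhds t)" if "\<delta> > 0" for \<delta>
    proof (intro eventually_ball_finite ballI)
      fix i assume "i \<in> even_idx ks"
      hence "isCont (\<lambda>s. x s i) t" using d DERIV_isCont by blast
      thus "eventually (\<lambda>s. \<bar>x s i - x t i\<bar> < \<delta>) (nhds t)"
        using that unfolding isCont_def tendsto_iff dist_real_def by (auto simp: eventually_nhds_conv_at)
    qed simp
    have near: "eventually (\<lambda>s. h (z (insert j A) s) - h (z A s) = (x s j - x t j) * ?g ((z A s)(j := r s)) \<and>
        \<bar>?g ((z A s)(j := r s)) - ?g (x t)\<bar> < e) (nhds t)" if "e > 0" for e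
    proof -
      obtain \<delta> where \<delta>: "\<delta> > 0" "\<And>z. z \<in> body_space ks \<Longrightarrow> (\<And>i. i \<in> even_idx ks \<Longrightarrow> \<bar>z i - x t i\<bar> < \<delta>) \<Longrightarrow>
          z \<in> U \<and> \<bar>?g z - ?g (x t)\<bar> < e"
        using continuous_on_body_box[OF U x cont \<open>e > 0\<close>] by metis
      show ?thesis using ev[OF \<delta>(1)]
      proof eventually_elim
        case (elim s)
        have box: "(z A s)(j := q) \<in> U \<and> \<bar>?g ((z A s)(j := q)) - ?g (x t)\<bar> < e" if "\<bar>q - x t j\<bar> \<le> \<bar>x s j - x t j\<bar>" for q
        proof (rule \<delta>(2))
          fix i assume i: "i \<in> even_idx ks"
          show "\<bar>((z A s)(j := q)) i - x t i\<bar> < \<delta>"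
            using bspec[OF elim i] bspec[OF elim j(1)] that \<delta>(1) by (cases "i = j") (simp_all add: z_def)
        qed (use zB j body_space_upd in auto)
        have "\<bar>r s - x t j\<bar> \<le> \<bar>x s j - x t j\<bar> \<and> h (z (insert j A) s) - h (z A s) = (x s j - x t j) * ?g ((z A s)(j := r s))"
          unfolding r_def by (rule someI_ex) (rule mvt, use box in blast)
        thus ?case using box by blast
      qed
    qed
    \<comment> \<open>Prescribing the value at \<open>t\<close> reduces continuity of
      \<open>G\<close> there to the estimate \<open>near\<close>.\<close>
    define G where "G = (\<lambda>s. if s = t then ?g (x t) else ?g ((z A s)(j := r s)))"
    have "isCont G t"
      unfolding isCont_def tendsto_iff dist_real_def
    proof (intro allI impI)
      fix e :: real assume "e > 0"
      from near[OF this] show "eventually (\<lambda>s. \<bar>G s - G t\<bar> < e) (at t)"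
        unfolding eventually_nhds_conv_at
        by (elim conjE) (erule eventually_mono, simp add: G_def \<open>e > 0\<close>)
    qed
    hence "isCont (\<lambda>s. c s * G s) t" using c(2) by (rule isCont_mult[rotated])
    moreover have G0: "c t * G t = x' j * ?g (x t)" by (simp add: c G_def)
    ultimately have "((\<lambda>s. (c s * G s) * (s - t)) has_real_derivative x' j * ?g (x t)) (at t)"
      unfolding CARAT_DERIV by (intro exI[of _ "\<lambda>s. c s * G s"]) simp
    moreover have "eventually (\<lambda>s. h (z (insert j A) s) - h (z A s) = (c s * G s) * (s - t)) (nhds t)"
      using near[of 1, simplified] by eventually_elim (auto simp: G_def c(1) algebra_simps)
    ultimately have "((\<lambda>s. h (z (insert j A) s) - h (z A s)) has_real_derivative x' j * ?g (x t)) (at t)"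
      by (subst DERIV_cong_ev[OF refl _ refl])
    from DERIV_add[OF this insert.IH[OF j(2)]] show ?case using insert by simp
  qed
  from this[of "even_idx ks"] have *: "((\<lambda>s. h (z (even_idx ks) s)) has_real_derivative
      (\<Sum>i\<in>even_idx ks. x' i * partial_deriv i h (x t))) (at t)" by simp
  have "eventually (\<lambda>s. h (z (even_idx ks) s) = h (x s)) (nhds t)"
    using B
  proof eventually_elim
    case (elim s)
    have "z (even_idx ks) s = x s" using elim xB by (auto simp: z_def body_space_def)
    thus ?case by simp
  qed
  from DERIV_cong_ev[OF refl this refl] show ?thesis using * by simp
qed

section \<open>Evaluation of superfunctions\<close>

subsection \<open>Left derivatives\<close>

lemma even_idx_less: "i \<in> even_idx ks \<Longrightarrow> i < length ks"
  by (simp add: even_idx_def)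

lemma zero_admissible [simp]: "(\<lambda>_. 0) \<in> admissible ks"
  by (simp add: admissible_def)

text \<open>For odd \<open>i\<close> the factor vanishes if \<open>m i = 1\<close>, when the raised exponent is not admissible.\<close>

definition raise_coeff :: "kind list \<Rightarrow> nat \<Rightarrow> (nat \<Rightarrow> nat) \<Rightarrow> real" where
  "raise_coeff ks i m = (if ks ! i = Odd
     then (if m i = 0 then (- 1) ^ (\<Sum>j\<in>odd_idx ks \<inter> {..<i}. m j) else 0) else real (m i + 1))"

lemma left_deriv_nonEven:
  assumes "i \<notin> even_idx ks" "i < length ks"
  shows "left_deriv ks i F x m = real_scalar (raise_coeff ks i m) * F x (m(i := m i + 1))"
  using assms by (cases "ks ! i")
    (auto simp: left_deriv_def raise_coeff_def even_idx_def real_scalar_sign distrib_right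
      real_scalar_add real_scalar_of_nat simp del: of_nat_Suc)

lemma scoeff_left_deriv_Even:
  assumes "i \<in> even_idx ks"
  shows "scoeff (left_deriv ks i F x m) k J = partial_deriv i (\<lambda>z. scoeff (F z m) k J) x"
proof (cases "finite J")
  case False
  thus ?thesis by (simp add: partial_deriv_def)
qed (use assms in \<open>simp add: left_deriv_def even_idx_def\<close>)

lemma admissible_raise:
  assumes "i \<notin> even_idx ks" "i < length ks" "m \<in> admissible ks" "raise_coeff ks i m \<noteq> 0"
  shows "m(i := m i + 1) \<in> admissible ks"
  using assms by (auto simp: admissible_def raise_coeff_def odd_idx_def even_idx_def split: if_splits)

lemma smooth_sfun_coeff:
  "smooth_sfun ks U F \<Longrightarrow> m \<in> admissible ks \<Longrightarrow> smooth_real ks U (\<lambda>x. scoeff (F x m) k J)"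
  by (simp add: smooth_sfun_def)

lemma smooth_sfun_left_deriv:
  assumes U: "openin_body ks U" and F: "smooth_sfun ks U F" and i: "i < length ks"
  shows "smooth_sfun ks U (left_deriv ks i F)"
  unfolding smooth_sfun_def
proof (intro ballI allI)
  fix m k J assume m: "m \<in> admissible ks"
  show "smooth_real ks U (\<lambda>x. scoeff (left_deriv ks i F x m) k J)"
  proof (cases "i \<in> even_idx ks")
    case True
    thus ?thesis using smooth_real_partial[OF smooth_sfun_coeff[OF F m] True]
      by (simp add: scoeff_left_deriv_Even)
  next
    case False
    show ?thesis
    proof (cases "raise_coeff ks i m = 0")
      case True
      thus ?thesis by (simp add: left_deriv_nonEven[OF False i] smooth_real_zero)
    next
      case nz: False
      show ?thesis using smooth_real_cmult[OF U smooth_sfun_coeff[OF F admissible_raise[OF False i m nz]]]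
        by (simp add: left_deriv_nonEven[OF False i])
    qed
  qed
qed

lemma sfun_parity_left_deriv:
  assumes U: "openin_body ks U" and F: "sfun_parity ks U p F" and i: "i < length ks"
  shows "sfun_parity ks U (p \<noteq> (ks ! i = Odd)) (left_deriv ks i F)"
  unfolding sfun_parity_def
proof (intro ballI)
  fix m x assume m: "m \<in> admissible ks" and x: "x \<in> U"
  show "has_parity ((p \<noteq> (ks ! i = Odd)) \<noteq> odd (\<Sum>j\<in>odd_idx ks. m j)) (left_deriv ks i F x m)"
  proof (cases "i \<in> even_idx ks")
    case True
    hence e: "ks ! i \<noteq> Odd" by (simp add: even_idx_def)
    show ?thesis
    proof (rule has_parityI)
      fix k J assume J: "finite (J :: nat set)" "odd (card J) \<noteq> ((p \<noteq> (ks ! i = Odd)) \<noteq> odd (\<Sum>j\<in>odd_idx ks. m j))"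
      have "partial_deriv i (\<lambda>z. scoeff (F z m) k J) x = partial_deriv i (\<lambda>_. 0) x"
        by (rule partial_deriv_cong[OF U True x])
          (use F m J e in \<open>auto simp: sfun_parity_def intro: has_parity_scoeff\<close>)
      thus "scoeff (left_deriv ks i F x m) k J = 0"
        by (simp add: scoeff_left_deriv_Even[OF True]) (simp add: partial_deriv_def)
    qed
  next
    case False
    show ?thesis
    proof (cases "raise_coeff ks i m = 0")
      case True
      thus ?thesis by (simp add: left_deriv_nonEven[OF False i])
    next
      case nz: False
      note a = admissible_raise[OF False i m nz]
      have s: "(\<Sum>j\<in>odd_idx ks. (m(i := m i + 1)) j) = (\<Sum>j\<in>odd_idx ks. m j) + of_bool (ks ! i = Odd)"
      proof (cases "ks ! i = Odd")
        case True
        hence o: "i \<in> odd_idx ks" using i by (simp add: odd_idx_def)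
        show ?thesis using True by (simp add: sum.remove[OF finite_odd_idx o])
      next
        case False
        thus ?thesis by (auto simp: odd_idx_def intro!: sum.cong)
      qed
      have "has_parity (p \<noteq> odd (\<Sum>j\<in>odd_idx ks. (m(i := m i + 1)) j)) (F x (m(i := m i + 1)))"
        using F a x unfolding sfun_parity_def by blast
      moreover have "(p \<noteq> odd (\<Sum>j\<in>odd_idx ks. (m(i := m i + 1)) j)) =
          ((p \<noteq> (ks ! i = Odd)) \<noteq> odd (\<Sum>j\<in>odd_idx ks. m j))"
        unfolding s by (cases "ks ! i = Odd") auto
      ultimately show ?thesis
        unfolding left_deriv_nonEven[OF False i] by (simp only: has_parity_real_scalar_mult)
    qed
  qed
qed

subsection \<open>Taylor coefficients\<close>

text \<open>The even part of the exponent spelled out as a sorted word of indices, so that the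
  nested iterates in \<open>taylor_coeff\<close> become a single fold over a list.\<close>

definition even_word :: "kind list \<Rightarrow> (nat \<Rightarrow> nat) \<Rightarrow> nat list" where
  "even_word ks e = concat (map (\<lambda>i. replicate (e i) i) (filter (\<lambda>i. i \<in> even_idx ks) [0..<length ks]))"

definition even_fact :: "kind list \<Rightarrow> (nat \<Rightarrow> nat) \<Rightarrow> real" where
  "even_fact ks e = (\<Prod>i\<in>even_idx ks. fact (e i))"

definition drop_even :: "kind list \<Rightarrow> (nat \<Rightarrow> nat) \<Rightarrow> nat \<Rightarrow> nat" where
  "drop_even ks e = (\<lambda>i. if i \<in> even_idx ks then 0 else e i)"

lemma set_even_word: "set (even_word ks e) \<subseteq> even_idx ks"
  by (auto simp: even_word_def)

lemma even_fact_nonzero: "even_fact ks e \<noteq> 0"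
  by (simp add: even_fact_def)

lemma scoeff_left_deriv_power:
  assumes "i \<in> even_idx ks"
  shows "(\<lambda>x. scoeff ((left_deriv ks i ^^ n) F x m) k J) =
    foldr partial_deriv (replicate n i) (\<lambda>x. scoeff (F x m) k J)"
  by (induction n) (simp_all add: scoeff_left_deriv_Even[OF assms] fun_eq_iff)

lemma scoeff_taylor_coeff:
  "scoeff (taylor_coeff ks e F x) k J =
     foldr partial_deriv (even_word ks e) (\<lambda>z. scoeff (F z (drop_even ks e)) k J) x / even_fact ks e"
proof -
  have "(\<lambda>x. scoeff ((foldr (\<lambda>i. left_deriv ks i ^^ e i) L F) x m) k J) =
      foldr partial_deriv (concat (map (\<lambda>i. replicate (e i) i) L)) (\<lambda>z. scoeff (F z m) k J)"
    if "set L \<subseteq> even_idx ks" for L m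
    using that by (induction L) (simp_all add: scoeff_left_deriv_power)
  from fun_cong[OF this[of "filter (\<lambda>i. i \<in> even_idx ks) [0..<length ks]" "drop_even ks e"], of x]
  show ?thesis
    unfolding taylor_coeff_def scoeff_real_scalar_mult even_word_def drop_even_def even_fact_def
    by auto
qed

lemma mset_even_word:
  assumes "i \<in> even_idx ks"
  shows "mset (even_word ks (e(i := Suc (e i)))) = mset (i # even_word ks e)"
proof -
  have *: "mset (concat (map (\<lambda>j. replicate ((e(i := Suc (e i))) j) j) L)) =
      mset (concat (map (\<lambda>j. replicate (e j) j) L)) + (if i \<in> set L then {#i#} else {#})"
    if "distinct L" for L
    using that by (induction L) auto
  show ?thesis unfolding even_word_def
    by (subst *) (use assms even_idx_less in auto)
qed

lemma drop_even_admissible: "e \<in> exponents ks N \<Longrightarrow> drop_even ks e \<in> admissible ks"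
  by (auto simp: exponents_def admissible_def drop_even_def)

text \<open>The factor that arises when the monomial with exponent \<open>e\<close> is
  differentiated in coordinate \<open>i\<close>: the exponent \<open>e i\<close> and, for odd
  \<open>i\<close>, the sign of moving the factor number \<open>i\<close> to the front past the odd
  ones before it.\<close>

definition lower_coeff :: "kind list \<Rightarrow> nat \<Rightarrow> (nat \<Rightarrow> nat) \<Rightarrow> real" where
  "lower_coeff ks i e = real (e i) * (- 1) ^ (if ks ! i = Odd then \<Sum>j\<in>odd_idx ks \<inter> {..<i}. e j else 0)"

text \<open>In the word for \<open>left_deriv ks i F\<close> the extra derivative is applied
  innermost. Moving it outermost gives the first identity; sorting it into the word of the raised
  exponent gives the second, where \<open>Suc (e i)\<close> makes up for the larger
  factorial.\<close>

lemma taylor_coeff_left_deriv_Even: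
  assumes U: "openin_body ks U" and F: "smooth_sfun ks U F" and x: "x \<in> U"
    and i: "i \<in> even_idx ks" and e: "e \<in> exponents ks N"
  shows "scoeff (taylor_coeff ks e (left_deriv ks i F) x) k J =
     partial_deriv i (\<lambda>x. scoeff (taylor_coeff ks e F x) k J) x"
    and "real_scalar (real (Suc (e i))) * taylor_coeff ks (e(i := Suc (e i))) F x =
     taylor_coeff ks e (left_deriv ks i F) x"
proof -
  define h where "h = (\<lambda>k J z. scoeff (F z (drop_even ks e)) k J)"
  have hh: "(\<lambda>z. scoeff (F z (drop_even ks e)) k J) = h k J" for k J
    by (simp add: h_def)
  have h: "smooth_real ks U (h k J)" for k J
    unfolding h_def by (rule smooth_sfun_coeff[OF F drop_even_admissible[OF e]])
  have T: "scoeff (taylor_coeff ks e (left_deriv ks i F) x) k J =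
      foldr partial_deriv (even_word ks e @ [i]) (h k J) x / even_fact ks e" for k J
    by (simp add: scoeff_taylor_coeff scoeff_left_deriv_Even[OF i] h_def)
  have "foldr partial_deriv (even_word ks e @ [i]) (h k J) x = foldr partial_deriv (i # even_word ks e) (h k J) x" for k J
    by (rule foldr_partial_perm[OF U h _ _ x]) (use set_even_word i in auto)
  hence T1: "scoeff (taylor_coeff ks e (left_deriv ks i F) x) k J =
      partial_deriv i (foldr partial_deriv (even_word ks e) (h k J)) x / even_fact ks e" for k J
    by (simp add: T)
  have "((\<lambda>t. foldr partial_deriv (even_word ks e) (h k J) (x(i := t)) / even_fact ks e) has_real_derivative
      partial_deriv i (foldr partial_deriv (even_word ks e) (h k J)) (x(i := x i)) / even_fact ks e) (at (x i))"
    by (intro DERIV_cdivide smooth_real_has_deriv[OF smooth_real_foldr[OF h set_even_word] i]) (use x in simp)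
  hence "partial_deriv i (\<lambda>x. scoeff (taylor_coeff ks e F x) k J) x =
      partial_deriv i (foldr partial_deriv (even_word ks e) (h k J)) x / even_fact ks e"
    unfolding scoeff_taylor_coeff hh
      partial_deriv_def[of i "\<lambda>x. foldr partial_deriv (even_word ks e) (h k J) x / even_fact ks e"]
    by (simp add: DERIV_imp_deriv)
  thus "scoeff (taylor_coeff ks e (left_deriv ks i F) x) k J =
     partial_deriv i (\<lambda>x. scoeff (taylor_coeff ks e F x) k J) x" by (simp add: T1)
  have d: "drop_even ks (e(i := Suc (e i))) = drop_even ks e"
    using i by (auto simp: drop_even_def)
  have f: "even_fact ks (e(i := Suc (e i))) = real (Suc (e i)) * even_fact ks e"
    unfolding even_fact_def by (simp add: prod.remove[OF finite_even_idx i] algebra_simps)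
  have "foldr partial_deriv (even_word ks (e(i := Suc (e i)))) (h k J) x =
      foldr partial_deriv (even_word ks e @ [i]) (h k J) x" for k J
    by (rule foldr_partial_perm[OF U h _ _ x]) (use mset_even_word[OF i] set_even_word in auto)
  thus "real_scalar (real (Suc (e i))) * taylor_coeff ks (e(i := Suc (e i))) F x =
     taylor_coeff ks e (left_deriv ks i F) x"
    by (intro scalar_eqI) (simp add: T scoeff_taylor_coeff[of ks "e(i := _)"] d f hh del: of_nat_Suc)
qed

lemma taylor_coeff_left_deriv_nonEven:
  assumes U: "openin_body ks U" and F: "smooth_sfun ks U F" and x: "x \<in> U"
    and i: "i \<notin> even_idx ks" "i < length ks" and e: "e \<in> exponents ks N"
  shows "taylor_coeff ks e (left_deriv ks i F) x =
    real_scalar (raise_coeff ks i e) * taylor_coeff ks (e(i := Suc (e i))) F x"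
proof (rule scalar_eqI)
  fix k J
  let ?m = "drop_even ks e"
  have r: "raise_coeff ks i ?m = raise_coeff ks i e"
    using i by (auto simp: raise_coeff_def drop_even_def even_idx_def odd_idx_def intro!: sum.cong
        arg_cong[of _ _ "\<lambda>n. (- 1) ^ n"])
  have m: "?m(i := ?m i + 1) = drop_even ks (e(i := Suc (e i)))"
    using i by (auto simp: drop_even_def)
  have w: "even_word ks (e(i := Suc (e i))) = even_word ks e"
    unfolding even_word_def using i by (intro arg_cong[of _ _ concat] map_cong) auto
  have f: "even_fact ks (e(i := Suc (e i))) = even_fact ks e"
    unfolding even_fact_def using i by (intro prod.cong) auto
  have "foldr partial_deriv (even_word ks e) (\<lambda>z. scoeff (left_deriv ks i F z ?m) k J) x =
      raise_coeff ks i e * foldr partial_deriv (even_word ks e) (\<lambda>z. scoeff (F z (?m(i := ?m i + 1))) k J) x"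
  proof (cases "raise_coeff ks i e = 0")
    case True
    thus ?thesis by (simp add: left_deriv_nonEven[OF i] r foldr_partial_zero)
  next
    case False
    show ?thesis
      unfolding left_deriv_nonEven[OF i] r scoeff_real_scalar_mult
      by (rule foldr_partial_cmult[OF U smooth_sfun_coeff[OF F] set_even_word x])
        (rule admissible_raise[OF i drop_even_admissible[OF e]], simp add: r False)
  qed
  thus "scoeff (taylor_coeff ks e (left_deriv ks i F) x) k J =
    scoeff (real_scalar (raise_coeff ks i e) * taylor_coeff ks (e(i := Suc (e i))) F x) k J"
    by (simp add: scoeff_taylor_coeff w f flip: m)
qed

text \<open>The common form, for all kinds of coordinates, of term-by-term differentiation. The
  condition for odd \<open>i\<close> keeps the raised exponent at most 1.\<close>

lemma taylor_coeff_lower: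
  assumes U: "openin_body ks U" and F: "smooth_sfun ks U F" and x: "x \<in> U"
    and i: "i < length ks" and e: "e \<in> exponents ks N" and oi: "ks ! i = Odd \<Longrightarrow> e i = 0"
  shows "real_scalar (lower_coeff ks i (e(i := Suc (e i)))) * taylor_coeff ks (e(i := Suc (e i))) F x =
    taylor_coeff ks e (left_deriv ks i F) x"
proof (cases "i \<in> even_idx ks")
  case True
  thus ?thesis using taylor_coeff_left_deriv_Even(2)[OF U F x True e]
    by (auto simp: lower_coeff_def even_idx_def)
next
  case False
  have "lower_coeff ks i (e(i := Suc (e i))) = raise_coeff ks i e"
    using oi by (auto simp: lower_coeff_def raise_coeff_def intro!: sum.cong arg_cong[of _ _ "\<lambda>n. (- 1) ^ n"])
  thus ?thesis by (simp add: taylor_coeff_left_deriv_nonEven[OF U F x False i e])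
qed

subsection \<open>Evaluation with an arbitrary truncation\<close>

lemma finite_exponents [simp]: "finite (exponents ks N)"
proof (rule finite_imageD)
  let ?f = "\<lambda>e :: nat \<Rightarrow> nat. map e [0..<length ks]"
  have "e i \<le> N" if "e \<in> exponents ks N" "i < length ks" for e i
    using that member_le_sum[of i "{..<length ks}" e] by (auto simp: exponents_def)
  hence "?f ` exponents ks N \<subseteq> {xs. set xs \<subseteq> {..N} \<and> length xs = length ks}"
    by auto
  thus "finite (?f ` exponents ks N)"
    by (rule finite_subset) (simp add: finite_lists_length_eq)
  show "inj_on ?f (exponents ks N)"
  proof (rule inj_onI, rule ext)
    fix e e' i assume e: "e \<in> exponents ks N" "e' \<in> exponents ks N" "?f e = ?f e'"
    show "e i = e' i"
      using e by (cases "i < length ks") (auto simp: exponents_def)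
  qed
qed

definition soul :: "scalar \<Rightarrow> scalar" where
  "soul a = a - real_scalar (sbody a)"

lemma sbody_soul [simp]: "sbody (soul a) = 0"
  by (simp add: soul_def)

lemma has_parity_soul: "has_parity p a \<Longrightarrow> has_parity p (soul a)"
  unfolding soul_def
  by (cases p) (auto simp: sbody_odd intro!: has_parity_diff)

lemma soul_monomial_soul:
  "soul_monomial ks e X = prod_list (map (\<lambda>i. soul (X i) ^ e i) [0..<length ks])"
  by (simp add: soul_monomial_def soul_def)

lemma soul_monomial_zero: "soul_monomial ks (\<lambda>_. 0) X = 1"
proof -
  have "prod_list (map (\<lambda>i. 1 :: scalar) is) = 1" for "is" :: "nat list" by (induction "is") auto
  thus ?thesis by (simp add: soul_monomial_soul)
qed

lemma taylor_coeff_zero: "taylor_coeff ks (\<lambda>_. 0) F x = F x (\<lambda>_. 0)"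
proof (rule scalar_eqI)
  have "even_word ks (\<lambda>_. 0) = []" by (simp add: even_word_def)
  thus "scoeff (taylor_coeff ks (\<lambda>_. 0) F x) k J = scoeff (F x (\<lambda>_. 0)) k J" for k J
    by (simp add: scoeff_taylor_coeff even_fact_def drop_even_def)
qed

lemma sord_soul_monomial: "sord (\<Sum>i<length ks. e i) (soul_monomial ks e X)"
proof -
  have "sord (sum_list (map e [0..<length ks])) (soul_monomial ks e X)"
    unfolding soul_monomial_soul by (rule sord_prod_list, rule sord_power, rule sord_1) simp
  thus ?thesis by (simp add: interv_sum_list_conv_sum_set_nat lessThan_atLeast0)
qed

text \<open>\<open>seval\<close> truncates differently for every coefficient and is therefore not
  literally a finite sum of scalars. With \<open>N\<close> fixed it is one, and can be
  differentiated termwise.\<close>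

definition seval_sum :: "kind list \<Rightarrow> nat \<Rightarrow> sfun \<Rightarrow> (nat \<Rightarrow> scalar) \<Rightarrow> scalar" where
  "seval_sum ks N F X = (\<Sum>e\<in>exponents ks N. soul_monomial ks e X * taylor_coeff ks e F (body_vec ks X))"

text \<open>A term of total degree above \<open>k + card J\<close> has more than that many factors
  without body, so it does not reach this coefficient.\<close>

lemma scoeff_seval:
  assumes "finite J" "k + card J \<le> N"
  shows "scoeff (seval ks F X) k J = scoeff (seval_sum ks N F X) k J"
proof -
  let ?f = "\<lambda>e. soul_monomial ks e X * taylor_coeff ks e F (body_vec ks X)"
  have "scoeff (seval_sum ks N F X) k J = (\<Sum>e\<in>exponents ks N. scoeff (?f e) k J)"
    by (simp add: seval_sum_def scoeff_sum)
  also have "\<dots> = (\<Sum>e\<in>exponents ks (k + card J). scoeff (?f e) k J)"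
  proof (rule sum.mono_neutral_right)
    show "exponents ks (k + card J) \<subseteq> exponents ks N"
      using assms by (auto simp: exponents_def)
    show "\<forall>e\<in>exponents ks N - exponents ks (k + card J). scoeff (?f e) k J = 0"
    proof
      fix e assume "e \<in> exponents ks N - exponents ks (k + card J)"
      hence "k + card J < (\<Sum>i<length ks. e i)" by (auto simp: exponents_def)
      moreover have "sord ((\<Sum>i<length ks. e i) + 0) (?f e)"
        by (intro sord_mult sord_soul_monomial sord_0)
      ultimately show "scoeff (?f e) k J = 0" using assms(1) by (simp add: sord_def)
    qed
  qed simp
  finally show ?thesis using assms(1) by (simp add: seval_def scoeff_sum)
qed

text \<open>The underlying points must agree because the Taylor series is centred there; for
  \<open>K > 0\<close> the bodies of all coordinates agree, so congruence passes to the souls. Two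
  different superfunctions are allowed with a view to limits.\<close>

lemma eps_cong_seval:
  assumes U: "openin_body ks U" and b: "body_vec ks X = body_vec ks Y" "body_vec ks X \<in> U"
    and XY: "\<And>i. i < length ks \<Longrightarrow> eps_cong K (X i) (Y i)"
    and FG: "\<And>m x. m \<in> admissible ks \<Longrightarrow> x \<in> U \<Longrightarrow> eps_cong K (F x m) (G x m)"
  shows "eps_cong K (seval ks F X) (seval ks G Y)"
proof (cases "K = 0")
  case False
  have T: "eps_cong K (taylor_coeff ks e F x) (taylor_coeff ks e G x)"
    if "e \<in> exponents ks N" "x \<in> U" for e N x
    unfolding eps_cong_def
  proof (intro allI impI)
    fix k J assume k: "k < K"
    have "foldr partial_deriv (even_word ks e) (\<lambda>z. scoeff (F z (drop_even ks e)) k J) x =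
       foldr partial_deriv (even_word ks e) (\<lambda>z. scoeff (G z (drop_even ks e)) k J) x"
      by (rule foldr_partial_cong[OF U set_even_word _ that(2)])
        (use FG drop_even_admissible[OF that(1)] k in \<open>auto simp: eps_cong_def\<close>)
    thus "scoeff (taylor_coeff ks e F x) k J = scoeff (taylor_coeff ks e G x) k J"
      by (simp add: scoeff_taylor_coeff)
  qed
  have S: "eps_cong K (soul (X i)) (soul (Y i))" if "i < length ks" for i
    unfolding soul_def using XY[OF that] eps_cong_sbody[OF XY[OF that]] False
    by (intro eps_cong_diff) auto
  have "eps_cong K (seval_sum ks N F X) (seval_sum ks N G Y)" for N
    unfolding seval_sum_def soul_monomial_soul b(1)[symmetric]
    by (intro eps_cong_sum eps_cong_mult T eps_cong_prod_list eps_cong_power S b) auto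
  moreover have "scoeff (seval ks F X) k J = scoeff (seval ks G Y) k J"
    if "finite J" "scoeff (seval_sum ks (k + card J) F X) k J = scoeff (seval_sum ks (k + card J) G Y) k J" for k J
    using that scoeff_seval[of J k "k + card J"] by simp
  ultimately show ?thesis unfolding eps_cong_def by (metis scoeff_infinite)
qed (simp add: eps_cong_def)

lemma seval_cong:
  assumes "openin_body ks U" "body_vec ks X \<in> U"
    and "\<And>m x. m \<in> admissible ks \<Longrightarrow> x \<in> U \<Longrightarrow> F x m = G x m"
  shows "seval ks F X = seval ks G X"
  by (rule eps_cong_eqI, rule eps_cong_seval[OF assms(1) refl assms(2)]) (simp_all add: assms(3))

lemma spoints_parity: "X \<in> spoints ks U \<Longrightarrow> i < length ks \<Longrightarrow> has_parity (ks ! i = Odd) (X i)"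
  by (simp add: spoints_def coord_tuples_def)

lemma spoints_body: "X \<in> spoints ks U \<Longrightarrow> body_vec ks X \<in> U"
  by (simp add: spoints_def)

text \<open>Stated for the first \<open>r\<close> factors because the Leibniz rule needs the parity
  of what stands before a given factor.\<close>

lemma has_parity_soul_monomial:
  assumes X: "\<And>i. i < length ks \<Longrightarrow> has_parity (ks ! i = Odd) (X i)"
    and "r \<le> length ks" "\<forall>i\<in>odd_idx ks. e i \<le> 1"
  shows "has_parity (odd (\<Sum>i\<in>odd_idx ks \<inter> {..<r}. e i))
      (prod_list (map (\<lambda>i. soul (X i) ^ e i) [0..<r]))"
  using assms(2,3)
proof (induction r)
  case (Suc r)
  have s: "has_parity (ks ! r = Odd) (soul (X r))" using X Suc by (intro has_parity_soul) simp
  show ?case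
  proof (cases "ks ! r = Odd")
    case True
    hence r: "r \<in> odd_idx ks" using Suc by (simp add: odd_idx_def)
    hence er: "e r = 0 \<or> e r = 1" using Suc by (auto simp: le_Suc_eq)
    have i: "odd_idx ks \<inter> {..<Suc r} = insert r (odd_idx ks \<inter> {..<r})" using r by auto
    have "has_parity (odd (e r)) (soul (X r) ^ e r)" using er s True by auto
    moreover have "(odd (\<Sum>i\<in>odd_idx ks \<inter> {..<r}. e i) \<noteq> odd (e r)) =
        odd (\<Sum>i\<in>odd_idx ks \<inter> {..<Suc r}. e i)"
      by (auto simp: i)
    ultimately show ?thesis
      using has_parity_mult[OF Suc.IH, of "odd (e r)" "soul (X r) ^ e r"] Suc.prems by simp
  next
    case False
    hence i: "odd_idx ks \<inter> {..<Suc r} = odd_idx ks \<inter> {..<r}" by (auto simp: odd_idx_def less_Suc_eq)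
    have "has_parity False (soul (X r) ^ e r)" using s False by (simp add: has_parity_power)
    from has_parity_mult[OF Suc.IH this] Suc.prems show ?thesis by (simp add: i)
  qed
qed simp

lemma has_parity_taylor_coeff:
  assumes U: "openin_body ks U" and F: "sfun_parity ks U p F" and x: "x \<in> U" and e: "e \<in> exponents ks N"
  shows "has_parity (p \<noteq> odd (\<Sum>i\<in>odd_idx ks. e i)) (taylor_coeff ks e F x)"
proof (rule has_parityI)
  fix k J assume J: "finite (J :: nat set)" "odd (card J) \<noteq> (p \<noteq> odd (\<Sum>i\<in>odd_idx ks. e i))"
  have s: "(\<Sum>i\<in>odd_idx ks. drop_even ks e i) = (\<Sum>i\<in>odd_idx ks. e i)"
    by (rule sum.cong) (auto simp: drop_even_def odd_idx_def even_idx_def)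
  have "scoeff (F z (drop_even ks e)) k J = 0" if "z \<in> U" for z
  proof -
    have "has_parity (p \<noteq> odd (\<Sum>i\<in>odd_idx ks. drop_even ks e i)) (F z (drop_even ks e))"
      using F drop_even_admissible[OF e] that unfolding sfun_parity_def by blast
    thus ?thesis by (rule has_parity_scoeff) (simp only: s J(2) not_False_eq_True)
  qed
  hence "foldr partial_deriv (even_word ks e) (\<lambda>z. scoeff (F z (drop_even ks e)) k J) x =
      foldr partial_deriv (even_word ks e) (\<lambda>_. 0) x"
    by (intro foldr_partial_cong[OF U set_even_word _ x])
  thus "scoeff (taylor_coeff ks e F x) k J = 0" by (simp add: scoeff_taylor_coeff foldr_partial_zero)
qed

lemma has_parity_seval:
  assumes U: "openin_body ks U" and F: "sfun_parity ks U p F" and X: "X \<in> spoints ks U"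
  shows "has_parity p (seval ks F X)"
proof -
  have "has_parity p (soul_monomial ks e X * taylor_coeff ks e F (body_vec ks X))"
    if e: "e \<in> exponents ks N" for e N
  proof -
    have eo: "\<forall>i\<in>odd_idx ks. e i \<le> 1" using e by (simp add: exponents_def)
    have "odd_idx ks \<inter> {..<length ks} = odd_idx ks" by (auto simp: odd_idx_def)
    hence "has_parity (odd (\<Sum>i\<in>odd_idx ks. e i)) (soul_monomial ks e X)"
      using has_parity_soul_monomial[OF spoints_parity[OF X] order_refl eo]
      by (simp add: soul_monomial_soul)
    from has_parity_mult[OF this has_parity_taylor_coeff[OF U F spoints_body[OF X] e]]
    show ?thesis by (cases p; cases "odd (\<Sum>i\<in>odd_idx ks. e i)") simp_all
  qed
  hence *: "has_parity p (seval_sum ks N F X)" for N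
    unfolding seval_sum_def by (rule has_parity_sum)
  show ?thesis
  proof (rule has_parityI)
    fix k J assume "finite (J :: nat set)" "odd (card J) \<noteq> p"
    thus "scoeff (seval ks F X) k J = 0"
      using has_parity_scoeff[OF *, of J "k + card J" k] by (simp add: scoeff_seval[of J k "k + card J"])
  qed
qed

subsection \<open>The chain rule along curves of points\<close>

text \<open>
  \<open>D a\<close> is the left partial derivative of the map \<open>V\<close> of points. This is the only notion of
  derivative needed for maps of points: curves with a derivative among the odd parameters detect
  odd derivatives.
\<close>

definition has_partials :: "kind list \<Rightarrow> (nat \<Rightarrow> real) set \<Rightarrow> ((nat \<Rightarrow> scalar) \<Rightarrow> scalar) \<Rightarrow>
    (nat \<Rightarrow> (nat \<Rightarrow> scalar) \<Rightarrow> scalar) \<Rightarrow> bool" where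
  "has_partials ks U V D \<longleftrightarrow> (\<forall>X X' t. (\<forall>a<length ks. has_sderiv (\<lambda>s. X s a) (X' a) t) \<longrightarrow>
     eventually (\<lambda>s. X s \<in> spoints ks U) (nhds t) \<longrightarrow>
     has_sderiv (\<lambda>s. V (X s)) (\<Sum>a<length ks. X' a * D a (X t)) t)"

lemma has_sderiv_soul: "has_sderiv a a' t \<Longrightarrow> has_sderiv (\<lambda>s. soul (a s)) (soul a') t"
  unfolding soul_def by (intro has_sderiv_diff has_sderiv_real_scalar has_sderiv_sbody)

text \<open>The Leibniz rule with every velocity \<open>soul (X' i)\<close> moved to the front. An
  odd velocity passing the preceding odd factors produces the sign in \<open>lower_coeff\<close>; an
  even one moves freely.\<close>

lemma has_sderiv_soul_prod:
  assumes ev: "eventually (\<lambda>s. X s \<in> spoints ks U) (nhds t)"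
    and d: "\<And>a. a < length ks \<Longrightarrow> has_sderiv (\<lambda>s. X s a) (X' a) t"
    and e: "\<forall>i\<in>odd_idx ks. e i \<le> 1" and r: "r \<le> length ks"
  shows "has_sderiv (\<lambda>s. prod_list (map (\<lambda>i. soul (X s i) ^ e i) [0..<r]))
    (\<Sum>i<r. real_scalar (lower_coeff ks i e) *
      (soul (X' i) * prod_list (map (\<lambda>j. soul (X t j) ^ (e(i := e i - 1)) j) [0..<r]))) t"
  using r
proof (induction r)
  case (Suc r)
  define P where "P = (\<lambda>s. prod_list (map (\<lambda>i. soul (X s i) ^ e i) [0..<r]))"
  define Q where "Q = (\<lambda>r i. prod_list (map (\<lambda>j. soul (X t j) ^ (e(i := e i - 1)) j) [0..<r]))"
  have r: "r < length ks" using Suc by simp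
  have Xt: "X t \<in> spoints ks U" using ev eventually_nhds_x_imp_x by blast
  let ?S = "soul (X t r)" and ?S' = "soul (X' r)"
  have S: "has_sderiv (\<lambda>s. soul (X s r)) ?S' t" by (rule has_sderiv_soul[OF d[OF r]])
  have pS: "has_parity (ks ! r = Odd) ?S" by (rule has_parity_soul[OF spoints_parity[OF Xt r]])
  have "eventually (\<lambda>s. has_parity (ks ! r = Odd) (soul (X s r))) (nhds t)"
    using ev by eventually_elim (rule has_parity_soul[OF spoints_parity[OF _ r]])
  hence pS': "has_parity (ks ! r = Odd) ?S'" by (rule has_sderiv_parity[OF S])
  have pP: "has_parity (odd (\<Sum>i\<in>odd_idx ks \<inter> {..<r}. e i)) (P t)"
    unfolding P_def by (rule has_parity_soul_monomial[OF spoints_parity[OF Xt] _ e]) (use r in auto)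
  have Qr: "Q (Suc r) i = Q r i * ?S ^ e r" if "i < r" for i
    using that by (simp add: Q_def)
  have m: "map (\<lambda>j. soul (X t j) ^ (e(r := e r - 1)) j) [0..<r] = map (\<lambda>j. soul (X t j) ^ e j) [0..<r]"
    by simp
  hence Qrr: "Q (Suc r) r = P t * ?S ^ (e r - 1)"
    unfolding Q_def P_def m[symmetric] by simp
  \<comment> \<open>The contribution of the newest factor. An odd factor has exponent 0 or 1, so a
    power rule is used for even factors only.\<close>
  have last: "\<exists>T'. has_sderiv (\<lambda>s. soul (X s r) ^ e r) T' t \<and>
      P t * T' = real_scalar (lower_coeff ks r e) * (?S' * Q (Suc r) r)"
  proof (cases "ks ! r = Odd")
    case False
    have "P t * (of_nat (e r) * (?S' * ?S ^ (e r - 1))) = of_nat (e r) * (P t * ?S' * ?S ^ (e r - 1))"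
      by (simp only: mult.assoc [symmetric] mult_of_nat_commute[of "e r" "P t", symmetric])
    also have "P t * ?S' = ?S' * P t" using even_commute[of ?S' "P t"] pS' False by simp
    finally have "P t * (of_nat (e r) * (?S' * ?S ^ (e r - 1))) = real_scalar (lower_coeff ks r e) * (?S' * Q (Suc r) r)"
      using False by (simp add: lower_coeff_def Qrr real_scalar_of_nat mult.assoc)
    thus ?thesis using has_sderiv_power_even[OF S, of "e r"] pS False by auto
  next
    case True
    hence "r \<in> odd_idx ks" using r by (simp add: odd_idx_def)
    hence "e r = 0 \<or> e r = 1" using e by (auto simp: le_Suc_eq)
    thus ?thesis
    proof
      assume "e r = 0"
      thus ?thesis by (intro exI[of _ 0]) (simp add: lower_coeff_def)
    next
      assume er: "e r = 1"
      have "P t * ?S' = (- 1) ^ (\<Sum>i\<in>odd_idx ks \<inter> {..<r}. e i) * (?S' * P t)"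
        using supercommute[OF pP pS'] True by (cases "odd (\<Sum>i\<in>odd_idx ks \<inter> {..<r}. e i)") auto
      thus ?thesis using S er True by (intro exI[of _ ?S']) (simp add: lower_coeff_def Qrr real_scalar_sign)
    qed
  qed
  then obtain T' where T': "has_sderiv (\<lambda>s. soul (X s r) ^ e r) T' t"
    "P t * T' = real_scalar (lower_coeff ks r e) * (?S' * Q (Suc r) r)" by blast
  have IH: "has_sderiv P (\<Sum>i<r. real_scalar (lower_coeff ks i e) * (soul (X' i) * Q r i)) t"
    unfolding P_def Q_def using Suc by simp
  have "has_sderiv (\<lambda>s. P s * soul (X s r) ^ e r)
      ((\<Sum>i<r. real_scalar (lower_coeff ks i e) * (soul (X' i) * Q r i)) * ?S ^ e r + P t * T') t"
    by (rule has_sderiv_mult[OF IH T'(1)])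
  moreover have "(\<Sum>i<r. real_scalar (lower_coeff ks i e) * (soul (X' i) * Q r i)) * ?S ^ e r + P t * T' =
      (\<Sum>i<Suc r. real_scalar (lower_coeff ks i e) * (soul (X' i) * Q (Suc r) i))"
    using Qr by (simp add: T'(2) sum_distrib_right mult.assoc)
  ultimately show ?case by (simp add: P_def Q_def)
qed simp

text \<open>Taylor coefficients depend on the point through its body alone, so only the bodies of
  the velocities enter.\<close>

lemma has_sderiv_taylor_coeff:
  assumes U: "openin_body ks U" and F: "smooth_sfun ks U F" and e: "e \<in> exponents ks N"
    and ev: "eventually (\<lambda>s. X s \<in> spoints ks U) (nhds t)"
    and d: "\<And>a. a < length ks \<Longrightarrow> has_sderiv (\<lambda>s. X s a) (X' a) t"
  shows "has_sderiv (\<lambda>s. taylor_coeff ks e F (body_vec ks (X s)))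
    (\<Sum>i\<in>even_idx ks. real_scalar (sbody (X' i)) * taylor_coeff ks e (left_deriv ks i F) (body_vec ks (X t))) t"
proof (rule has_sderivI)
  fix k J
  let ?h = "\<lambda>x. scoeff (taylor_coeff ks e F x) k J"
  have Xt: "X t \<in> spoints ks U" using ev eventually_nhds_x_imp_x by blast
  have h: "smooth_real ks U ?h"
    using smooth_real_cmult[OF U smooth_real_foldr[OF smooth_sfun_coeff[OF F drop_even_admissible[OF e]] set_even_word],
        of "1 / even_fact ks e" e k J] by (simp add: scoeff_taylor_coeff)
  have "((\<lambda>s. ?h (body_vec ks (X s))) has_real_derivative
      (\<Sum>i\<in>even_idx ks. sbody (X' i) * partial_deriv i ?h (body_vec ks (X t)))) (at t)"
  proof (rule smooth_real_chain[OF U h])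
    show "eventually (\<lambda>s. body_vec ks (X s) \<in> body_space ks) (nhds t)"
      by (auto simp: body_space_def body_vec_def)
    show "((\<lambda>s. body_vec ks (X s) i) has_real_derivative sbody (X' i)) (at t)" if "i \<in> even_idx ks" for i
      using has_sderiv_sbody[OF d[OF even_idx_less[OF that]]] that by (simp add: body_vec_def)
  qed (rule spoints_body[OF Xt])
  thus "((\<lambda>s. ?h (body_vec ks (X s))) has_real_derivative scoeff (\<Sum>i\<in>even_idx ks. real_scalar (sbody (X' i)) *
      taylor_coeff ks e (left_deriv ks i F) (body_vec ks (X t))) k J) (at t)"
    using taylor_coeff_left_deriv_Even(1)[OF U F spoints_body[OF Xt] _ e] by (simp add: scoeff_sum)
qed

text \<open>Lowering the exponent of \<open>i\<close> is a bijection from the exponents of degree at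
  most \<open>Suc N\<close> with \<open>e i \<noteq> 0\<close> to those of degree at most
  \<open>N\<close>, restricted to \<open>e i = 0\<close> if \<open>i\<close> is odd. The exponents
  left out contribute nothing on the right, since a derivative in an odd coordinate no longer
  contains that coordinate.\<close>

lemma seval_sum_lower:
  assumes U: "openin_body ks U" and F: "smooth_sfun ks U F" and X: "X \<in> spoints ks U" and i: "i < length ks"
  shows "(\<Sum>e\<in>exponents ks (Suc N). real_scalar (lower_coeff ks i e) *
      (c * soul_monomial ks (e(i := e i - 1)) X) * taylor_coeff ks e F (body_vec ks X)) =
    c * seval_sum ks N (left_deriv ks i F) X"
proof -
  let ?x = "body_vec ks X"
  let ?A = "{e \<in> exponents ks (Suc N). e i \<noteq> 0}" and ?B = "{e \<in> exponents ks N. ks ! i = Odd \<longrightarrow> e i = 0}"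
  let ?t = "\<lambda>e. c * (soul_monomial ks e X * taylor_coeff ks e (left_deriv ks i F) ?x)"
  have x: "?x \<in> U" by (rule spoints_body[OF X])
  have upd: "(\<Sum>j<length ks. (e(i := n)) j) + e i = (\<Sum>j<length ks. e j) + n" for e :: "nat \<Rightarrow> nat" and n
    using i by (simp add: sum.remove[of "{..<length ks}" i])
  have "(\<Sum>e\<in>exponents ks (Suc N). real_scalar (lower_coeff ks i e) *
      (c * soul_monomial ks (e(i := e i - 1)) X) * taylor_coeff ks e F ?x) =
    (\<Sum>e\<in>?A. real_scalar (lower_coeff ks i e) *
      (c * soul_monomial ks (e(i := e i - 1)) X) * taylor_coeff ks e F ?x)"
    by (rule sum.mono_neutral_right) (auto simp: lower_coeff_def)
  also have "\<dots> = (\<Sum>e\<in>?B. ?t e)"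
  proof (rule sum.reindex_bij_witness[of _ "\<lambda>e. e(i := Suc (e i))" "\<lambda>e. e(i := e i - 1)"])
    fix e assume e: "e \<in> ?A"
    show "(e(i := e i - 1))(i := Suc ((e(i := e i - 1)) i)) = e"
      using e by auto
    show B: "e(i := e i - 1) \<in> ?B"
      using e upd[of e "e i - 1"] i by (auto simp: exponents_def odd_idx_def)
    define e' where "e' = e(i := e i - 1)"
    have e': "e' \<in> exponents ks N" "ks ! i = Odd \<Longrightarrow> e' i = 0" "e = e'(i := Suc (e' i))"
      using B e by (auto simp: e'_def)
    have "real_scalar (lower_coeff ks i e) * (c * soul_monomial ks e' X) * taylor_coeff ks e F ?x =
        c * (soul_monomial ks e' X * (real_scalar (lower_coeff ks i e) * taylor_coeff ks e F ?x))"
      by (metis mult.assoc real_scalar_commute)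
    also have "\<dots> = ?t e'"
      using taylor_coeff_lower[OF U F x i e'(1,2)] by (simp flip: e'(3))
    finally show "?t (e(i := e i - 1)) = real_scalar (lower_coeff ks i e) *
      (c * soul_monomial ks (e(i := e i - 1)) X) * taylor_coeff ks e F ?x" by (simp add: e'_def)
  next
    fix e assume e: "e \<in> ?B"
    show "(e(i := Suc (e i)))(i := (e(i := Suc (e i))) i - 1) = e" by auto
    show "e(i := Suc (e i)) \<in> ?A"
      using e upd[of e "Suc (e i)"] i by (auto simp: exponents_def odd_idx_def)
  qed
  also have "\<dots> = (\<Sum>e\<in>exponents ks N. ?t e)"
  proof (rule sum.mono_neutral_left)
    show "\<forall>e\<in>exponents ks N - ?B. ?t e = 0"
    proof
      fix e assume e: "e \<in> exponents ks N - ?B"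
      hence "ks ! i = Odd" "e i \<noteq> 0" by auto
      hence "i \<notin> even_idx ks" "raise_coeff ks i e = 0" by (auto simp: even_idx_def raise_coeff_def)
      thus "?t e = 0" using taylor_coeff_left_deriv_nonEven[OF U F x _ i] e by auto
    qed
  qed auto
  finally show ?thesis by (simp add: seval_sum_def sum_distrib_left)
qed

text \<open>Each velocity splits into body and soul. The body acts through the Taylor coefficients,
  the soul through the monomials; both multiply the same derivative, so they recombine to
  \<open>X' a\<close>.\<close>

theorem has_partials_seval:
  assumes U: "openin_body ks U" and F: "smooth_sfun ks U F"
  shows "has_partials ks U (seval ks F) (\<lambda>a. seval ks (left_deriv ks a F))"
  unfolding has_partials_def
proof (intro allI impI has_sderivI)
  fix X X' t k J
  assume d: "\<forall>a<length ks. has_sderiv (\<lambda>s. X s a) (X' a) t"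
    and ev: "eventually (\<lambda>s. X s \<in> spoints ks U) (nhds t)" and J: "finite (J :: nat set)"
  let ?n = "length ks" and ?D = "\<lambda>i. left_deriv ks i F"
  have Xt: "X t \<in> spoints ks U" using ev eventually_nhds_x_imp_x by blast
  \<comment> \<open>The sum is cut at \<open>Suc N\<close>, one degree beyond what the coefficient
    requires, because differentiating the monomials loses one degree.\<close>
  define N where "N = k + card J"
  let ?T = "\<lambda>e. taylor_coeff ks e F (body_vec ks (X t))"
  let ?T' = "\<lambda>e. \<Sum>i\<in>even_idx ks. real_scalar (sbody (X' i)) * taylor_coeff ks e (?D i) (body_vec ks (X t))"
  let ?M = "\<lambda>e. soul_monomial ks e (X t)"
  let ?M' = "\<lambda>e. \<Sum>i<?n. real_scalar (lower_coeff ks i e) * (soul (X' i) * ?M (e(i := e i - 1)))"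
  have e: "\<forall>i\<in>odd_idx ks. e i \<le> 1" if "e \<in> exponents ks (Suc N)" for e
    using that by (simp add: exponents_def)
  have dM: "has_sderiv (\<lambda>s. soul_monomial ks e (X s)) (?M' e) t" if "e \<in> exponents ks (Suc N)" for e
    unfolding soul_monomial_soul by (rule has_sderiv_soul_prod[OF ev _ e[OF that]]) (use d in auto)
  have dT: "has_sderiv (\<lambda>s. taylor_coeff ks e F (body_vec ks (X s))) (?T' e) t" if "e \<in> exponents ks (Suc N)" for e
    by (rule has_sderiv_taylor_coeff[OF U F that ev]) (use d in auto)
  have D: "has_sderiv (\<lambda>s. seval_sum ks (Suc N) F (X s)) (\<Sum>e\<in>exponents ks (Suc N). ?M' e * ?T e + ?M e * ?T' e) t"
    unfolding seval_sum_def by (intro has_sderiv_sum has_sderiv_mult dM dT)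
  have "(\<Sum>e\<in>exponents ks (Suc N). ?M' e * ?T e) = (\<Sum>i<?n. \<Sum>e\<in>exponents ks (Suc N).
      real_scalar (lower_coeff ks i e) * (soul (X' i) * ?M (e(i := e i - 1))) * ?T e)"
    by (simp only: sum_distrib_right) (rule sum.swap)
  also have "\<dots> = (\<Sum>i<?n. soul (X' i) * seval_sum ks N (?D i) (X t))"
    by (intro sum.cong refl seval_sum_lower[OF U F Xt]) simp
  finally have 1: "(\<Sum>e\<in>exponents ks (Suc N). ?M' e * ?T e) = (\<Sum>i<?n. soul (X' i) * seval_sum ks N (?D i) (X t))" .
  have "?M e * (real_scalar r * b) = real_scalar r * (?M e * b)" for e r b
    by (metis mult.assoc real_scalar_commute)
  hence "(\<Sum>e\<in>exponents ks (Suc N). ?M e * ?T' e) = (\<Sum>e\<in>exponents ks (Suc N). \<Sum>i\<in>even_idx ks.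
      real_scalar (sbody (X' i)) * (?M e * taylor_coeff ks e (?D i) (body_vec ks (X t))))"
    by (simp add: sum_distrib_left)
  also have "\<dots> = (\<Sum>i\<in>even_idx ks. real_scalar (sbody (X' i)) * seval_sum ks (Suc N) (?D i) (X t))"
    by (subst sum.swap) (simp add: seval_sum_def sum_distrib_left)
  finally have 2: "(\<Sum>e\<in>exponents ks (Suc N). ?M e * ?T' e) =
      (\<Sum>i\<in>even_idx ks. real_scalar (sbody (X' i)) * seval_sum ks (Suc N) (?D i) (X t))" .
  have sub: "finite T \<and> i + card T \<le> N" if "i \<le> k" "T \<subseteq> J" for i T
    using that J card_mono[OF J that(2)] finite_subset by (auto simp: N_def)
  have c: "scoeff (c * seval_sum ks N' (?D i) (X t)) k J = scoeff (c * seval ks (?D i) (X t)) k J" if "N \<le> N'" for c i N'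
  proof (rule scoeff_mult_cong)
    fix l T assume "l \<le> k" "T \<subseteq> J"
    thus "scoeff (seval_sum ks N' (?D i) (X t)) l T = scoeff (seval ks (?D i) (X t)) l T"
      using sub[of l T] that by (intro scoeff_seval[symmetric]) auto
  qed simp
  \<comment> \<open>Odd and formal coordinates have body 0 all along the curve, so their velocities
    have body 0, and the sum over even indices can be extended to all indices.\<close>
  have body0: "sbody (X' i) = 0" if "i < ?n" "i \<notin> even_idx ks" for i
  proof -
    have "eventually (\<lambda>s. sbody (X s i) = 0) (nhds t)"
      using ev
    proof eventually_elim
      case (elim s)
      show ?case
      proof (cases "ks ! i")
        case Odd
        thus ?thesis using spoints_parity[OF elim that(1)] by (simp add: sbody_odd)
      qed (use elim that in \<open>auto simp: spoints_def even_idx_def\<close>)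
    qed
    hence "((\<lambda>s. sbody (X s i)) has_real_derivative 0) (at t)"
      by (subst DERIV_cong_ev[OF refl _ refl]) auto
    thus ?thesis using has_sderiv_sbody d that(1) DERIV_unique by blast
  qed
  have "(\<Sum>i\<in>even_idx ks. real_scalar (sbody (X' i)) * seval ks (?D i) (X t)) =
      (\<Sum>i<?n. real_scalar (sbody (X' i)) * seval ks (?D i) (X t))"
    by (rule sum.mono_neutral_left) (auto simp: even_idx_less body0)
  hence tot: "(\<Sum>i<?n. soul (X' i) * seval ks (?D i) (X t)) +
      (\<Sum>i\<in>even_idx ks. real_scalar (sbody (X' i)) * seval ks (?D i) (X t)) = (\<Sum>i<?n. X' i * seval ks (?D i) (X t))"
    by (simp add: soul_def flip: sum.distrib distrib_right)
  have "((\<lambda>s. scoeff (seval_sum ks (Suc N) F (X s)) k J) has_real_derivative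
      scoeff ((\<Sum>i<?n. soul (X' i) * seval_sum ks N (?D i) (X t)) +
        (\<Sum>i\<in>even_idx ks. real_scalar (sbody (X' i)) * seval_sum ks (Suc N) (?D i) (X t))) k J) (at t)"
    using has_sderivD[OF D] by (simp only: sum.distrib 1 2)
  moreover have "scoeff ((\<Sum>i<?n. soul (X' i) * seval_sum ks N (?D i) (X t)) +
        (\<Sum>i\<in>even_idx ks. real_scalar (sbody (X' i)) * seval_sum ks (Suc N) (?D i) (X t))) k J =
      scoeff (\<Sum>i<?n. X' i * seval ks (?D i) (X t)) k J"
    unfolding tot[symmetric] scoeff_add scoeff_sum by (simp add: c del: scoeff_real_scalar_mult)
  moreover have "scoeff (seval ks F (X s)) k J = scoeff (seval_sum ks (Suc N) F (X s)) k J" for s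
    by (rule scoeff_seval[OF J]) (simp add: N_def)
  ultimately show "((\<lambda>s. scoeff (seval ks F (X s)) k J) has_real_derivative
      scoeff (\<Sum>a<?n. X' a * seval ks (?D a) (X t)) k J) (at t)" by simp
qed

subsection \<open>Continuity and values at ordinary points\<close>

definition real_point :: "(nat \<Rightarrow> real) \<Rightarrow> nat \<Rightarrow> scalar" where
  "real_point x = (\<lambda>i. real_scalar (x i))"

lemma real_point_spoints:
  assumes "openin_body ks U" "x \<in> U"
  shows "real_point x \<in> spoints ks U" "body_vec ks (real_point x) = x"
proof -
  have x: "x \<in> body_space ks" using openin_body_subset assms by blast
  have z: "x i = 0" if "i \<notin> even_idx ks" for i using x that by (simp add: body_space_def)
  show b: "body_vec ks (real_point x) = x"
    using z by (auto simp: body_vec_def real_point_def)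
  have "has_parity (ks ! i = Odd) (real_scalar (x i))" if "i < length ks" for i
    by (cases "ks ! i = Odd") (use z[of i] in \<open>auto simp: even_idx_def\<close>)
  moreover have "x i = 0" if "i \<ge> length ks" for i using z[of i] that by (auto simp: even_idx_def)
  moreover have "x i = 0" if "ks ! i = Formal" for i using z[of i] that by (auto simp: even_idx_def)
  ultimately show "real_point x \<in> spoints ks U"
    using b assms(2) by (auto simp: spoints_def coord_tuples_def real_point_def)
qed

lemma prod_list_zero: "(0 :: 'a :: semiring_1) \<in> set xs \<Longrightarrow> prod_list xs = 0"
  by (induction xs) auto

lemma seval_real_point:
  assumes "openin_body ks U" "x \<in> U"
  shows "seval ks F (real_point x) = F x (\<lambda>_. 0)"
proof (rule scalar_eqI)
  fix k J assume J: "finite (J :: nat set)"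
  let ?N = "k + card J"
  let ?t = "\<lambda>e. soul_monomial ks e (real_point x) * taylor_coeff ks e F x"
  have b: "body_vec ks (real_point x) = x" using real_point_spoints(2)[OF assms] .
  have soul0: "soul (real_point x i) = 0" for i by (simp add: soul_def real_point_def)
  have "seval_sum ks ?N F (real_point x) = (\<Sum>e\<in>{\<lambda>_. 0}. ?t e)"
    unfolding seval_sum_def b
  proof (rule sum.mono_neutral_right)
    show "\<forall>e\<in>exponents ks ?N - {\<lambda>_. 0}. ?t e = 0"
    proof
      fix e assume e: "e \<in> exponents ks ?N - {\<lambda>_. 0}"
      then obtain i where i: "e i \<noteq> 0" by auto
      hence "i < length ks" using e by (auto simp: exponents_def intro: leI)
      hence "0 \<in> set (map (\<lambda>i. soul (real_point x i) ^ e i) [0..<length ks])"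
        using i by (auto simp: soul0 power_0_left intro!: image_eqI[of _ _ i])
      hence "soul_monomial ks e (real_point x) = 0"
        unfolding soul_monomial_soul by (rule prod_list_zero)
      thus "?t e = 0" by simp
    qed
    show "finite (exponents ks ?N)" by simp
  qed (auto simp: exponents_def)
  also have "\<dots> = F x (\<lambda>_. 0)" by (simp add: soul_monomial_zero taylor_coeff_zero)
  finally show "scoeff (seval ks F (real_point x)) k J = scoeff (F x (\<lambda>_. 0)) k J"
    by (simp add: scoeff_seval[OF J order_refl])
qed

definition cont_scalar :: "(nat \<Rightarrow> real) set \<Rightarrow> ((nat \<Rightarrow> real) \<Rightarrow> scalar) \<Rightarrow> bool" where
  "cont_scalar A a \<longleftrightarrow> (\<forall>k J. continuous_on A (\<lambda>x. scoeff (a x) k J))"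

lemma cont_scalar_const [simp]: "cont_scalar A (\<lambda>_. c)"
  by (simp add: cont_scalar_def)

lemma cont_scalar_add: "cont_scalar A a \<Longrightarrow> cont_scalar A b \<Longrightarrow> cont_scalar A (\<lambda>x. a x + b x)"
  by (auto simp: cont_scalar_def intro!: continuous_intros)

lemma cont_scalar_diff: "cont_scalar A a \<Longrightarrow> cont_scalar A b \<Longrightarrow> cont_scalar A (\<lambda>x. a x - b x)"
  by (auto simp: cont_scalar_def intro!: continuous_intros)

lemma cont_scalar_sum: "(\<And>i. i \<in> I \<Longrightarrow> cont_scalar A (a i)) \<Longrightarrow> cont_scalar A (\<lambda>x. \<Sum>i\<in>I. a i x)"
  by (auto simp: cont_scalar_def scoeff_sum intro!: continuous_intros)

lemma cont_scalar_mult: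
  assumes "cont_scalar A a" "cont_scalar A b"
  shows "cont_scalar A (\<lambda>x. a x * b x)"
  unfolding cont_scalar_def
proof (intro allI)
  fix k J show "continuous_on A (\<lambda>x. scoeff (a x * b x) k J)"
  proof (cases "finite J")
    case True
    have "continuous_on A (\<lambda>x. \<Sum>i\<le>k. \<Sum>T\<in>Pow J. gsign T (J - T) * scoeff (a x) i T * scoeff (b x) (k - i) (J - T))"
      using assms unfolding cont_scalar_def by (intro continuous_intros) auto
    thus ?thesis by (simp add: scoeff_mult[OF True])
  qed simp
qed

lemma cont_scalar_prod_list:
  "(\<And>i. i \<in> set is \<Longrightarrow> cont_scalar A (a i)) \<Longrightarrow> cont_scalar A (\<lambda>x. prod_list (map (\<lambda>i. a i x) is))"
  by (induction "is") (auto intro!: cont_scalar_mult)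

lemma cont_scalar_power: "cont_scalar A a \<Longrightarrow> cont_scalar A (\<lambda>x. a x ^ n)"
  by (induction n) (auto intro!: cont_scalar_mult)

lemma scoeff_real_scalar_1: "scoeff (real_scalar r) k J = r * scoeff 1 k J"
  by (simp add: scoeff_real_scalar scoeff_1)

lemma cont_scalar_soul:
  assumes "cont_scalar A a"
  shows "cont_scalar A (\<lambda>x. soul (a x))"
proof -
  have "cont_scalar A (\<lambda>x. real_scalar (sbody (a x)))"
    unfolding cont_scalar_def
  proof (intro allI)
    fix k J show "continuous_on A (\<lambda>x. scoeff (real_scalar (sbody (a x))) k J)"
      unfolding scoeff_real_scalar_1 sbody_def using assms
      by (intro continuous_on_mult_right) (simp add: cont_scalar_def)
  qed
  thus ?thesis unfolding soul_def using assms by (rule cont_scalar_diff[rotated])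
qed

lemma cont_scalar_seval:
  assumes U: "openin_body ks U" and F: "smooth_sfun ks U F"
    and Y: "\<And>x. x \<in> A \<Longrightarrow> Y x \<in> spoints ks U"
    and c: "\<And>i. i < length ks \<Longrightarrow> cont_scalar A (\<lambda>x. Y x i)"
  shows "cont_scalar A (\<lambda>x. seval ks F (Y x))"
proof -
  have "continuous_on A (\<lambda>x. body_vec ks (Y x) i)" for i
    using c[OF even_idx_less, of i]
    by (cases "i \<in> even_idx ks") (auto simp: body_vec_def cont_scalar_def sbody_def)
  hence cb: "continuous_on A (\<lambda>x. body_vec ks (Y x))"
    by (rule continuous_on_coordinatewise_then_product)
  have T: "cont_scalar A (\<lambda>x. taylor_coeff ks e F (body_vec ks (Y x)))" if e: "e \<in> exponents ks N" for e N
    unfolding cont_scalar_def scoeff_taylor_coeff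
  proof (intro allI)
    fix k J
    have "continuous_on U (foldr partial_deriv (even_word ks e) (\<lambda>z. scoeff (F z (drop_even ks e)) k J))"
      by (intro smooth_real_continuous[of ks] smooth_real_foldr set_even_word smooth_sfun_coeff[OF F] drop_even_admissible[OF e])
    from continuous_on_compose2[OF this cb]
    show "continuous_on A (\<lambda>x. foldr partial_deriv (even_word ks e) (\<lambda>z. scoeff (F z (drop_even ks e)) k J)
        (body_vec ks (Y x)) / even_fact ks e)"
      using spoints_body[OF Y] by (intro continuous_intros) (auto simp: even_fact_nonzero)
  qed
  have *: "cont_scalar A (\<lambda>x. seval_sum ks N F (Y x))" for N
    unfolding seval_sum_def soul_monomial_soul
    by (intro cont_scalar_sum cont_scalar_mult cont_scalar_prod_list cont_scalar_power cont_scalar_soul c T) auto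
  show ?thesis
    unfolding cont_scalar_def
  proof (intro allI)
    fix k J show "continuous_on A (\<lambda>x. scoeff (seval ks F (Y x)) k J)"
      using * by (cases "finite J") (auto simp: scoeff_seval[of J k "k + card J"] cont_scalar_def)
  qed
qed

lemma cont_scalar_real_point: "cont_scalar A (\<lambda>x. real_point x i)"
  unfolding cont_scalar_def
proof (intro allI)
  fix k J show "continuous_on A (\<lambda>x. scoeff (real_point x i) k J)"
    unfolding scoeff_real_scalar_1 real_point_def
    by (intro continuous_on_mult_right continuous_on_subset[OF continuous_on_product_coordinates subset_UNIV])
qed

subsection \<open>Partial derivatives of maps of points\<close>

lemma has_partialsD:
  assumes "has_partials ks U V D" "\<And>a. a < length ks \<Longrightarrow> has_sderiv (\<lambda>s. X s a) (X' a) t"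
    and "eventually (\<lambda>s. X s \<in> spoints ks U) (nhds t)"
  shows "has_sderiv (\<lambda>s. V (X s)) (\<Sum>a<length ks. X' a * D a (X t)) t"
  using assms unfolding has_partials_def by blast

lemma spoints_mono: "X \<in> spoints ks A \<Longrightarrow> A \<subseteq> B \<Longrightarrow> X \<in> spoints ks B"
  by (auto simp: spoints_def)

lemma spoints_self: "X \<in> spoints ks U \<Longrightarrow> X \<in> spoints ks {body_vec ks X}"
  by (simp add: spoints_def)

lemma spoints_same_body: "Z \<in> spoints ks {body_vec ks X} \<Longrightarrow> X \<in> spoints ks U \<Longrightarrow> Z \<in> spoints ks U"
  by (auto simp: spoints_def)

lemma spoints_perturb:
  assumes X: "X \<in> spoints ks U" and a: "a < length ks" and \<eta>: "has_parity (ks ! a = Odd) \<eta>" "sbody \<eta> = 0"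
  shows "X(a := X a + \<eta>) \<in> spoints ks {body_vec ks X}"
  using X a \<eta> unfolding spoints_def coord_tuples_def
  by (auto simp: body_vec_def has_parity_add)

lemma has_partials_curve:
  assumes V: "has_partials ks U V D" and a: "a < length ks"
    and ev: "eventually (\<lambda>s. X(a := X a + real_scalar s * \<eta>) \<in> spoints ks U) (nhds t)"
  shows "has_sderiv (\<lambda>s. V (X(a := X a + real_scalar s * \<eta>))) (\<eta> * D a (X(a := X a + real_scalar t * \<eta>))) t"
proof -
  let ?X' = "\<lambda>i. if i = a then \<eta> else 0"
  have "has_sderiv (\<lambda>s. (X(a := X a + real_scalar s * \<eta>)) i) (?X' i) t" for i
    by (cases "i = a") (simp_all add: has_sderiv_linear)
  hence "has_sderiv (\<lambda>s. V (X(a := X a + real_scalar s * \<eta>)))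
      (\<Sum>i<length ks. ?X' i * D i (X(a := X a + real_scalar t * \<eta>))) t"
    using V[unfolded has_partials_def, rule_format, of "\<lambda>s. X(a := X a + real_scalar s * \<eta>)" ?X' t] ev
    by blast
  moreover have "(\<Sum>i<length ks. ?X' i * D i Z) = \<eta> * D a Z" for Z
  proof -
    have "(\<Sum>i<length ks. ?X' i * D i Z) = (\<Sum>i<length ks. if i = a then \<eta> * D a Z else 0)"
      by (rule sum.cong) auto
    thus ?thesis using a by simp
  qed
  ultimately show ?thesis by simp
qed

lemma soul_param_scale: "soul_param p \<eta> \<Longrightarrow> has_parity p (real_scalar s * \<eta>) \<and> sbody (real_scalar s * \<eta>) = 0"
  by (auto simp: soul_param_def has_parity_real_scalar_mult)

lemma has_partials_soul_curve:
  assumes V: "has_partials ks U V D" and X: "X \<in> spoints ks U" and a: "a < length ks"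
    and \<eta>: "soul_param (ks ! a = Odd) \<eta>"
  shows "has_sderiv (\<lambda>s. V (X(a := X a + real_scalar s * \<eta>))) (\<eta> * D a (X(a := X a + real_scalar t * \<eta>))) t"
proof (rule has_partials_curve[OF V a])
  have "X(a := X a + real_scalar s * \<eta>) \<in> spoints ks U" for s
    using spoints_same_body[OF spoints_perturb[OF X a] X] soul_param_scale[OF \<eta>] by blast
  thus "eventually (\<lambda>s. X(a := X a + real_scalar s * \<eta>) \<in> spoints ks U) (nhds t)" by simp
qed

text \<open>Along the line in direction \<open>a\<close> with velocity \<eta> the coefficients below
  order \<open>K\<close> in \<epsilon> vanish identically, hence so do those of
  \<open>\<eta> * D a X\<close>, and \<eta> cancels. As \<eta> has no body, only points over the
  underlying point of \<open>X\<close> are involved, even when \<open>a\<close> is an ordinary even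
  coordinate.\<close>

lemma has_partials_eps_zero:
  assumes V: "has_partials ks U V D" and X: "X \<in> spoints ks U" and a: "a < length ks"
    and z: "\<And>Z. Z \<in> spoints ks {body_vec ks X} \<Longrightarrow> eps_cong K (V Z) 0"
  shows "eps_cong K (D a X) 0"
  unfolding eps_cong_def
proof (intro allI impI)
  fix k J assume k: "k < K"
  have "scoeff (D a X) k J = 0"
  proof (rule soul_param_cancel_coeff)
    fix \<eta> J assume \<eta>: "soul_param (ks ! a = Odd) \<eta>"
    have "scoeff (V (X(a := X a + real_scalar s * \<eta>))) k J = 0" for s
      using z[OF spoints_perturb[OF X a]] soul_param_scale[OF \<eta>] k by (simp add: eps_cong_def)
    with has_sderivD[OF has_partials_soul_curve[OF V X a \<eta>, of 0], of k J]
    have "((\<lambda>s. 0) has_real_derivative scoeff (\<eta> * D a X) k J) (at 0)" by simp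
    thus "scoeff (\<eta> * D a X) k J = 0" using DERIV_unique DERIV_const by blast
  qed
  thus "scoeff (D a X) k J = scoeff 0 k J" by simp
qed

lemma has_partials_diff:
  assumes "has_partials ks U V D" "has_partials ks U W E"
  shows "has_partials ks U (\<lambda>X. V X - W X) (\<lambda>a X. D a X - E a X)"
  using assms unfolding has_partials_def
  by (auto simp: right_diff_distrib sum_subtractf intro!: has_sderiv_diff)

lemma has_partials_cmult:
  assumes "has_partials ks U V D"
  shows "has_partials ks U (\<lambda>X. real_scalar r * V X) (\<lambda>a X. real_scalar r * D a X)"
  unfolding has_partials_def
proof (intro allI impI)
  fix X X' t
  assume *: "\<forall>a<length ks. has_sderiv (\<lambda>s. X s a) (X' a) t" "eventually (\<lambda>s. X s \<in> spoints ks U) (nhds t)"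
  have "has_sderiv (\<lambda>s. real_scalar r * V (X s)) (real_scalar r * (\<Sum>a<length ks. X' a * D a (X t))) t"
    using assms * unfolding has_partials_def by (intro has_sderiv_cmult) blast
  also have "real_scalar r * (\<Sum>a<length ks. X' a * D a (X t)) = (\<Sum>a<length ks. X' a * (real_scalar r * D a (X t)))"
    unfolding sum_distrib_left by (intro sum.cong refl) (metis mult.assoc real_scalar_commute)
  finally show "has_sderiv (\<lambda>s. real_scalar r * V (X s)) (\<Sum>a<length ks. X' a * (real_scalar r * D a (X t))) t" .
qed

text \<open>The factor \<open>r\<close> provides for the signs between iterated odd derivatives and,
  with \<open>r = 0\<close>, for their vanishing.\<close>

lemma has_partials_unique:
  assumes V: "has_partials ks U V D" and W: "has_partials ks U W E"
    and X: "X \<in> spoints ks U" and a: "a < length ks"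
    and z: "\<And>Z. Z \<in> spoints ks {body_vec ks X} \<Longrightarrow> V Z = real_scalar r * W Z"
  shows "D a X = real_scalar r * E a X"
proof -
  have "eps_cong K (D a X - real_scalar r * E a X) 0" for K
    by (rule has_partials_eps_zero[OF has_partials_diff[OF V has_partials_cmult[OF W]] X a]) (simp add: z)
  hence "D a X - real_scalar r * E a X = 0" by (rule eps_cong_eqI)
  thus ?thesis by simp
qed

lemma has_partials_eq:
  assumes V: "has_partials ks U V D" and W: "has_partials ks U W E"
    and X: "X \<in> spoints ks U" and a: "a < length ks"
    and z: "\<And>Z. Z \<in> spoints ks {body_vec ks X} \<Longrightarrow> V Z = W Z"
  shows "D a X = E a X"
  using has_partials_unique[OF V W X a, of 1] z by simp

lemma has_sderiv_zero_constant:
  assumes "\<And>t. has_sderiv a 0 t"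
  shows "a s = a t"
proof (rule scalar_eqI)
  fix k J
  have "\<forall>x. ((\<lambda>s. scoeff (a s) k J) has_real_derivative 0) (at x)"
    using has_sderivD[OF assms, of k J] by simp
  from DERIV_isconst_all[OF this] show "scoeff (a s) k J = scoeff (a t) k J" .
qed

text \<open>Because \<eta> squares to zero, \<open>\<eta> * D a\<close> is constant along the line
  through \<open>X\<close> with velocity \<eta>, and the first-order Taylor formula is
  exact.\<close>

lemma has_partials_expand:
  assumes V: "has_partials ks U V D" and D: "has_partials ks U (D a) E"
    and X: "X \<in> spoints ks U" and a: "a < length ks" and \<eta>: "soul_param (ks ! a = Odd) \<eta>"
  shows "V (X(a := X a + \<eta>)) = V X + \<eta> * D a X"
proof -
  let ?X = "\<lambda>s. X(a := X a + real_scalar s * \<eta>)"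
  have "has_sderiv (\<lambda>s. \<eta> * D a (?X s)) (\<eta> * (\<eta> * E a (?X t))) t" for t
    by (intro has_sderiv_cmult has_partials_soul_curve[OF D X a \<eta>])
  moreover have "\<eta> * (\<eta> * b) = 0" for b using \<eta> by (simp add: soul_param_def flip: mult.assoc)
  ultimately have "has_sderiv (\<lambda>s. \<eta> * D a (?X s)) 0 t" for t by simp
  from has_sderiv_zero_constant[OF this, of _ 0] have c: "\<eta> * D a (?X s) = \<eta> * D a X" for s by simp
  have "has_sderiv (\<lambda>s. V (?X s) - (0 + real_scalar s * (\<eta> * D a X))) (\<eta> * D a (?X t) - \<eta> * D a X) t" for t
    by (intro has_sderiv_diff has_partials_soul_curve[OF V X a \<eta>] has_sderiv_linear)
  hence "has_sderiv (\<lambda>s. V (?X s) - real_scalar s * (\<eta> * D a X)) 0 t" for t by (simp add: c)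
  from has_sderiv_zero_constant[OF this, of 1 0] show ?thesis by (simp add: algebra_simps)
qed

lemma soul_param_commute:
  "soul_param p \<eta> \<Longrightarrow> soul_param q \<zeta> \<Longrightarrow> \<eta> * \<zeta> = (- 1) ^ (of_bool p * of_bool q) * (\<zeta> * \<eta>)"
  by (simp add: soul_param_def supercommute)

text \<open>
  Expanding \<open>V(X + \<eta> e\<^sub>a + \<zeta> e\<^sub>b)\<close> in both orders with square-zero \<open>\<eta>, \<zeta>\<close> gives the symmetry of
  second derivatives without any further analysis.
\<close>

lemma has_partials_commute:
  assumes V: "has_partials ks U V D"
    and Da: "has_partials ks U (D a) (E a)" and Db: "has_partials ks U (D b) (E b)"
    and Eab: "has_partials ks U (E a b) G" and Eba: "has_partials ks U (E b a) H"
    and X: "X \<in> spoints ks U" and a: "a < length ks" and b: "b < length ks"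
  shows "E b a X = (- 1) ^ (par ks a * par ks b) * E a b X"
proof (rule soul_param_cancel[of "ks ! a = Odd"], rule soul_param_cancel[of "ks ! b = Odd"])
  fix \<eta> \<zeta> assume \<eta>: "soul_param (ks ! a = Odd) \<eta>" and \<zeta>: "soul_param (ks ! b = Odd) \<zeta>"
  let ?Xa = "X(a := X a + \<eta>)" and ?Xb = "X(b := X b + \<zeta>)"
  have Xa: "?Xa \<in> spoints ks U" and Xb: "?Xb \<in> spoints ks U"
    using spoints_same_body[OF spoints_perturb[OF X a] X] spoints_same_body[OF spoints_perturb[OF X b] X] \<eta> \<zeta>
    by (auto simp: soul_param_def)
  have "?Xa(b := ?Xa b + \<zeta>) = ?Xb(a := ?Xb a + \<eta>)"
    by (auto simp: fun_eq_iff ac_simps)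
  moreover have "V (?Xa(b := ?Xa b + \<zeta>)) = V X + \<eta> * D a X + \<zeta> * (D b X + \<eta> * E b a X)"
    using has_partials_expand[OF V Db Xa b \<zeta>] has_partials_expand[OF V Da X a \<eta>]
      has_partials_expand[OF Db Eba X a \<eta>] by (simp del: fun_upd_apply)
  moreover have "V (?Xb(a := ?Xb a + \<eta>)) = V X + \<zeta> * D b X + \<eta> * (D a X + \<zeta> * E a b X)"
    using has_partials_expand[OF V Da Xb a \<eta>] has_partials_expand[OF V Db X b \<zeta>]
      has_partials_expand[OF Da Eab X b \<zeta>] by (simp del: fun_upd_apply)
  ultimately have "\<zeta> * (\<eta> * E b a X) = \<eta> * (\<zeta> * E a b X)" by (simp add: algebra_simps)
  also have "\<eta> * (\<zeta> * E a b X) = (\<eta> * \<zeta>) * E a b X" by (simp only: mult.assoc)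
  also have "\<dots> = (- 1) ^ (par ks a * par ks b) * (\<zeta> * \<eta>) * E a b X"
    using soul_param_commute[OF \<eta> \<zeta>] by (simp add: par_def)
  also have "\<dots> = \<zeta> * (\<eta> * ((- 1) ^ (par ks a * par ks b) * E a b X))"
    by (metis mult.assoc sign_mult_commute)
  finally show "\<zeta> * (\<eta> * E b a X) = \<zeta> * (\<eta> * ((- 1) ^ (par ks a * par ks b) * E a b X))" .
qed

section \<open>Recognising superfunctions among maps of points\<close>

text \<open>The index \<open>b\<close> is the parity. Membership in such a class says that partial
  derivatives of all orders exist, have the right parity and are continuous at ordinary points,
  without naming any of them.\<close>

definition diff_closed :: "kind list \<Rightarrow> (nat \<Rightarrow> real) set \<Rightarrow> (bool \<Rightarrow> ((nat \<Rightarrow> scalar) \<Rightarrow> scalar) \<Rightarrow> bool) \<Rightarrow> bool" where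
  "diff_closed ks U C \<longleftrightarrow> (\<forall>b. C b (\<lambda>_. 0)) \<and> (\<forall>b V. C b V \<longrightarrow>
     (\<forall>X\<in>spoints ks U. has_parity b (V X)) \<and> cont_scalar U (\<lambda>x. V (real_point x)) \<and>
     (\<exists>D. has_partials ks U V D \<and> (\<forall>a<length ks. C (b \<noteq> (ks ! a = Odd)) (D a))))"

definition representable :: "kind list \<Rightarrow> (nat \<Rightarrow> real) set \<Rightarrow> bool \<Rightarrow> ((nat \<Rightarrow> scalar) \<Rightarrow> scalar) \<Rightarrow> bool" where
  "representable ks U b V \<longleftrightarrow>
     (\<exists>F. smooth_sfun ks U F \<and> sfun_parity ks U b F \<and> (\<forall>X\<in>spoints ks U. V X = seval ks F X))"

definition odd_word :: "kind list \<Rightarrow> (nat \<Rightarrow> nat) \<Rightarrow> nat list" where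
  "odd_word ks m = filter (\<lambda>i. i \<in> odd_idx ks \<and> m i \<noteq> 0) [0..<length ks]"

text \<open>
  The superfunction representing \<open>V\<close> has the coefficient \<open>\<partial>\<^sub>i\<^sub>r \<dots> \<partial>\<^sub>i\<^sub>1 V\<close> at \<open>\<zeta>\<^sub>i\<^sub>1 \<dots> \<zeta>\<^sub>i\<^sub>r\<close>, evaluated at
  ordinary points. It agrees with \<open>V\<close> because both have the same derivatives of all orders at
  ordinary points, and along \<open>s \<mapsto> x + s (X - x)\<close> every derivative gains one degree in the filtration
  of the scalars.
\<close>

context
  fixes ks :: "kind list" and U :: "(nat \<Rightarrow> real) set"
    and C :: "bool \<Rightarrow> ((nat \<Rightarrow> scalar) \<Rightarrow> scalar) \<Rightarrow> bool"
    and d :: "nat \<Rightarrow> ((nat \<Rightarrow> scalar) \<Rightarrow> scalar) \<Rightarrow> (nat \<Rightarrow> scalar) \<Rightarrow> scalar"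
  assumes no_formal: "Formal \<notin> set ks" and U: "openin_body ks U"
    and C_parity: "\<And>b V X. C b V \<Longrightarrow> X \<in> spoints ks U \<Longrightarrow> has_parity b (V X)"
    and C_cont: "\<And>b V. C b V \<Longrightarrow> cont_scalar U (\<lambda>x. V (real_point x))"
    and C_partials: "\<And>b V. C b V \<Longrightarrow> has_partials ks U V (\<lambda>a. d a V)"
    and C_d: "\<And>b V a. C b V \<Longrightarrow> a < length ks \<Longrightarrow> C (b \<noteq> (ks ! a = Odd)) (d a V)"
begin

text \<open>Maps are compared on \<open>spoints ks U\<close> only, while \<open>d\<close> acts on
  them as functions, so equations cannot be substituted under \<open>d\<close>; this relation is
  carried through by uniqueness of derivatives. The factor takes the values 1, -1 and 0.\<close>

definition equal_up_to :: "real \<Rightarrow> ((nat \<Rightarrow> scalar) \<Rightarrow> scalar) \<Rightarrow> ((nat \<Rightarrow> scalar) \<Rightarrow> scalar) \<Rightarrow> bool" where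
  "equal_up_to r V W \<longleftrightarrow> (\<forall>X\<in>spoints ks U. V X = real_scalar r * W X)"

lemma equal_up_to_refl: "equal_up_to 1 V V"
  by (simp add: equal_up_to_def)

lemma equal_up_to_trans: "equal_up_to r V W \<Longrightarrow> equal_up_to s W Z \<Longrightarrow> equal_up_to (r * s) V Z"
  by (simp add: equal_up_to_def real_scalar_mult mult.assoc)

lemma equal_up_to_d:
  assumes "C b V" "C b' W" "equal_up_to r V W" "a < length ks"
  shows "equal_up_to r (d a V) (d a W)"
  unfolding equal_up_to_def
proof
  fix X assume X: "X \<in> spoints ks U"
  show "d a V X = real_scalar r * d a W X"
    by (rule has_partials_unique[OF C_partials[OF assms(1)] C_partials[OF assms(2)] X assms(4)])
      (use assms(3) spoints_same_body[OF _ X] in \<open>auto simp: equal_up_to_def\<close>)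
qed

lemma d_commute:
  assumes "C p V" "a < length ks" "b < length ks"
  shows "equal_up_to ((- 1) ^ (par ks a * par ks b)) (d a (d b V)) (d b (d a V))"
  unfolding equal_up_to_def real_scalar_sign
proof
  fix X assume X: "X \<in> spoints ks U"
  have Ca: "C (p \<noteq> (ks ! a = Odd)) (d a V)" and Cb: "C (p \<noteq> (ks ! b = Odd)) (d b V)"
    using C_d assms by blast+
  show "d a (d b V) X = (- 1) ^ (par ks a * par ks b) * d b (d a V) X"
    by (rule has_partials_commute[where D = "\<lambda>a. d a V" and E = "\<lambda>a b. d b (d a V)",
          OF C_partials[OF assms(1)] C_partials[OF Ca] C_partials[OF Cb]
          C_partials[OF C_d[OF Ca assms(3)]] C_partials[OF C_d[OF Cb assms(2)]] X assms(2,3)])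
qed

text \<open>An odd derivative anticommutes with itself, so its square equals its own
  negative.\<close>

lemma d_square:
  assumes "C p V" "a < length ks" "ks ! a = Odd" "X \<in> spoints ks U"
  shows "d a (d a V) X = 0"
proof -
  have "d a (d a V) X = - d a (d a V) X"
    using d_commute[OF assms(1,2,2)] assms(3,4) by (simp add: equal_up_to_def par_def real_scalar_minus)
  hence "scoeff (d a (d a V) X) k J = - scoeff (d a (d a V) X) k J" for k J by (metis scoeff_minus)
  thus ?thesis by (intro scalar_eqI) (simp add: eq_neg_iff_add_eq_0)
qed

lemma C_fold:
  assumes "C b V" "set w \<subseteq> {..<length ks}"
  shows "\<exists>b'. C b' (fold d w V)"
  using assms by (induction w arbitrary: b V) (auto dest: C_d)

lemma C_fold_odd:
  assumes "C b V" "set w \<subseteq> odd_idx ks"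
  shows "C (b \<noteq> odd (length w)) (fold d w V)"
  using assms
proof (induction w arbitrary: b V)
  case (Cons i w)
  have "C (b \<noteq> (ks ! i = Odd)) (d i V)" using C_d[OF Cons.prems(1), of i] Cons.prems(2) by (auto simp: odd_idx_def)
  moreover have "ks ! i = Odd" using Cons.prems by (simp add: odd_idx_def)
  ultimately have "C ((\<not> b) \<noteq> odd (length w)) (fold d w (d i V))"
    using Cons.IH[of "b \<noteq> (ks ! i = Odd)" "d i V"] Cons.prems by auto
  moreover have "((\<not> b) \<noteq> odd (length w)) = (b \<noteq> odd (length (i # w)))" by auto
  ultimately show ?case by simp
qed auto

lemma equal_up_to_fold:
  assumes "C b V" "C b' W" "equal_up_to r V W" "set w \<subseteq> {..<length ks}"
  shows "equal_up_to r (fold d w V) (fold d w W)"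
  using assms
proof (induction w arbitrary: b b' V W)
  case (Cons i w)
  have i: "i < length ks" using Cons.prems by auto
  show ?case using Cons.IH[OF C_d[OF Cons.prems(1) i] C_d[OF Cons.prems(2) i]
        equal_up_to_d[OF Cons.prems(1,2,3) i]] Cons.prems(4) by simp
qed simp

lemma fold_d_commute:
  assumes "C b V" "set w \<subseteq> odd_idx ks" "a < length ks"
  shows "equal_up_to ((- 1) ^ (par ks a * length w)) (fold d w (d a V)) (d a (fold d w V))"
  using assms
proof (induction w arbitrary: b V)
  case (Cons i w)
  have i: "i < length ks" "par ks i = 1" "set w \<subseteq> odd_idx ks" using Cons.prems by (auto simp: odd_idx_def par_def)
  have w: "set w \<subseteq> {..<length ks}" using i(3) by (auto simp: odd_idx_def)
  have Ci: "C (b \<noteq> (ks ! i = Odd)) (d i V)" and Ca: "C (b \<noteq> (ks ! a = Odd)) (d a V)"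
    using C_d Cons.prems i by blast+
  have "equal_up_to ((- 1) ^ (par ks i * par ks a)) (fold d w (d i (d a V))) (fold d w (d a (d i V)))"
    by (rule equal_up_to_fold[OF C_d[OF Ca i(1)] C_d[OF Ci Cons.prems(3)] d_commute[OF Cons.prems(1) i(1) Cons.prems(3)] w])
  from equal_up_to_trans[OF this Cons.IH[OF Ci i(3) Cons.prems(3)]]
  show ?case using i by (simp add: power_add)
qed (simp add: equal_up_to_refl)

definition representing_sfun :: "((nat \<Rightarrow> scalar) \<Rightarrow> scalar) \<Rightarrow> sfun" where
  "representing_sfun V = (\<lambda>x m. fold d (odd_word ks m) V (real_point x))"

lemma set_odd_word: "set (odd_word ks m) \<subseteq> odd_idx ks" "set (odd_word ks m) \<subseteq> {..<length ks}"
  by (auto simp: odd_word_def odd_idx_def)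

lemma length_odd_word:
  assumes "m \<in> admissible ks"
  shows "length (odd_word ks m) = (\<Sum>i\<in>odd_idx ks. m i)"
proof -
  have "(\<Sum>i\<in>odd_idx ks. m i) = (\<Sum>i\<in>{i \<in> odd_idx ks. m i \<noteq> 0}. m i)"
    by (rule sum.mono_neutral_right) auto
  also have "\<dots> = (\<Sum>i\<in>{i \<in> odd_idx ks. m i \<noteq> 0}. 1)"
    using assms by (intro sum.cong) (auto simp: admissible_def le_Suc_eq)
  also have "{i \<in> odd_idx ks. m i \<noteq> 0} = set (odd_word ks m)"
    by (auto simp: odd_word_def odd_idx_def)
  also have "distinct (odd_word ks m)" by (simp add: odd_word_def)
  hence "(\<Sum>i\<in>set (odd_word ks m). 1) = length (odd_word ks m)"
    by (simp add: distinct_card)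
  finally show ?thesis by simp
qed

text \<open>Here the velocity is 1 instead of a soul parameter: the underlying point itself moves,
  and stays in \<open>U\<close> for parameters near \<open>r\<close> because \<open>U\<close> is
  open.\<close>

lemma real_point_deriv:
  assumes "C b V" "i \<in> even_idx ks" "x(i := r) \<in> U"
  shows "((\<lambda>t. scoeff (V (real_point (x(i := t)))) k J) has_real_derivative
    scoeff (d i V (real_point (x(i := r)))) k J) (at r)"
proof -
  define X where "X = real_point (x(i := 0))"
  have e: "X(i := X i + real_scalar s * 1) = real_point (x(i := s))" for s
    by (auto simp: X_def real_point_def)
  have "eventually (\<lambda>t. (x(i := r))(i := t) \<in> U) (nhds ((x(i := r)) i))"
    by (rule eventually_body_upd[OF U assms(3,2)])
  hence ev: "eventually (\<lambda>s. X(i := X i + real_scalar s * 1) \<in> spoints ks U) (nhds r)"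
    unfolding e by (simp, elim eventually_mono) (rule real_point_spoints(1)[OF U])
  show ?thesis
    using has_sderivD[OF has_partials_curve[OF C_partials[OF assms(1)] even_idx_less[OF assms(2)] ev], of k J]
    unfolding e by simp
qed

text \<open>\<open>representing_sfun\<close> intertwines \<open>left_deriv\<close> with
  \<open>d\<close>. For odd \<open>a\<close> with exponent 0, the innermost \<open>d a\<close> is
  moved past the smaller odd indices, which costs exactly the sign in \<open>left_deriv\<close>;
  with exponent 1 it meets a second \<open>d a\<close> and vanishes.\<close>

lemma left_deriv_representing_sfun:
  assumes V: "C b V" and a: "a < length ks" and m: "m \<in> admissible ks" and x: "x \<in> U"
  shows "left_deriv ks a (representing_sfun V) x m = representing_sfun (d a V) x m"
proof -
  let ?w = "odd_word ks m"
  have rx: "real_point x \<in> spoints ks U" using real_point_spoints[OF U x] by blast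
  obtain b' where Cw: "C b' (fold d ?w V)" using C_fold[OF V set_odd_word(2)] by blast
  consider (even) "a \<in> even_idx ks" | (odd) "ks ! a = Odd" "a \<notin> even_idx ks" "a \<in> odd_idx ks"
    using a no_formal nth_mem[OF a] by (cases "ks ! a") (auto simp: even_idx_def odd_idx_def)
  thus ?thesis
  proof cases
    case even
    hence "par ks a = 0" by (simp add: par_def even_idx_def)
    hence "representing_sfun (d a V) x m = d a (fold d ?w V) (real_point x)"
      using fold_d_commute[OF V set_odd_word(1) a] rx by (simp add: equal_up_to_def representing_sfun_def)
    moreover have "scoeff (left_deriv ks a (representing_sfun V) x m) k J = scoeff (d a (fold d ?w V) (real_point x)) k J" for k J
      using real_point_deriv[OF Cw even, of x "x a" k J] x
      by (simp add: scoeff_left_deriv_Even[OF even] partial_deriv_def representing_sfun_def DERIV_imp_deriv)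
    ultimately show ?thesis by (intro scalar_eqI) simp
  next
    case odd
    let ?f = "\<lambda>i. i \<in> odd_idx ks \<and> m i \<noteq> 0"
    let ?u = "filter ?f [0..<a]" and ?v = "filter ?f [Suc a..<length ks]"
    have spl: "[0..<length ks] = [0..<a] @ a # [Suc a..<length ks]"
      using a upt_add_eq_append[of 0 a "length ks - a"] upt_conv_Cons[of a "length ks"] by simp
    have su: "set ?u \<subseteq> odd_idx ks" "set ?v \<subseteq> odd_idx ks" by auto
    have sv: "set ?v \<subseteq> {..<length ks}" by auto
    obtain bu where Cu: "C bu (fold d ?u V)" using C_fold[OF V, of ?u] su(1) by (auto simp: odd_idx_def)
    have Cda: "C (b \<noteq> (ks ! a = Odd)) (d a V)" by (rule C_d[OF V a])
    obtain bu' where Cu': "C bu' (fold d ?u (d a V))" using C_fold[OF Cda, of ?u] su(1) by (auto simp: odd_idx_def)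
    have com: "equal_up_to ((- 1) ^ length ?u) (fold d ?u (d a V)) (d a (fold d ?u V))"
      using fold_d_commute[OF V su(1) a] odd by (simp add: par_def)
    show ?thesis
    proof (cases "m a = 0")
      case True
      have w: "?w = ?u @ ?v" using True unfolding odd_word_def spl by simp
      have w': "odd_word ks (m(a := 1)) = ?u @ a # ?v"
        unfolding odd_word_def spl using odd by (auto intro!: arg_cong2[of _ _ _ _ append] filter_cong)
      have "length ?u = (\<Sum>i\<in>odd_idx ks \<inter> {..<a}. m i)"
      proof -
        have "(\<Sum>i\<in>odd_idx ks \<inter> {..<a}. m i) = (\<Sum>i\<in>set ?u. m i)"
          by (rule sum.mono_neutral_right) auto
        also have "\<dots> = (\<Sum>i\<in>set ?u. 1)"
          using m by (intro sum.cong) (auto simp: admissible_def le_Suc_eq)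
        also have "\<dots> = length ?u"
          unfolding card_eq_sum[symmetric] by (rule distinct_card) simp
        finally show ?thesis by simp
      qed
      hence "left_deriv ks a (representing_sfun V) x m = (- 1) ^ length ?u * fold d ?v (d a (fold d ?u V)) (real_point x)"
        using True odd w' by (simp add: left_deriv_def representing_sfun_def)
      moreover have "equal_up_to ((- 1) ^ length ?u) (fold d ?v (fold d ?u (d a V))) (fold d ?v (d a (fold d ?u V)))"
        by (rule equal_up_to_fold[OF Cu' C_d[OF Cu a] com sv])
      ultimately show ?thesis
        using rx by (simp add: representing_sfun_def w equal_up_to_def real_scalar_sign)
    next
      case False
      have w: "?w = ?u @ a # ?v" using False odd unfolding odd_word_def spl by simp
      have "equal_up_to 0 (d a (fold d ?u (d a V))) V"
        unfolding equal_up_to_def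
      proof
        fix X assume X: "X \<in> spoints ks U"
        show "d a (fold d ?u (d a V)) X = real_scalar 0 * V X"
          using equal_up_to_d[OF Cu' C_d[OF Cu a] com a] X d_square[OF Cu a odd(1) X]
          by (simp add: equal_up_to_def)
      qed
      from equal_up_to_fold[OF C_d[OF Cu' a] V this sv]
      have "representing_sfun (d a V) x m = 0" using rx by (simp add: representing_sfun_def w equal_up_to_def)
      thus ?thesis using False odd by (simp add: left_deriv_def)
    qed
  qed
qed

text \<open>Every iterated partial derivative of a coefficient is a coefficient, at ordinary points,
  of another member of \<open>C\<close>; its continuity and differentiability come from the closure
  of \<open>C\<close>.\<close>

lemma smooth_representing_sfun:
  assumes V: "C b V"
  shows "smooth_sfun ks U (representing_sfun V)"
  unfolding smooth_sfun_def
proof (intro ballI allI)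
  fix m k J assume m: "m \<in> admissible ks"
  have *: "\<exists>b' W. C b' W \<and> (\<forall>x\<in>U. foldr partial_deriv w (\<lambda>x. scoeff (representing_sfun V x m) k J) x = scoeff (W (real_point x)) k J)"
    if "set w \<subseteq> even_idx ks" for w
    using that
  proof (induction w)
    case Nil
    obtain b' where "C b' (fold d (odd_word ks m) V)" using C_fold[OF V set_odd_word(2)] by blast
    thus ?case by (intro exI[of _ b'] exI[of _ "fold d (odd_word ks m) V"]) (simp add: representing_sfun_def)
  next
    case (Cons i w)
    then obtain b' W where W: "C b' W" "\<And>x. x \<in> U \<Longrightarrow>
      foldr partial_deriv w (\<lambda>x. scoeff (representing_sfun V x m) k J) x = scoeff (W (real_point x)) k J" by auto
    have i: "i \<in> even_idx ks" using Cons by simp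
    have "foldr partial_deriv (i # w) (\<lambda>x. scoeff (representing_sfun V x m) k J) x = scoeff (d i W (real_point x)) k J"
      if x: "x \<in> U" for x
    proof -
      have "foldr partial_deriv (i # w) (\<lambda>x. scoeff (representing_sfun V x m) k J) x =
          partial_deriv i (\<lambda>x. scoeff (W (real_point x)) k J) x"
        using partial_deriv_cong[OF U i x W(2)] by simp
      also have "\<dots> = scoeff (d i W (real_point x)) k J"
        using real_point_deriv[OF W(1) i, of x "x i" k J] x by (simp add: partial_deriv_def DERIV_imp_deriv)
      finally show ?thesis .
    qed
    thus ?case using C_d[OF W(1) even_idx_less[OF i]] by blast
  qed
  show "smooth_real ks U (\<lambda>x. scoeff (representing_sfun V x m) k J)"
  proof (rule smooth_realI)
    fix w assume w: "set w \<subseteq> even_idx ks"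
    obtain b' W where W: "C b' W" "\<And>x. x \<in> U \<Longrightarrow>
      foldr partial_deriv w (\<lambda>x. scoeff (representing_sfun V x m) k J) x = scoeff (W (real_point x)) k J"
      using *[OF w] by auto
    have "continuous_on U (\<lambda>x. scoeff (W (real_point x)) k J)"
      using C_cont[OF W(1)] by (simp add: cont_scalar_def)
    thus "continuous_on U (foldr partial_deriv w (\<lambda>x. scoeff (representing_sfun V x m) k J))"
      by (subst continuous_on_cong[OF refl W(2)])
    fix i x assume i: "i \<in> even_idx ks" and x: "x \<in> U"
    have ev: "eventually (\<lambda>t. foldr partial_deriv w (\<lambda>x. scoeff (representing_sfun V x m) k J) (x(i := t)) =
        scoeff (W (real_point (x(i := t)))) k J) (nhds (x i))"
      using eventually_body_upd[OF U x i] by eventually_elim (rule W(2))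
    have "((\<lambda>t. scoeff (W (real_point (x(i := t)))) k J) has_real_derivative
        scoeff (d i W (real_point (x(i := x i)))) k J) (at (x i))"
      by (rule real_point_deriv[OF W(1) i]) (use x in simp)
    hence "((\<lambda>t. foldr partial_deriv w (\<lambda>x. scoeff (representing_sfun V x m) k J) (x(i := t))) has_real_derivative
        scoeff (d i W (real_point (x(i := x i)))) k J) (at (x i))"
      by (subst DERIV_cong_ev[OF refl ev refl])
    thus "(\<lambda>t. foldr partial_deriv w (\<lambda>x. scoeff (representing_sfun V x m) k J) (x(i := t))) differentiable at (x i)"
      using real_differentiable_def by blast
  qed
qed

lemma sfun_parity_representing_sfun:
  assumes V: "C b V"
  shows "sfun_parity ks U b (representing_sfun V)"
  unfolding sfun_parity_def
proof (intro ballI)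
  fix m x assume m: "m \<in> admissible ks" and x: "x \<in> U"
  show "has_parity (b \<noteq> odd (\<Sum>i\<in>odd_idx ks. m i)) (representing_sfun V x m)"
    using C_parity[OF C_fold_odd[OF V set_odd_word(1)] real_point_spoints(1)[OF U x], of m] length_odd_word[OF m]
    by (simp add: representing_sfun_def)
qed

lemma seval_representing_sfun:
  assumes V: "C b V" and X: "X \<in> spoints ks U"
  shows "V X = seval ks (representing_sfun V) X"
proof -
  \<comment> \<open>Induction on a bound for the degree of the coefficient, for all members of the
    class at once, since the induction step passes to derivatives of \<open>V\<close>.\<close>
  have "scoeff (V X) k J = scoeff (seval ks (representing_sfun V) X) k J"
    if "C b V" "X \<in> spoints ks U" "finite J" "k + card J < n" for n b V X k J
    using that
  proof (induction n arbitrary: b V X k J)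
    case (Suc n)
    note V = Suc.prems(1) and X = Suc.prems(2) and J = Suc.prems(3)
    define x where "x = body_vec ks X"
    have x: "x \<in> U" using spoints_body[OF X] by (simp add: x_def)
    \<comment> \<open>The line from the ordinary point \<open>x\<close> at \<open>s = 0\<close> to
      \<open>X\<close> at \<open>s = 1\<close>; the underlying point stays fixed.\<close>
    define Z where "Z = (\<lambda>s i. real_scalar (x i) + real_scalar s * soul (X i))"
    have nf: "sbody (X i) = x i" if "i < length ks" for i
    proof (cases "ks ! i = Odd")
      case True
      thus ?thesis using spoints_parity[OF X that] by (simp add: sbody_odd x_def body_vec_def even_idx_def)
    next
      case False
      moreover have "ks ! i \<noteq> Formal" using no_formal that nth_mem by metis
      ultimately have "i \<in> even_idx ks" using that by (cases "ks ! i") (auto simp: even_idx_def)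
      thus ?thesis by (simp add: x_def body_vec_def)
    qed
    have x0: "x i = 0" if "i \<notin> even_idx ks" for i using that by (simp add: x_def body_vec_def)
    have X0: "X i = 0" if "i \<ge> length ks" for i using X that by (simp add: spoints_def coord_tuples_def)
    have pZ: "has_parity (ks ! i = Odd) (Z s i)" if "i < length ks" for s i
    proof -
      have "has_parity (ks ! i = Odd) (real_scalar (x i))"
        using x0[of i] by (cases "ks ! i = Odd") (auto simp: even_idx_def)
      thus ?thesis unfolding Z_def
        by (intro has_parity_add has_parity_real_scalar_mult has_parity_soul spoints_parity[OF X that])
    qed
    have sZ: "sbody (Z s i) = x i" for s i by (simp add: Z_def)
    have Z: "Z s \<in> spoints ks U" for s
    proof -
      have "body_vec ks (Z s) = x" using x0 by (auto simp: body_vec_def sZ)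
      moreover have "Z s i = 0" if "i \<ge> length ks" for i
        using that x0[of i] X0[OF that] by (simp add: Z_def even_idx_def soul_def)
      moreover have "x i = 0" if "ks ! i = Formal" for i using x0[of i] that by (simp add: even_idx_def)
      ultimately show ?thesis using pZ x by (auto simp: spoints_def coord_tuples_def sZ)
    qed
    have Z0: "Z 0 = real_point x" by (auto simp: Z_def real_point_def)
    have Z1: "Z 1 = X"
    proof
      fix i show "Z 1 i = X i"
        using nf[of i] X0[of i] x0[of i] by (cases "i < length ks") (auto simp: Z_def soul_def even_idx_def)
    qed
    have dZ: "has_sderiv (\<lambda>s. Z s a) (soul (X a)) t" for a t
      by (simp add: Z_def has_sderiv_linear)
    let ?W = "seval ks (representing_sfun V)"
    have seq: "seval ks (left_deriv ks a (representing_sfun V)) Y = seval ks (representing_sfun (d a V)) Y"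
      if "a < length ks" "Y \<in> spoints ks U" for a Y
      by (rule seval_cong[OF U spoints_body[OF that(2)]]) (rule left_deriv_representing_sfun[OF V that(1)])
    have dV: "has_sderiv (\<lambda>s. V (Z s)) (\<Sum>a<length ks. soul (X a) * d a V (Z t)) t" for t
      by (rule has_partialsD[OF C_partials[OF V] dZ]) (simp add: Z)
    have dW: "has_sderiv (\<lambda>s. ?W (Z s)) (\<Sum>a<length ks. soul (X a) * seval ks (left_deriv ks a (representing_sfun V)) (Z t)) t" for t
      by (rule has_partialsD[OF has_partials_seval[OF U smooth_representing_sfun[OF V]] dZ]) (simp add: Z)
    \<comment> \<open>A soul has no coefficient of degree 0, so the derivative next to it matters
      only in strictly smaller degree, where the induction hypothesis applies.\<close>
    have "scoeff (soul (X a) * d a V (Z t)) k J =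
        scoeff (soul (X a) * seval ks (left_deriv ks a (representing_sfun V)) (Z t)) k J" if a: "a < length ks" for a t
    proof -
      let ?f = "\<lambda>b. \<Sum>i\<le>k. \<Sum>T\<in>Pow J. gsign T (J - T) * scoeff (soul (X a)) i T * scoeff b (k - i) (J - T)"
      have "gsign T (J - T) * scoeff (soul (X a)) i T * scoeff (d a V (Z t)) (k - i) (J - T) =
         gsign T (J - T) * scoeff (soul (X a)) i T * scoeff (seval ks (representing_sfun (d a V)) (Z t)) (k - i) (J - T)"
        if i: "i \<le> k" and T: "T \<in> Pow J" for i T
      proof (cases "scoeff (soul (X a)) i T = 0")
        case False
        have fT: "finite T" using T J finite_subset by auto
        have "i + card T \<noteq> 0"
        proof
          assume "i + card T = 0"
          hence "scoeff (soul (X a)) i T = sbody (soul (X a))" using fT by (simp add: sbody_def)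
          thus False using False by simp
        qed
        hence "(k - i) + card (J - T) < n"
          using Suc.prems(4) i card_split[OF J, of T] T by auto
        from Suc.IH[OF C_d[OF V a] Z _ this] show ?thesis using J by simp
      qed simp
      hence "?f (d a V (Z t)) = ?f (seval ks (representing_sfun (d a V)) (Z t))"
        by (intro sum.cong refl) auto
      thus ?thesis by (simp add: scoeff_mult[OF J] seq[OF a Z])
    qed
    hence "scoeff (\<Sum>a<length ks. soul (X a) * d a V (Z t)) k J =
        scoeff (\<Sum>a<length ks. soul (X a) * seval ks (left_deriv ks a (representing_sfun V)) (Z t)) k J" for t
      by (simp add: scoeff_sum)
    hence "((\<lambda>s. scoeff (V (Z s)) k J - scoeff (?W (Z s)) k J) has_real_derivative 0) (at t)" for t
      using DERIV_diff[OF has_sderivD[OF dV[of t], of k J] has_sderivD[OF dW[of t], of k J]] by simp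
    from DERIV_isconst_all[OF allI[OF this], of 1 0]
    have "scoeff (V X) k J - scoeff (?W X) k J = scoeff (V (real_point x)) k J - scoeff (?W (real_point x)) k J"
      by (simp add: Z0 Z1)
    also have "?W (real_point x) = V (real_point x)"
    proof -
      have "odd_word ks (\<lambda>_. 0) = []" by (simp add: odd_word_def)
      thus ?thesis by (simp add: seval_real_point[OF U x] representing_sfun_def)
    qed
    finally show ?case by simp
  qed simp
  from this[OF V X _ lessI] show ?thesis by (intro scalar_eqI)
qed

lemma representable_if_closed: "C b V \<Longrightarrow> representable ks U b V"
  unfolding representable_def
  using smooth_representing_sfun sfun_parity_representing_sfun seval_representing_sfun by blast

end

text \<open>\<open>diff_closed\<close> offers derivatives for each parity separately, whereas the
  results above use one operator on maps. The two choices can differ only for a map of both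
  parities; such a map vanishes on all points and is given the derivative 0.\<close>

theorem diff_closed_representable:
  assumes nf: "Formal \<notin> set ks" and U: "openin_body ks U" and C: "diff_closed ks U C" and V: "C b V"
  shows "representable ks U b V"
proof -
  have "\<exists>D. \<forall>b. C b V \<longrightarrow> has_partials ks U V D \<and> (\<forall>a<length ks. C (b \<noteq> (ks ! a = Odd)) (D a))" for V
  proof (cases "C True V \<and> C False V")
    case True
    have "V X = 0" if "X \<in> spoints ks U" for X
    proof (rule scalar_eqI)
      fix k J
      have "has_parity True (V X)" "has_parity False (V X)"
        using True C that unfolding diff_closed_def by blast+
      thus "scoeff (V X) k J = scoeff 0 k J" by (cases "odd (card J)") (auto simp: has_parity_scoeff)
    qed
    hence "has_partials ks U V (\<lambda>_ _. 0)"
      unfolding has_partials_def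
    proof (intro allI impI)
      fix X :: "real \<Rightarrow> nat \<Rightarrow> scalar" and X' :: "nat \<Rightarrow> scalar" and t
      assume *: "\<And>X. X \<in> spoints ks U \<Longrightarrow> V X = 0" and "eventually (\<lambda>s. X s \<in> spoints ks U) (nhds t)"
      from this(2) have "eventually (\<lambda>s. V (X s) = 0) (nhds t)" by eventually_elim (rule *)
      from has_sderiv_cong[OF this] show "has_sderiv (\<lambda>s. V (X s)) (\<Sum>a<length ks. X' a * 0) t" by simp
    qed
    moreover have "C b (\<lambda>_. 0)" for b using C by (simp add: diff_closed_def)
    ultimately show ?thesis by (intro exI[of _ "\<lambda>_ _. 0"]) simp
  next
    case False
    define c where "c = C True V"
    have c: "b = c" if "C b V" for b using that False by (cases b) (simp_all add: c_def)
    have "\<exists>D. C c V \<longrightarrow> has_partials ks U V D \<and> (\<forall>a<length ks. C (c \<noteq> (ks ! a = Odd)) (D a))"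
      using C unfolding diff_closed_def by blast
    thus ?thesis using c by blast
  qed
  then obtain D where "\<forall>V b. C b V \<longrightarrow> has_partials ks U V (D V) \<and> (\<forall>a<length ks. C (b \<noteq> (ks ! a = Odd)) (D V a))"
    by (rule choice[OF allI, THEN exE])
  hence D: "\<And>b V. C b V \<Longrightarrow> has_partials ks U V (D V)"
    "\<And>b V a. C b V \<Longrightarrow> a < length ks \<Longrightarrow> C (b \<noteq> (ks ! a = Odd)) (D V a)"
    by blast+
  show ?thesis
    by (rule representable_if_closed[where C = C and d = "\<lambda>a V. D V a", OF nf U _ _ _ D(2) V])
      (use C D(1) in \<open>auto simp: diff_closed_def\<close>)
qed

subsection \<open>Operations on representable maps\<close>

lemma has_partials_cong:
  assumes "\<And>X. X \<in> spoints ks U \<Longrightarrow> V X = W X" "has_partials ks U W D"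
  shows "has_partials ks U V D"
  unfolding has_partials_def
proof (intro allI impI)
  fix X X' t
  assume d: "\<forall>a<length ks. has_sderiv (\<lambda>s. X s a) (X' a) t" and ev: "eventually (\<lambda>s. X s \<in> spoints ks U) (nhds t)"
  have "eventually (\<lambda>s. V (X s) = W (X s)) (nhds t)" using ev by eventually_elim (rule assms(1))
  from has_sderiv_cong[OF this] has_partialsD[OF assms(2) _ ev] d
  show "has_sderiv (\<lambda>s. V (X s)) (\<Sum>a<length ks. X' a * D a (X t)) t" by blast
qed

lemma representable_cong:
  "representable ks U b V \<Longrightarrow> (\<And>X. X \<in> spoints ks U \<Longrightarrow> W X = V X) \<Longrightarrow> representable ks U b W"
  by (auto simp: representable_def)

lemma representable_parity:
  "openin_body ks U \<Longrightarrow> representable ks U b V \<Longrightarrow> X \<in> spoints ks U \<Longrightarrow> has_parity b (V X)"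
  by (auto simp: representable_def has_parity_seval)

lemma representable_cont:
  assumes U: "openin_body ks U" and V: "representable ks U b V"
  shows "cont_scalar U (\<lambda>x. V (real_point x))"
proof -
  obtain F where F: "smooth_sfun ks U F" "\<And>X. X \<in> spoints ks U \<Longrightarrow> V X = seval ks F X"
    using V by (auto simp: representable_def)
  have "cont_scalar U (\<lambda>x. seval ks F (real_point x))"
    by (rule cont_scalar_seval[OF U F(1)]) (auto intro: real_point_spoints[OF U] cont_scalar_real_point)
  thus ?thesis
    unfolding cont_scalar_def using F(2)[OF real_point_spoints(1)[OF U]]
    by (simp cong: continuous_on_cong)
qed

lemma representable_seval:
  "smooth_sfun ks U F \<Longrightarrow> sfun_parity ks U b F \<Longrightarrow> representable ks U b (seval ks F)"
  by (auto simp: representable_def)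

lemma representable_left_deriv:
  assumes "openin_body ks U" "smooth_sfun ks U F" "sfun_parity ks U b F" "a < length ks"
  shows "representable ks U (b \<noteq> (ks ! a = Odd)) (seval ks (left_deriv ks a F))"
  using assms by (intro representable_seval smooth_sfun_left_deriv sfun_parity_left_deriv)

lemma representable_partials:
  assumes U: "openin_body ks U" and V: "representable ks U b V"
  obtains D where "has_partials ks U V D"
    "\<And>a. a < length ks \<Longrightarrow> representable ks U (b \<noteq> (ks ! a = Odd)) (D a)"
proof -
  obtain F where F: "smooth_sfun ks U F" "sfun_parity ks U b F" "\<And>X. X \<in> spoints ks U \<Longrightarrow> V X = seval ks F X"
    using V by (auto simp: representable_def)
  show thesis
    by (rule that[OF has_partials_cong[OF F(3) has_partials_seval[OF U F(1)]]])
      (use F U representable_left_deriv in auto)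
qed

text \<open>A class that the chain and product rules do not leave: the derivative of
  \<open>seval ks' F (Y X)\<close> is a sum of products of derivatives of \<open>Y\<close>, which
  are representable, with terms of the same form for the derivatives of \<open>F\<close>.\<close>

inductive composed :: "kind list \<Rightarrow> (nat \<Rightarrow> real) set \<Rightarrow> kind list \<Rightarrow> (nat \<Rightarrow> real) set \<Rightarrow>
    ((nat \<Rightarrow> scalar) \<Rightarrow> nat \<Rightarrow> scalar) \<Rightarrow> bool \<Rightarrow> ((nat \<Rightarrow> scalar) \<Rightarrow> scalar) \<Rightarrow> bool"
  for ks U ks' U' Y where
  rep: "representable ks U b V \<Longrightarrow> composed ks U ks' U' Y b V"
| const: "has_parity b c \<Longrightarrow> composed ks U ks' U' Y b (\<lambda>_. c)"
| coord: "a < length ks \<Longrightarrow> composed ks U ks' U' Y (ks ! a = Odd) (\<lambda>X. X a)"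
| comp: "smooth_sfun ks' U' F \<Longrightarrow> sfun_parity ks' U' b F \<Longrightarrow> composed ks U ks' U' Y b (\<lambda>X. seval ks' F (Y X))"
| add: "composed ks U ks' U' Y b V \<Longrightarrow> composed ks U ks' U' Y b W \<Longrightarrow> composed ks U ks' U' Y b (\<lambda>X. V X + W X)"
| mult: "composed ks U ks' U' Y b V \<Longrightarrow> composed ks U ks' U' Y c W \<Longrightarrow>
    composed ks U ks' U' Y (b \<noteq> c) (\<lambda>X. V X * W X)"

lemma composed_sum:
  "finite A \<Longrightarrow> (\<And>i. i \<in> A \<Longrightarrow> composed ks U ks' U' Y b (V i)) \<Longrightarrow>
    composed ks U ks' U' Y b (\<lambda>X. \<Sum>i\<in>A. V i X)"
  by (induction A rule: finite_induct) (auto intro: composed.const composed.add)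

text \<open>The sign comes from moving the velocity \<open>X' a\<close> to the front past
  \<open>V\<close>.\<close>

lemma has_partials_mult:
  assumes V: "has_partials ks U V D" and W: "has_partials ks U W E"
    and p: "\<And>X. X \<in> spoints ks U \<Longrightarrow> has_parity b (V X)"
  shows "has_partials ks U (\<lambda>X. V X * W X) (\<lambda>a X. D a X * W X + (- 1) ^ (of_bool b * par ks a) * (V X * E a X))"
  unfolding has_partials_def
proof (intro allI impI)
  fix X X' t
  assume d: "\<forall>a<length ks. has_sderiv (\<lambda>s. X s a) (X' a) t" and ev: "eventually (\<lambda>s. X s \<in> spoints ks U) (nhds t)"
  have Xt: "X t \<in> spoints ks U" using ev eventually_nhds_x_imp_x by blast
  have "V (X t) * (X' a * E a (X t)) = X' a * ((- 1) ^ (of_bool b * par ks a) * (V (X t) * E a (X t)))"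
    if a: "a < length ks" for a
  proof -
    have "eventually (\<lambda>s. has_parity (ks ! a = Odd) (X s a)) (nhds t)"
      using ev by eventually_elim (rule spoints_parity[OF _ a])
    hence "has_parity (ks ! a = Odd) (X' a)" using d a has_sderiv_parity by blast
    from supercommute[OF p[OF Xt] this]
    have "V (X t) * X' a = (- 1) ^ (of_bool b * par ks a) * (X' a * V (X t))" by (simp add: par_def)
    hence "V (X t) * (X' a * E a (X t)) = (- 1) ^ (of_bool b * par ks a) * (X' a * V (X t)) * E a (X t)"
      by (simp only: mult.assoc [symmetric])
    thus ?thesis by (metis mult.assoc sign_mult_commute)
  qed
  hence "(\<Sum>a<length ks. X' a * D a (X t)) * W (X t) + V (X t) * (\<Sum>a<length ks. X' a * E a (X t)) =
      (\<Sum>a<length ks. X' a * (D a (X t) * W (X t) + (- 1) ^ (of_bool b * par ks a) * (V (X t) * E a (X t))))"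
    by (simp add: sum_distrib_left sum_distrib_right mult.assoc distrib_left sum.distrib)
  moreover have "has_sderiv (\<lambda>s. V (X s) * W (X s))
      ((\<Sum>a<length ks. X' a * D a (X t)) * W (X t) + V (X t) * (\<Sum>a<length ks. X' a * E a (X t))) t"
    by (rule has_sderiv_mult[OF has_partialsD[OF V _ ev] has_partialsD[OF W _ ev]]) (use d in auto)
  ultimately show "has_sderiv (\<lambda>s. V (X s) * W (X s))
      (\<Sum>a<length ks. X' a * (D a (X t) * W (X t) + (- 1) ^ (of_bool b * par ks a) * (V (X t) * E a (X t)))) t"
    by (simp only:)
qed

lemma has_partials_compose:
  assumes F: "has_partials ks' U' V E"
    and Y: "\<And>i. i < length ks' \<Longrightarrow> has_partials ks U (\<lambda>X. Y X i) (D i)"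
    and Y': "\<And>X. X \<in> spoints ks U \<Longrightarrow> Y X \<in> spoints ks' U'"
  shows "has_partials ks U (\<lambda>X. V (Y X)) (\<lambda>a X. \<Sum>i<length ks'. D i a X * E i (Y X))"
  unfolding has_partials_def
proof (intro allI impI)
  fix X X' t
  assume d: "\<forall>a<length ks. has_sderiv (\<lambda>s. X s a) (X' a) t" and ev: "eventually (\<lambda>s. X s \<in> spoints ks U) (nhds t)"
  have ev': "eventually (\<lambda>s. Y (X s) \<in> spoints ks' U') (nhds t)" using ev by eventually_elim (rule Y')
  have "has_sderiv (\<lambda>s. V (Y (X s))) (\<Sum>i<length ks'. (\<Sum>a<length ks. X' a * D i a (X t)) * E i (Y (X t))) t"
    by (rule has_partialsD[OF F has_partialsD[OF Y _ ev] ev']) (use d in auto)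
  also have "(\<Sum>i<length ks'. (\<Sum>a<length ks. X' a * D i a (X t)) * E i (Y (X t))) =
      (\<Sum>a<length ks. X' a * (\<Sum>i<length ks'. D i a (X t) * E i (Y (X t))))"
    unfolding sum_distrib_left sum_distrib_right mult.assoc by (rule sum.swap)
  finally show "has_sderiv (\<lambda>s. V (Y (X s)))
      (\<Sum>a<length ks. X' a * (\<Sum>i<length ks'. D i a (X t) * E i (Y (X t)))) t" .
qed

lemma has_partials_coord:
  assumes "a < length ks"
  shows "has_partials ks U (\<lambda>X. X a) (\<lambda>b _. if b = a then 1 else 0)"
  unfolding has_partials_def
proof (intro allI impI)
  fix X :: "real \<Rightarrow> nat \<Rightarrow> scalar" and X' t
  assume d: "\<forall>a<length ks. has_sderiv (\<lambda>s. X s a) (X' a) t"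
  have "(\<Sum>b<length ks. X' b * (if b = a then 1 else 0)) = (\<Sum>b<length ks. if b = a then X' a else 0)"
    by (rule sum.cong) auto
  thus "has_sderiv (\<lambda>s. X s a) (\<Sum>b<length ks. X' b * (if b = a then 1 else 0)) t"
    using d assms by simp
qed

lemma has_partials_subset:
  assumes "has_partials ks U V D" "U' \<subseteq> U"
  shows "has_partials ks U' V D"
  unfolding has_partials_def
proof (intro allI impI)
  fix X X' t
  assume d: "\<forall>a<length ks. has_sderiv (\<lambda>s. X s a) (X' a) t"
    and "eventually (\<lambda>s. X s \<in> spoints ks U') (nhds t)"
  from this(2) have "eventually (\<lambda>s. X s \<in> spoints ks U) (nhds t)"
    by eventually_elim (rule spoints_mono[OF _ assms(2)])
  from has_partialsD[OF assms(1) _ this] d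
  show "has_sderiv (\<lambda>s. V (X s)) (\<Sum>a<length ks. X' a * D a (X t)) t" by blast
qed

lemma diff_closed_composed:
  assumes U: "openin_body ks U" and U': "openin_body ks' U'"
    and Y: "\<And>i. i < length ks' \<Longrightarrow> representable ks U (ks' ! i = Odd) (\<lambda>X. Y X i)"
    and Y': "\<And>X. X \<in> spoints ks U \<Longrightarrow> Y X \<in> spoints ks' U'"
  shows "diff_closed ks U (composed ks U ks' U' Y)"
proof -
  let ?C = "composed ks U ks' U' Y"
  have "(\<forall>X\<in>spoints ks U. has_parity b (V X)) \<and> cont_scalar U (\<lambda>x. V (real_point x)) \<and>
     (\<exists>D. has_partials ks U V D \<and> (\<forall>a<length ks. ?C (b \<noteq> (ks ! a = Odd)) (D a)))"
    if "?C b V" for b V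
    using that
  proof induction
    case (rep b V)
    obtain D where "has_partials ks U V D" "\<And>a. a < length ks \<Longrightarrow> representable ks U (b \<noteq> (ks ! a = Odd)) (D a)"
      using representable_partials[OF U rep] by blast
    thus ?case using representable_parity[OF U rep] representable_cont[OF U rep]
      by (auto intro!: exI[of _ D] composed.rep)
  next
    case (const b c)
    have "has_partials ks U (\<lambda>_. c) (\<lambda>_ _. 0)" by (simp add: has_partials_def)
    thus ?case using const by (auto intro!: exI[of _ "\<lambda>_ _. 0"] composed.const)
  next
    case (coord a)
    note has_partials_coord[OF coord, of U]
    moreover have "?C ((ks ! a = Odd) \<noteq> (ks ! c = Odd)) (\<lambda>_. if c = a then 1 else 0)" for c
      by (auto intro!: composed.const)
    ultimately show ?case
      using spoints_parity[OF _ coord] cont_scalar_real_point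
      by (intro conjI ballI exI[of _ "\<lambda>c _. if c = a then 1 else 0"]) auto
  next
    case (comp F b)
    have "\<forall>i. \<exists>D. i < length ks' \<longrightarrow> has_partials ks U (\<lambda>X. Y X i) D \<and>
        (\<forall>a<length ks. representable ks U ((ks' ! i = Odd) \<noteq> (ks ! a = Odd)) (D a))"
      using representable_partials[OF U Y] by metis
    then obtain D where D: "\<And>i. i < length ks' \<Longrightarrow> has_partials ks U (\<lambda>X. Y X i) (D i)"
      "\<And>i a. i < length ks' \<Longrightarrow> a < length ks \<Longrightarrow> representable ks U ((ks' ! i = Odd) \<noteq> (ks ! a = Odd)) (D i a)"
      by metis
    let ?D = "\<lambda>a X. \<Sum>i<length ks'. D i a X * seval ks' (left_deriv ks' i F) (Y X)"
    have "has_partials ks U (\<lambda>X. seval ks' F (Y X)) ?D"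
      by (rule has_partials_compose[OF has_partials_seval[OF U' comp(1)] D(1) Y'])
    moreover have "?C (b \<noteq> (ks ! a = Odd)) (?D a)" if a: "a < length ks" for a
    proof (rule composed_sum)
      fix i assume "i \<in> {..<length ks'}"
      hence i: "i < length ks'" by simp
      have "?C (((ks' ! i = Odd) \<noteq> (ks ! a = Odd)) \<noteq> (b \<noteq> (ks' ! i = Odd)))
          (\<lambda>X. D i a X * seval ks' (left_deriv ks' i F) (Y X))"
        by (intro composed.mult composed.rep D(2) composed.comp smooth_sfun_left_deriv sfun_parity_left_deriv
            U' comp i a)
      moreover have "(((ks' ! i = Odd) \<noteq> (ks ! a = Odd)) \<noteq> (b \<noteq> (ks' ! i = Odd))) = (b \<noteq> (ks ! a = Odd))" by auto
      ultimately show "?C (b \<noteq> (ks ! a = Odd)) (\<lambda>X. D i a X * seval ks' (left_deriv ks' i F) (Y X))" by simp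
    qed simp
    moreover have "cont_scalar U (\<lambda>x. seval ks' F (Y (real_point x)))"
      using Y' real_point_spoints(1)[OF U] representable_cont[OF U Y]
      by (intro cont_scalar_seval[OF U' comp(1)]) auto
    ultimately show ?case using has_parity_seval[OF U' comp(2) Y'] by blast
  next
    case (add b V W)
    then obtain D E where D: "has_partials ks U V D" "\<And>a. a < length ks \<Longrightarrow> ?C (b \<noteq> (ks ! a = Odd)) (D a)"
      and E: "has_partials ks U W E" "\<And>a. a < length ks \<Longrightarrow> ?C (b \<noteq> (ks ! a = Odd)) (E a)" by blast
    have "has_partials ks U (\<lambda>X. V X + W X) (\<lambda>a X. D a X + E a X)"
      using D(1) E(1) unfolding has_partials_def
      by (auto simp: distrib_left sum.distrib intro!: has_sderiv_add)
    moreover have "?C (b \<noteq> (ks ! a = Odd)) (\<lambda>X. D a X + E a X)" if "a < length ks" for a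
      by (intro composed.add D(2) E(2) that)
    moreover have "\<forall>X\<in>spoints ks U. has_parity b (V X + W X)"
      using add by (simp add: has_parity_add)
    moreover have "cont_scalar U (\<lambda>x. V (real_point x) + W (real_point x))"
      using add by (simp add: cont_scalar_add)
    ultimately show ?case by (intro conjI exI[of _ "\<lambda>a X. D a X + E a X"]) simp_all
  next
    case (mult b V c W)
    then obtain D E where D: "has_partials ks U V D" "\<And>a. a < length ks \<Longrightarrow> ?C (b \<noteq> (ks ! a = Odd)) (D a)"
      and E: "has_partials ks U W E" "\<And>a. a < length ks \<Longrightarrow> ?C (c \<noteq> (ks ! a = Odd)) (E a)" by blast
    let ?D = "\<lambda>a X. D a X * W X + (- 1) ^ (of_bool b * par ks a) * (V X * E a X)"
    have "has_partials ks U (\<lambda>X. V X * W X) ?D"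
      by (rule has_partials_mult[OF D(1) E(1)]) (use mult in blast)
    moreover have "?C ((b \<noteq> c) \<noteq> (ks ! a = Odd)) (?D a)" if a: "a < length ks" for a
    proof (rule composed.add)
      have "?C ((b \<noteq> (ks ! a = Odd)) \<noteq> c) (\<lambda>X. D a X * W X)"
        by (rule composed.mult[OF D(2)[OF a] mult(2)])
      moreover have "((b \<noteq> (ks ! a = Odd)) \<noteq> c) = ((b \<noteq> c) \<noteq> (ks ! a = Odd))" by auto
      ultimately show "?C ((b \<noteq> c) \<noteq> (ks ! a = Odd)) (\<lambda>X. D a X * W X)" by simp
      have "has_parity False ((- 1) ^ (of_bool b * par ks a))"
        by (metis has_parity_real_scalar real_scalar_sign)
      hence "?C (False \<noteq> (b \<noteq> (c \<noteq> (ks ! a = Odd)))) (\<lambda>X. (- 1) ^ (of_bool b * par ks a) * (V X * E a X))"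
        by (intro composed.mult[OF composed.const] composed.mult[OF mult(1)] E(2) a)
      moreover have "(False \<noteq> (b \<noteq> (c \<noteq> (ks ! a = Odd)))) = ((b \<noteq> c) \<noteq> (ks ! a = Odd))" by auto
      ultimately show "?C ((b \<noteq> c) \<noteq> (ks ! a = Odd)) (\<lambda>X. (- 1) ^ (of_bool b * par ks a) * (V X * E a X))" by simp
    qed
    moreover have "\<forall>X\<in>spoints ks U. has_parity (b \<noteq> c) (V X * W X)"
      using mult by (intro ballI has_parity_mult) simp_all
    moreover have "cont_scalar U (\<lambda>x. V (real_point x) * W (real_point x))"
      using mult by (simp add: cont_scalar_mult)
    ultimately show ?case by (intro conjI exI[of _ ?D]) blast+
  qed
  thus ?thesis unfolding diff_closed_def by (auto intro: composed.const)
qed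

context
  fixes ks :: "kind list" and U :: "(nat \<Rightarrow> real) set"
  assumes no_formal: "Formal \<notin> set ks" and U: "openin_body ks U"
begin

lemma representable_compose:
  assumes "openin_body ks' U'" "smooth_sfun ks' U' F" "sfun_parity ks' U' b F"
    and "\<And>i. i < length ks' \<Longrightarrow> representable ks U (ks' ! i = Odd) (\<lambda>X. Y X i)"
    and "\<And>X. X \<in> spoints ks U \<Longrightarrow> Y X \<in> spoints ks' U'"
  shows "representable ks U b (\<lambda>X. seval ks' F (Y X))"
  by (rule diff_closed_representable[OF no_formal U diff_closed_composed[OF U assms(1,4,5)]])
    (auto intro: composed.comp assms)

text \<open>An inner map into the space without coordinates turns the closure result for
  compositions into one for sums and products of representable maps, constants and
  coordinates.\<close>

lemma diff_closed_composed_trivial: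
  "diff_closed ks U (composed ks U [] (body_space []) (\<lambda>_ _. 0))"
  by (rule diff_closed_composed[OF U])
    (auto simp: spoints_def coord_tuples_def body_vec_def body_space_def even_idx_def)

lemmas representable_composed = diff_closed_representable[OF no_formal U diff_closed_composed_trivial]

lemma representable_const: "has_parity b c \<Longrightarrow> representable ks U b (\<lambda>_. c)"
  by (rule representable_composed) (rule composed.const)

lemma representable_coord: "a < length ks \<Longrightarrow> representable ks U (ks ! a = Odd) (\<lambda>X. X a)"
  by (rule representable_composed) (rule composed.coord)

lemma representable_add:
  "representable ks U b V \<Longrightarrow> representable ks U b W \<Longrightarrow> representable ks U b (\<lambda>X. V X + W X)"
  by (rule representable_composed) (intro composed.add composed.rep)

lemma representable_mult:
  "representable ks U b V \<Longrightarrow> representable ks U c W \<Longrightarrow> representable ks U (b \<noteq> c) (\<lambda>X. V X * W X)"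
  by (rule representable_composed) (intro composed.mult composed.rep)

lemma representable_sum:
  "finite A \<Longrightarrow> (\<And>i. i \<in> A \<Longrightarrow> representable ks U b (V i)) \<Longrightarrow> representable ks U b (\<lambda>X. \<Sum>i\<in>A. V i X)"
  by (rule representable_composed) (intro composed_sum composed.rep)

lemma representable_sign_mult:
  assumes "representable ks U b V"
  shows "representable ks U b (\<lambda>X. (- 1) ^ n * V X)"
proof -
  have "has_parity False ((- 1) ^ n)" by (metis has_parity_real_scalar real_scalar_sign)
  from representable_mult[OF representable_const[OF this] assms] show ?thesis by simp
qed

lemma representable_diff:
  "representable ks U b V \<Longrightarrow> representable ks U b W \<Longrightarrow> representable ks U b (\<lambda>X. V X - W X)"
  using representable_add[OF _ representable_sign_mult[of b W 1], of V] by simp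

text \<open>A coefficient with exponent 1 at an odd \<open>i\<close> is, up to sign, the coefficient
  of \<open>left_deriv ks i F\<close> with that exponent removed. Induction on the number of odd
  factors thus leads to values at ordinary points. The form modulo a power of \<epsilon> is what
  successive approximations need.\<close>

lemma sfun_determined:
  assumes F: "smooth_sfun ks U F" and G: "smooth_sfun ks U G"
    and eq: "\<And>X. X \<in> spoints ks U \<Longrightarrow> eps_cong K (seval ks F X) (seval ks G X)"
    and m: "m \<in> admissible ks" and x: "x \<in> U"
  shows "eps_cong K (F x m) (G x m)"
proof -
  define P where "P = (\<lambda>F G m. eps_cong K (F x m) (G x (m :: nat \<Rightarrow> nat)))"
  have "P F G m"
    if "smooth_sfun ks U F" "smooth_sfun ks U G"
      "\<forall>X\<in>spoints ks U. eps_cong K (seval ks F X) (seval ks G X)" "m \<in> admissible ks"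
      "(\<Sum>i\<in>odd_idx ks. m i) = n" for n F G m
    using that
  proof (induction n arbitrary: F G m)
    case 0
    have "m i = 0" for i
    proof (cases "i \<in> odd_idx ks")
      case True thus ?thesis using "0.prems"(5) by simp
    next
      case False
      have "i < length ks \<Longrightarrow> ks ! i \<noteq> Formal" using no_formal nth_mem by metis
      hence "i \<ge> length ks \<or> i \<in> even_idx ks"
        using False by (cases "ks ! i"; cases "i < length ks") (auto simp: odd_idx_def even_idx_def)
      thus ?thesis using \<open>m \<in> admissible ks\<close> by (auto simp: admissible_def)
    qed
    hence m0: "m = (\<lambda>_. 0)" by (rule ext)
    have "eps_cong K (seval ks F (real_point x)) (seval ks G (real_point x))"
      using "0.prems"(3) real_point_spoints(1)[OF U x] by blast
    thus ?case unfolding P_def seval_real_point[OF U x, of F] seval_real_point[OF U x, of G] m0 .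
  next
    case (Suc n)
    have "\<not> (\<forall>i\<in>odd_idx ks. m i = 0)"
    proof
      assume "\<forall>i\<in>odd_idx ks. m i = 0"
      hence "(\<Sum>i\<in>odd_idx ks. m i) = 0" by simp
      thus False using Suc.prems(5) by simp
    qed
    then obtain i where i: "i \<in> odd_idx ks" "m i \<noteq> 0" by blast
    have il: "i < length ks" "ks ! i = Odd" using i by (auto simp: odd_idx_def)
    have mi: "m i = 1" using i Suc.prems(4) by (auto simp: admissible_def le_Suc_eq)
    define m' where "m' = m(i := 0)"
    have m': "m' \<in> admissible ks" using Suc.prems(4) by (auto simp: m'_def admissible_def)
    have mm: "m'(i := 1) = m" "m' i = 0" using mi by (auto simp: m'_def)
    have "(\<Sum>j\<in>odd_idx ks. m j) = m i + (\<Sum>j\<in>odd_idx ks. m' j)"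
      by (simp add: sum.remove[OF finite_odd_idx i(1)] m'_def)
    hence n: "(\<Sum>j\<in>odd_idx ks. m' j) = n" using Suc.prems(5) mi by simp
    have "eps_cong K (seval ks (left_deriv ks i F) X) (seval ks (left_deriv ks i G) X)" if X: "X \<in> spoints ks U" for X
    proof -
      have "eps_cong K (seval ks (left_deriv ks i F) X - seval ks (left_deriv ks i G) X) 0"
      proof (rule has_partials_eps_zero[OF has_partials_diff[OF has_partials_seval[OF U Suc.prems(1)]
              has_partials_seval[OF U Suc.prems(2)]] X il(1)])
        fix Z assume "Z \<in> spoints ks {body_vec ks X}"
        from bspec[OF Suc.prems(3) spoints_same_body[OF this X]]
        show "eps_cong K (seval ks F Z - seval ks G Z) 0" by (simp add: eps_cong_def)
      qed
      thus ?thesis by (simp add: eps_cong_def)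
    qed
    with Suc.IH[OF smooth_sfun_left_deriv[OF U Suc.prems(1) il(1)]
        smooth_sfun_left_deriv[OF U Suc.prems(2) il(1)] _ m' n]
    have "P (left_deriv ks i F) (left_deriv ks i G) m'" by blast
    thus ?case using il mm by (simp add: P_def left_deriv_def eps_cong_def)
  qed
  from this[OF F G _ m refl] eq have "P F G m" by blast
  thus ?thesis by (simp add: P_def)
qed

text \<open>Under \<epsilon>-adic convergence every coefficient becomes stationary, so each
  coefficient of the limit belongs to a single approximation and is smooth without any uniform
  estimate.\<close>

lemma representable_limit:
  assumes V: "\<And>n. representable ks U b (V n)"
    and lim: "\<And>n X. X \<in> spoints ks U \<Longrightarrow> eps_cong n (W X) (V n X)"
  shows "representable ks U b W"
proof -
  have "\<forall>n. \<exists>F. smooth_sfun ks U F \<and> sfun_parity ks U b F \<and> (\<forall>X\<in>spoints ks U. V n X = seval ks F X)"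
    using V by (simp add: representable_def)
  then obtain F where F: "\<And>n. smooth_sfun ks U (F n)" "\<And>n. sfun_parity ks U b (F n)"
    "\<And>n X. X \<in> spoints ks U \<Longrightarrow> V n X = seval ks (F n) X" by metis
  \<comment> \<open>Agreement modulo the power \<open>n\<close> of \<epsilon> covers the degrees
    below \<open>n\<close>, so degree \<open>k\<close> is read from approximation
    \<open>Suc k\<close>.\<close>
  define H where "H = (\<lambda>x m. mk_scalar (\<lambda>k J. scoeff (F (Suc k) x m) k J))"
  have H: "scoeff (H x m) k J = scoeff (F (Suc k) x m) k J" for x m k J
    by (cases "finite J") (simp_all add: H_def)
  have "eps_cong n (seval ks (F n) X) (seval ks (F n') X)" if "X \<in> spoints ks U" "n \<le> n'" for n n' X
    using lim[OF that(1)] that eps_cong_mono eps_cong_trans eps_cong_sym unfolding F(3)[OF that(1)] by metis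
  hence "eps_cong n (F n x m) (F n' x m)" if "n \<le> n'" "m \<in> admissible ks" "x \<in> U" for n n' m x
    using sfun_determined[OF F(1) F(1) _ that(2,3)] that(1) by blast
  hence FH: "eps_cong n (H x m) (F n x m)" if "m \<in> admissible ks" "x \<in> U" for n m x
    using that unfolding eps_cong_def H by (metis Suc_leI lessI)
  have "smooth_sfun ks U H"
    unfolding smooth_sfun_def H using F(1) by (simp add: smooth_sfun_def)
  moreover have "sfun_parity ks U b H"
    using F(2) unfolding sfun_parity_def has_parity_def H by blast
  moreover have "W X = seval ks H X" if X: "X \<in> spoints ks U" for X
  proof (rule eps_cong_eqI)
    fix n
    have "eps_cong n (seval ks H X) (seval ks (F n) X)"
      by (rule eps_cong_seval[OF U refl spoints_body[OF X]]) (auto intro: FH)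
    thus "eps_cong n (W X) (seval ks H X)"
      using lim[OF X, of n] F(3)[OF X] eps_cong_trans eps_cong_sym by metis
  qed
  ultimately show ?thesis unfolding representable_def by blast
qed

end

text \<open>Local representatives agree on overlaps because a superfunction is determined by its
  values at points. Hence the diagonal choice \<open>F x x\<close> coincides near every point with
  one smooth representative.\<close>

lemma representable_local:
  assumes nf: "Formal \<notin> set ks" and U: "openin_body ks U"
    and loc: "\<And>x. x \<in> U \<Longrightarrow> \<exists>U'. openin_body ks U' \<and> x \<in> U' \<and> U' \<subseteq> U \<and> representable ks U' b V"
  shows "representable ks U b V"
proof -
  define P where "P = (\<lambda>x N F. openin_body ks N \<and> x \<in> N \<and> N \<subseteq> U \<and> smooth_sfun ks N F \<and>
      sfun_parity ks N b F \<and> (\<forall>X\<in>spoints ks N. V X = seval ks F X))"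
  have "\<exists>N F. x \<in> U \<longrightarrow> P x N F" for x
  proof (cases "x \<in> U")
    case True
    from loc[OF this] obtain N where N: "openin_body ks N" "x \<in> N" "N \<subseteq> U" "representable ks N b V" by blast
    from N(4) obtain F where "smooth_sfun ks N F" "sfun_parity ks N b F" "\<forall>X\<in>spoints ks N. V X = seval ks F X"
      unfolding representable_def by blast
    hence "P x N F" using N unfolding P_def by blast
    thus ?thesis by blast
  qed simp
  hence "\<forall>x. \<exists>N F. x \<in> U \<longrightarrow> P x N F" by blast
  from choice[OF this] obtain N where "\<forall>x. \<exists>F. x \<in> U \<longrightarrow> P x (N x) F" by blast
  from choice[OF this] obtain F where "\<forall>x. x \<in> U \<longrightarrow> P x (N x) (F x)" by blast
  hence N: "\<And>x. x \<in> U \<Longrightarrow> openin_body ks (N x)" "\<And>x. x \<in> U \<Longrightarrow> x \<in> N x" "\<And>x. x \<in> U \<Longrightarrow> N x \<subseteq> U"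
    and F: "\<And>x. x \<in> U \<Longrightarrow> smooth_sfun ks (N x) (F x)" "\<And>x. x \<in> U \<Longrightarrow> sfun_parity ks (N x) b (F x)"
      "\<And>x X. x \<in> U \<Longrightarrow> X \<in> spoints ks (N x) \<Longrightarrow> V X = seval ks (F x) X"
    unfolding P_def by blast+
  define H where "H = (\<lambda>x. F x x)"
  have HF: "H z m = F x z m" if x: "x \<in> U" and z: "z \<in> N x" and m: "m \<in> admissible ks" for x z m
  proof -
    have zU: "z \<in> U" using N(3)[OF x] z by blast
    let ?N = "N x \<inter> N z"
    have o: "openin_body ks ?N" using N(1) x zU by blast
    have s: "smooth_sfun ks ?N (F y)" if "?N \<subseteq> N y" "y \<in> U" for y
      using F(1)[OF that(2)] smooth_real_subset[OF o that(1)] by (simp add: smooth_sfun_def)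
    have "eps_cong K (F z z m) (F x z m)" for K
    proof (rule sfun_determined[OF nf o s s _ m])
      show "eps_cong K (seval ks (F z) X) (seval ks (F x) X)" if "X \<in> spoints ks ?N" for X
        using F(3)[OF x spoints_mono[OF that]] F(3)[OF zU spoints_mono[OF that]] by simp
    qed (use x z zU N(2) in auto)
    thus ?thesis unfolding H_def by (rule eps_cong_eqI)
  qed
  have "smooth_real ks U (\<lambda>x. scoeff (H x m) k J)" if m: "m \<in> admissible ks" for m k J
  proof (rule smooth_real_local[OF U])
    fix x assume x: "x \<in> U"
    show "\<exists>V h'. openin_body ks V \<and> x \<in> V \<and> V \<subseteq> U \<and> smooth_real ks V h' \<and> (\<forall>z\<in>V. scoeff (H z m) k J = h' z)"
      using N[OF x] HF[OF x _ m] smooth_sfun_coeff[OF F(1)[OF x] m]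
      by (intro exI[of _ "N x"] exI[of _ "\<lambda>z. scoeff (F x z m) k J"]) auto
  qed
  moreover have "sfun_parity ks U b H"
    using F(2) N(2) by (auto simp: sfun_parity_def H_def)
  moreover have "V X = seval ks H X" if X: "X \<in> spoints ks U" for X
  proof -
    let ?x = "body_vec ks X"
    have x: "?x \<in> U" using spoints_body[OF X] .
    have "X \<in> spoints ks (N ?x)" using X N(2)[OF x] by (simp add: spoints_def)
    moreover have "seval ks (F ?x) X = seval ks H X"
      by (rule seval_cong[OF N(1)[OF x] N(2)[OF x]]) (simp add: HF[OF x])
    ultimately show ?thesis using F(3)[OF x] by simp
  qed
  ultimately show ?thesis unfolding representable_def smooth_sfun_def by blast
qed

subsection \<open>Scaling by \<open>\<epsilon>\<close> and the body of a value\<close>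

lemma taylor_coeff_eps_mult: "taylor_coeff ks e (\<lambda>x m. fps_X * F x m) x = fps_X * taylor_coeff ks e F x"
  by (rule scalar_eqI) (simp add: scoeff_taylor_coeff scoeff_eps_mult foldr_partial_zero)

lemma seval_eps_mult: "seval ks (\<lambda>x m. fps_X * F x m) X = fps_X * seval ks F X"
proof (rule scalar_eqI)
  fix k J assume J: "finite (J :: nat set)"
  have "a * (fps_X * b) = fps_X * (a * b)" for a b :: scalar
    by (metis eps_commute mult.assoc)
  hence *: "seval_sum ks N (\<lambda>x m. fps_X * F x m) X = fps_X * seval_sum ks N F X" for N
    by (simp add: seval_sum_def taylor_coeff_eps_mult sum_distrib_left)
  show "scoeff (seval ks (\<lambda>x m. fps_X * F x m) X) k J = scoeff (fps_X * seval ks F X) k J"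
    using J by (simp add: scoeff_seval[of J _ "k + card J"] * scoeff_eps_mult)
qed

lemma left_deriv_eps_mult:
  assumes "i < length ks"
  shows "left_deriv ks i (\<lambda>x m. fps_X * F x m) = (\<lambda>x m. fps_X * left_deriv ks i F x m)"
proof (intro ext scalar_eqI)
  fix x m k J
  show "scoeff (left_deriv ks i (\<lambda>x m. fps_X * F x m) x m) k J = scoeff (fps_X * left_deriv ks i F x m) k J"
  proof (cases "i \<in> even_idx ks")
    case True
    show ?thesis
      by (cases "k = 0") (simp_all add: scoeff_left_deriv_Even[OF True] scoeff_eps_mult, simp add: partial_deriv_def)
  qed (simp add: left_deriv_nonEven[OF _ assms] scoeff_eps_mult)
qed

lemma smooth_sfun_eps_mult:
  assumes "smooth_sfun ks U F"
  shows "smooth_sfun ks U (\<lambda>x m. fps_X * F x m)"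
  unfolding smooth_sfun_def
proof (intro ballI allI)
  fix m k J assume "m \<in> admissible ks"
  from smooth_sfun_coeff[OF assms this]
  show "smooth_real ks U (\<lambda>x. scoeff (fps_X * F x m) k J)"
    by (cases "k = 0") (simp_all add: scoeff_eps_mult smooth_real_zero)
qed

lemma sfun_parity_eps_mult: "sfun_parity ks U b F \<Longrightarrow> sfun_parity ks U b (\<lambda>x m. fps_X * F x m)"
  by (simp add: sfun_parity_def has_parity_eps_mult)

lemma sbody_eps [simp]: "sbody fps_X = 0"
  using sbody_simps(7)[of 1] by simp

lemma sbody_seval: "sbody (seval ks F X) = sbody (F (body_vec ks X) (\<lambda>_. 0))"
proof -
  have "exponents ks 0 = {\<lambda>_. 0}"
  proof (intro set_eqI iffI)
    fix e assume e: "e \<in> exponents ks 0"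
    have "e i = 0" for i using e by (cases "i < length ks") (auto simp: exponents_def)
    thus "e \<in> {\<lambda>_. 0}" by auto
  qed (simp add: exponents_def)
  hence "scoeff (seval ks F X) 0 {} = scoeff (F (body_vec ks X) (\<lambda>_. 0)) 0 {}"
    by (simp add: scoeff_seval[of "{}" 0 0] seval_sum_def soul_monomial_zero taylor_coeff_zero)
  thus ?thesis by (simp add: sbody_def)
qed

section \<open>Charts\<close>

lemma supermanifold_no_formal: "supermanifold M \<Longrightarrow> Formal \<notin> set (mf_kinds M)"
  by (simp add: supermanifold_def)

lemma chart_facts:
  assumes "supermanifold M" "c \<in> mf_charts M"
  shows "openin (mf_top M) (mf_dom M c)" "openin_body (mf_kinds M) (mf_coord M c ` mf_dom M c)"
    "homeomorphic_map (subtopology (mf_top M) (mf_dom M c)) (top_of_set (mf_coord M c ` mf_dom M c)) (mf_coord M c)"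
proof -
  have "\<forall>c\<in>mf_charts M. openin (mf_top M) (mf_dom M c) \<and>
      openin_body (mf_kinds M) (mf_coord M c ` mf_dom M c) \<and>
      homeomorphic_map (subtopology (mf_top M) (mf_dom M c)) (top_of_set (mf_coord M c ` mf_dom M c)) (mf_coord M c)"
    using assms(1) unfolding supermanifold_def by (elim conjE)
  from bspec[OF this assms(2)]
  show "openin (mf_top M) (mf_dom M c)" "openin_body (mf_kinds M) (mf_coord M c ` mf_dom M c)"
    "homeomorphic_map (subtopology (mf_top M) (mf_dom M c)) (top_of_set (mf_coord M c ` mf_dom M c)) (mf_coord M c)"
    by simp_all
qed

lemma chart_inj:
  assumes "supermanifold M" "c \<in> mf_charts M"
  shows "inj_on (mf_coord M c) (mf_dom M c)"
proof -
  have "topspace (subtopology (mf_top M) (mf_dom M c)) = mf_dom M c"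
    using openin_subset[OF chart_facts(1)[OF assms]] by auto
  thus ?thesis using homeomorphic_imp_injective_map[OF chart_facts(3)[OF assms]] by metis
qed

lemma chart_image_open:
  assumes M: "supermanifold M" "c \<in> mf_charts M" and W: "openin (mf_top M) W" "W \<subseteq> mf_dom M c"
  shows "openin_body (mf_kinds M) (mf_coord M c ` W)"
proof -
  have "openin (subtopology (mf_top M) (mf_dom M c)) W"
    using W by (simp add: openin_subset_topspace_eq openin_subtopology_Int2 openin_subtopology) (metis Int_absorb2)
  hence "openin (top_of_set (mf_coord M c ` mf_dom M c)) (mf_coord M c ` W)"
    using homeomorphic_imp_open_map[OF chart_facts(3)[OF M]] by (simp add: open_map_def)
  thus ?thesis using chart_facts(2)[OF M] by (rule openin_trans)
qed

lemma mf_points_spoints: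
  "(m, X) \<in> mf_points M \<Longrightarrow> c \<in> charts_at M m \<Longrightarrow> X c \<in> spoints (mf_kinds M) {mf_coord M c m}"
  unfolding mf_points_def by blast

section \<open>The pullback equations in a pair of charts\<close>

definition overlap :: "('p, 'c) smanifold \<Rightarrow> ('q, 'd) smanifold \<Rightarrow> ('p \<Rightarrow> 'q) \<Rightarrow> 'c \<Rightarrow> 'd \<Rightarrow> 'p set" where
  "overlap M1 M2 \<phi> c d = {m \<in> mf_dom M1 c. \<phi> m \<in> mf_dom M2 d}"

section \<open>The arguments of the generating function\<close>

lemma length_gf_kinds: "length (gf_kinds M1 M2) = mf_dim M1 + mf_dim M2"
  by (simp add: gf_kinds_def mf_dim_def)

lemma gf_kinds_nth:
  "a < mf_dim M1 \<Longrightarrow> gf_kinds M1 M2 ! a = mf_kinds M1 ! a"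
  "i < mf_dim M2 \<Longrightarrow> gf_kinds M1 M2 ! (mf_dim M1 + i) = (if mf_kinds M2 ! i = Odd then Odd else Formal)"
  by (simp_all add: gf_kinds_def mf_dim_def nth_append)

lemma gf_kinds_Odd: "i < mf_dim M2 \<Longrightarrow> (gf_kinds M1 M2 ! (mf_dim M1 + i) = Odd) = (mf_kinds M2 ! i = Odd)"
  by (simp add: gf_kinds_nth)

lemma gf_index_cases:
  assumes "j < mf_dim M1 + mf_dim M2"
  obtains "j < mf_dim M1" | i where "j = mf_dim M1 + i" "i < mf_dim M2"
  using assms le_Suc_ex[of "mf_dim M1" j] by (cases "j < mf_dim M1") auto

text \<open>Momenta are odd or formal, so the underlying space of the arguments of \<open>S\<close>
  is that of \<open>M1\<close> alone.\<close>

lemma even_idx_gf_kinds: "even_idx (gf_kinds M1 M2) = even_idx (mf_kinds M1)"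
proof (rule set_eqI)
  fix j
  have "gf_kinds M1 M2 ! (mf_dim M1 + i) \<noteq> Even" if "i < mf_dim M2" for i
    using that by (simp add: gf_kinds_nth)
  hence "j < mf_dim M1 \<and> gf_kinds M1 M2 ! j = mf_kinds M1 ! j"
    if "j < mf_dim M1 + mf_dim M2" "gf_kinds M1 M2 ! j = Even"
    using that(2) by (cases rule: gf_index_cases[OF that(1)]) (auto simp: gf_kinds_nth)
  thus "j \<in> even_idx (gf_kinds M1 M2) \<longleftrightarrow> j \<in> even_idx (mf_kinds M1)"
    by (auto simp: even_idx_def length_gf_kinds gf_kinds_nth mf_dim_def[symmetric])
qed

lemma body_space_gf_kinds: "body_space (gf_kinds M1 M2) = body_space (mf_kinds M1)"
  by (simp add: body_space_def even_idx_gf_kinds)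

lemma body_vec_gf_args: "body_vec (gf_kinds M1 M2) (gf_args M1 X q) = body_vec (mf_kinds M1) X"
  unfolding body_vec_def even_idx_gf_kinds
  by (rule ext) (auto simp: gf_args_def mf_dim_def dest: even_idx_less)

text \<open>Momenta at which a formal power series in \<open>q\<close> can be evaluated: correct
  parities and no bodies.\<close>

definition small_tuple :: "kind list \<Rightarrow> (nat \<Rightarrow> scalar) \<Rightarrow> bool" where
  "small_tuple ks q \<longleftrightarrow> q \<in> coord_tuples ks \<and> (\<forall>i<length ks. sbody (q i) = 0)"

lemma gf_args_spoints:
  assumes X: "X \<in> spoints (mf_kinds M1) U" and q: "small_tuple (mf_kinds M2) q" and nf: "Formal \<notin> set (mf_kinds M1)"
  shows "gf_args M1 X q \<in> spoints (gf_kinds M1 M2) U"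
proof -
  let ?gk = "gf_kinds M1 M2"
  have "has_parity (?gk ! j = Odd) (gf_args M1 X q j) \<and> (?gk ! j = Formal \<longrightarrow> sbody (gf_args M1 X q j) = 0)"
    if j: "j < mf_dim M1 + mf_dim M2" for j
  proof (cases "j < mf_dim M1")
    case True
    moreover have "mf_kinds M1 ! j \<noteq> Formal" using True nf nth_mem unfolding mf_dim_def by metis
    ultimately show ?thesis using spoints_parity[OF X, of j] by (simp add: gf_args_def gf_kinds_nth mf_dim_def)
  next
    case False
    then obtain i where i: "j = mf_dim M1 + i" "i < mf_dim M2" using j by (metis add_less_cancel_left le_Suc_ex not_less)
    thus ?thesis using q by (simp add: gf_args_def gf_kinds_Odd small_tuple_def coord_tuples_def mf_dim_def[of M2])
  qed
  moreover have "gf_args M1 X q j = 0" if "j \<ge> mf_dim M1 + mf_dim M2" for j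
    using that q by (auto simp: gf_args_def small_tuple_def coord_tuples_def mf_dim_def)
  ultimately show ?thesis
    using spoints_body[OF X] by (simp add: spoints_def coord_tuples_def length_gf_kinds body_vec_gf_args)
qed

context
  fixes M1 :: "('p, 'c) smanifold" and M2 :: "('q, 'd) smanifold"
    and \<phi> :: "'p \<Rightarrow> 'q" and S :: "'c \<Rightarrow> 'd \<Rightarrow> sfun" and g :: "'d \<Rightarrow> sfun" and c :: 'c and d :: 'd
  assumes M1: "supermanifold M1" and M2: "supermanifold M2"
    and S: "generating_function M1 M2 \<phi> S" and g: "smooth_function M2 g"
    and c: "c \<in> mf_charts M1" and d: "d \<in> mf_charts M2"
begin

private abbreviation (input) "ks1 \<equiv> mf_kinds M1"
private abbreviation (input) "ks2 \<equiv> mf_kinds M2"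
private abbreviation (input) "gk \<equiv> gf_kinds M1 M2"
private abbreviation (input) "U1 \<equiv> mf_coord M1 c ` overlap M1 M2 \<phi> c d"
private abbreviation (input) "U2 \<equiv> mf_coord M2 d ` mf_dom M2 d"

text \<open>Together with \<open>q_of\<close> the right-hand sides of the two equations, padded with
  0 beyond the dimension so that solving them is an equality of functions.\<close>

definition y_of :: "(nat \<Rightarrow> scalar) \<Rightarrow> (nat \<Rightarrow> scalar) \<Rightarrow> nat \<Rightarrow> scalar" where
  "y_of X q = (\<lambda>i. if i < mf_dim M2 then gf_y M1 M2 (S c d) X q i else 0)"

definition q_of :: "(nat \<Rightarrow> scalar) \<Rightarrow> nat \<Rightarrow> scalar" where
  "q_of y = (\<lambda>i. if i < mf_dim M2 then seval (mf_kinds M2) (left_deriv (mf_kinds M2) i (eps_times g d)) y else 0)"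

lemma openin_overlap: "openin_body ks1 U1"
proof (rule chart_image_open[OF M1 c])
  have "continuous_map (mf_top M1) (mf_top M2) \<phi>" using S by (simp add: generating_function_def)
  hence "openin (mf_top M1) {m \<in> topspace (mf_top M1). \<phi> m \<in> mf_dom M2 d}"
    using chart_facts(1)[OF M2 d] by (rule openin_continuous_map_preimage)
  moreover have "overlap M1 M2 \<phi> c d = mf_dom M1 c \<inter> {m \<in> topspace (mf_top M1). \<phi> m \<in> mf_dom M2 d}"
    using openin_subset[OF chart_facts(1)[OF M1 c]] by (auto simp: overlap_def)
  ultimately show "openin (mf_top M1) (overlap M1 M2 \<phi> c d)"
    using chart_facts(1)[OF M1 c] by auto
qed (auto simp: overlap_def)

lemma openin_overlap_gf: "openin_body gk U1"
  using openin_overlap by (simp add: body_space_gf_kinds)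

lemma generating_function_chart:
  "smooth_sfun gk U1 (S c d)" "sfun_parity gk U1 False (S c d)"
  "m \<in> overlap M1 M2 \<phi> c d \<Longrightarrow> i \<in> even_idx ks2 \<Longrightarrow>
    sbody (gf_dq M1 M2 i (S c d) (mf_coord M1 c m) (\<lambda>_. 0)) = mf_coord M2 d (\<phi> m) i"
proof -
  have "\<forall>c\<in>mf_charts M1. \<forall>d\<in>mf_charts M2. let D = {m \<in> mf_dom M1 c. \<phi> m \<in> mf_dom M2 d}; U = mf_coord M1 c ` D in
        smooth_sfun gk U (S c d) \<and> sfun_parity gk U False (S c d) \<and> eps_free gk U (S c d) \<and>
        (\<forall>m\<in>D. \<forall>i\<in>even_idx ks2.
           sbody (gf_dq M1 M2 i (S c d) (mf_coord M1 c m) (\<lambda>_. 0)) = mf_coord M2 d (\<phi> m) i)"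
    using S unfolding generating_function_def by (elim conjE)
  from bspec[OF bspec[OF this c] d]
  show "smooth_sfun gk U1 (S c d)" "sfun_parity gk U1 False (S c d)"
    "m \<in> overlap M1 M2 \<phi> c d \<Longrightarrow> i \<in> even_idx ks2 \<Longrightarrow>
      sbody (gf_dq M1 M2 i (S c d) (mf_coord M1 c m) (\<lambda>_. 0)) = mf_coord M2 d (\<phi> m) i"
    unfolding Let_def overlap_def by simp_all
qed

private lemma g_facts: "smooth_sfun ks2 U2 (eps_times g d)" "sfun_parity ks2 U2 False (eps_times g d)"
proof -
  have "smooth_sfun ks2 U2 (g d)" "sfun_parity ks2 U2 False (g d)"
    using g d by (simp_all add: smooth_function_def)
  thus "smooth_sfun ks2 U2 (eps_times g d)" "sfun_parity ks2 U2 False (eps_times g d)"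
    unfolding eps_times_def by (simp_all add: smooth_sfun_eps_mult sfun_parity_eps_mult)
qed

private lemmas openin_U2 = chart_facts(2)[OF M2 d]
private lemmas nf1 = supermanifold_no_formal[OF M1]
private lemmas nf2 = supermanifold_no_formal[OF M2]

text \<open>The explicit factor \<epsilon> makes the momenta free of bodies and the iteration
  contracting.\<close>

lemma q_of_eps: "i < mf_dim M2 \<Longrightarrow> q_of y i = fps_X * seval ks2 (left_deriv ks2 i (g d)) y"
  by (simp add: q_of_def eps_times_def left_deriv_eps_mult mf_dim_def seval_eps_mult)

lemma small_q_of:
  assumes "y \<in> spoints ks2 U2"
  shows "small_tuple ks2 (q_of y)"
proof -
  have "has_parity (ks2 ! i = Odd) (q_of y i)" if "i < length ks2" for i
    using has_parity_seval[OF openin_U2 sfun_parity_left_deriv[OF openin_U2 g_facts(2) that] assms] that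
    by (simp add: q_of_def mf_dim_def)
  moreover have "sbody (q_of y i) = 0" if "i < length ks2" for i
    using that by (simp add: q_of_eps mf_dim_def)
  ultimately show ?thesis by (simp add: small_tuple_def coord_tuples_def) (simp add: q_of_def mf_dim_def)
qed

text \<open>As \<open>q\<close> has no body, only the first-order coefficients of \<open>S\<close>
  in \<open>q\<close> contribute to the body of \<open>y\<close>, and these give the coordinates of
  \<open>\<phi> m\<close>. So \<open>y\<close> stays in the chart, over an underlying point that
  does not depend on \<open>q\<close>.\<close>

lemma y_of_body:
  assumes m: "m \<in> overlap M1 M2 \<phi> c d" and X: "X \<in> spoints ks1 {mf_coord M1 c m}" and q: "small_tuple ks2 q"
  shows "y_of X q \<in> spoints ks2 {mf_coord M2 d (\<phi> m)}"
proof -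
  have X': "X \<in> spoints ks1 U1" using X m by (auto intro: spoints_mono)
  have Z: "gf_args M1 X q \<in> spoints gk U1" by (rule gf_args_spoints[OF X' q nf1])
  have par: "has_parity (ks2 ! i = Odd) (y_of X q i)" if i: "i < mf_dim M2" for i
  proof -
    have i': "mf_dim M1 + i < length gk" using i by (simp add: length_gf_kinds)
    have "has_parity (ks2 ! i = Odd) (gf_eval M1 M2 (gf_dq M1 M2 i (S c d)) X q)"
      using has_parity_seval[OF openin_overlap_gf sfun_parity_left_deriv[OF openin_overlap_gf generating_function_chart(2) i'] Z] i
      by (simp add: gf_eval_def gf_dq_def gf_kinds_Odd)
    thus ?thesis using i by (simp add: y_of_def gf_y_def has_parity_sign_mult del: power_Suc)
  qed
  have \<phi>m: "mf_coord M2 d (\<phi> m) \<in> body_space ks2"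
    using openin_body_subset[OF openin_U2] m by (auto simp: overlap_def)
  have "sbody (y_of X q i) = mf_coord M2 d (\<phi> m) i" if i: "i \<in> even_idx ks2" for i
  proof -
    have "i < mf_dim M2" "par ks2 i = 0" using i by (auto simp: even_idx_def mf_dim_def par_def)
    moreover have "body_vec ks1 X = mf_coord M1 c m" using spoints_body[OF X] by simp
    ultimately show ?thesis
      using generating_function_chart(3)[OF m i] by (simp add: y_of_def gf_y_def gf_eval_def sbody_seval body_vec_gf_args)
  qed
  hence "body_vec ks2 (y_of X q) = mf_coord M2 d (\<phi> m)"
    using \<phi>m by (auto simp: body_vec_def body_space_def)
  moreover have "ks2 ! i \<noteq> Formal" if "i < length ks2" for i using nf2 that nth_mem by metis
  ultimately show ?thesis
    using par by (auto simp: spoints_def coord_tuples_def mf_dim_def y_of_def[unfolded mf_dim_def])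
qed

lemma y_of_spoints:
  assumes X: "X \<in> spoints ks1 U1" and q: "small_tuple ks2 q"
  shows "y_of X q \<in> spoints ks2 U2"
proof -
  obtain m where m: "m \<in> overlap M1 M2 \<phi> c d" "body_vec ks1 X = mf_coord M1 c m"
    using spoints_body[OF X] by auto
  have "X \<in> spoints ks1 {mf_coord M1 c m}" using spoints_self[OF X] m by simp
  from y_of_body[OF m(1) this q] show ?thesis
    by (rule spoints_mono) (use m in \<open>auto simp: overlap_def\<close>)
qed

lemma y_of_cong:
  assumes X: "X \<in> spoints ks1 U1" and q: "\<And>i. i < mf_dim M2 \<Longrightarrow> eps_cong K (q i) (q' i)"
  shows "eps_cong K (y_of X q i) (y_of X q' i)"
proof (cases "i < mf_dim M2")
  case True
  have "eps_cong K (seval gk F (gf_args M1 X q)) (seval gk F (gf_args M1 X q'))" for F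
  proof (rule eps_cong_seval[OF openin_overlap_gf])
    show "body_vec gk (gf_args M1 X q) = body_vec gk (gf_args M1 X q')" "body_vec gk (gf_args M1 X q) \<in> U1"
      using spoints_body[OF X] by (simp_all add: body_vec_gf_args)
    show "eps_cong K (gf_args M1 X q j) (gf_args M1 X q' j)" if "j < length gk" for j
      using q[of "j - mf_dim M1"] that by (simp add: gf_args_def length_gf_kinds)
  qed simp
  thus ?thesis by (simp add: y_of_def gf_y_def gf_eval_def eps_cong_mult)
qed (simp add: y_of_def)

lemma q_of_cong:
  assumes y: "y \<in> spoints ks2 U2" and b: "body_vec ks2 y = body_vec ks2 y'" and yy: "\<And>i. eps_cong K (y i) (y' i)"
  shows "eps_cong (Suc K) (q_of y i) (q_of y' i)"
proof (cases "i < mf_dim M2")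
  case True
  show ?thesis unfolding q_of_eps[OF True]
    by (intro eps_cong_eps_mult eps_cong_seval[OF openin_U2 b spoints_body[OF y]] yy) simp
qed (simp add: q_of_def)

text \<open>The contraction estimate. The evaluations of \<open>g\<close> can be compared because
  both values of \<open>y\<close> lie over the same underlying point.\<close>

lemma step_cong:
  assumes X: "X \<in> spoints ks1 U1" and q: "small_tuple ks2 q" "small_tuple ks2 q'" and qq: "\<And>i. eps_cong K (q i) (q' i)"
  shows "eps_cong (Suc K) (q_of (y_of X q) i) (q_of (y_of X q') i)"
proof -
  obtain m where m: "m \<in> overlap M1 M2 \<phi> c d" "body_vec ks1 X = mf_coord M1 c m"
    using spoints_body[OF X] by auto
  have X': "X \<in> spoints ks1 {mf_coord M1 c m}" using spoints_self[OF X] m by simp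
  show ?thesis
    using spoints_body[OF y_of_body[OF m(1) X' q(1)]] spoints_body[OF y_of_body[OF m(1) X' q(2)]]
    by (intro q_of_cong y_of_spoints[OF X q(1)] y_of_cong[OF X qq]) simp
qed

section \<open>Solution of the equations by iteration\<close>

definition q_iter :: "nat \<Rightarrow> (nat \<Rightarrow> scalar) \<Rightarrow> nat \<Rightarrow> scalar" where
  "q_iter n X = ((\<lambda>q. q_of (y_of X q)) ^^ n) (\<lambda>_. 0)"

lemma q_iter_simps: "q_iter 0 X = (\<lambda>_. 0)" "q_iter (Suc n) X = q_of (y_of X (q_iter n X))"
  by (simp_all add: q_iter_def)

lemma small_q_iter: "X \<in> spoints ks1 U1 \<Longrightarrow> small_tuple ks2 (q_iter n X)"
  by (induction n) (auto simp: q_iter_simps small_q_of y_of_spoints, simp add: small_tuple_def coord_tuples_def)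

lemma q_iter_cong:
  assumes "X \<in> spoints ks1 U1"
  shows "n \<le> n' \<Longrightarrow> eps_cong n (q_iter n X i) (q_iter n' X i)"
proof (induction n arbitrary: n' i)
  case (Suc n)
  then obtain l where l: "n' = Suc l" "n \<le> l" by (cases n') auto
  show ?case unfolding l(1) q_iter_simps
    by (intro step_cong assms small_q_iter Suc.IH l)
qed (simp add: eps_cong_def)

text \<open>The \<epsilon>-adic limit: from iterate \<open>Suc k\<close> on, the coefficient at
  degree \<open>k\<close> no longer changes.\<close>

definition q_sol :: "(nat \<Rightarrow> scalar) \<Rightarrow> nat \<Rightarrow> scalar" where
  "q_sol X = (\<lambda>i. mk_scalar (\<lambda>k J. scoeff (q_iter (Suc k) X i) k J))"

definition y_sol :: "(nat \<Rightarrow> scalar) \<Rightarrow> nat \<Rightarrow> scalar" where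
  "y_sol X = y_of X (q_sol X)"

lemma q_sol_cong:
  assumes "X \<in> spoints ks1 U1"
  shows "eps_cong n (q_sol X i) (q_iter n X i)"
  unfolding eps_cong_def
proof (intro allI impI)
  fix k J assume "k < n"
  hence "scoeff (q_iter (Suc k) X i) k J = scoeff (q_iter n X i) k J"
    using q_iter_cong[OF assms, of "Suc k" n i] by (simp add: eps_cong_def)
  thus "scoeff (q_sol X i) k J = scoeff (q_iter n X i) k J"
    by (cases "finite J") (simp_all add: q_sol_def)
qed

lemma small_q_sol:
  assumes X: "X \<in> spoints ks1 U1"
  shows "small_tuple ks2 (q_sol X)"
proof -
  have s: "scoeff (q_sol X i) k J = scoeff (q_iter (Suc k) X i) k J" for i k J
    by (cases "finite J") (simp_all add: q_sol_def)
  have "q_sol X i = 0" if "i \<ge> length ks2" for i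
    using small_q_iter[OF X] that by (intro scalar_eqI) (simp add: s small_tuple_def coord_tuples_def)
  moreover have "has_parity (ks2 ! i = Odd) (q_sol X i)" if "i < length ks2" for i
    using small_q_iter[OF X] that unfolding has_parity_def s small_tuple_def coord_tuples_def by blast
  moreover have "sbody (q_sol X i) = 0" if "i < length ks2" for i
    using small_q_iter[OF X, of 1] that by (simp add: sbody_def s small_tuple_def)
  ultimately show ?thesis by (simp add: small_tuple_def coord_tuples_def)
qed

lemma q_sol_fixed:
  assumes X: "X \<in> spoints ks1 U1"
  shows "q_sol X = q_of (y_sol X)"
proof (rule ext, rule eps_cong_eqI)
  fix i n
  have "eps_cong (Suc n) (q_of (y_of X (q_sol X)) i) (q_iter (Suc n) X i)"
    unfolding q_iter_simps by (intro step_cong X small_q_sol small_q_iter q_sol_cong)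
  from eps_cong_trans[OF q_sol_cong[OF X] eps_cong_sym[OF this]]
  show "eps_cong n (q_sol X i) (q_of (y_sol X) i)"
    unfolding y_sol_def by (rule eps_cong_mono) simp
qed

text \<open>Existence is the fixed point property of \<open>q_sol\<close>. For uniqueness
  \<open>y\<close> is eliminated, which makes \<open>q\<close> a fixed point of the same
  contraction, so it agrees with \<open>q_sol\<close> to every order in \<epsilon>.\<close>

lemma pullback_equations_iff:
  assumes X: "X \<in> spoints ks1 U1"
  shows "pullback_equations M1 M2 S (eps_times g) c d X y q \<longleftrightarrow> y = y_sol X \<and> q = q_sol X"
proof
  assume "y = y_sol X \<and> q = q_sol X"
  moreover have "y_sol X \<in> spoints ks2 U2"
    unfolding y_sol_def by (rule y_of_spoints[OF X small_q_sol[OF X]])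
  moreover have "q_sol X \<in> coord_tuples ks2" using small_q_sol[OF X] by (simp add: small_tuple_def)
  moreover have "q_sol X i = seval ks2 (left_deriv ks2 i (eps_times g d)) (y_sol X)" if "i < mf_dim M2" for i
    using fun_cong[OF q_sol_fixed[OF X], of i] that by (simp add: q_of_def)
  moreover have "y_sol X i = gf_y M1 M2 (S c d) X (q_sol X) i" if "i < mf_dim M2" for i
    using that by (simp add: y_sol_def y_of_def)
  ultimately show "pullback_equations M1 M2 S (eps_times g) c d X y q"
    unfolding pullback_equations_def by blast
next
  assume eq: "pullback_equations M1 M2 S (eps_times g) c d X y q"
  hence yq: "y \<in> spoints ks2 U2" "q \<in> coord_tuples ks2"
    "\<And>i. i < mf_dim M2 \<Longrightarrow> q i = seval ks2 (left_deriv ks2 i (eps_times g d)) y"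
    "\<And>i. i < mf_dim M2 \<Longrightarrow> y i = gf_y M1 M2 (S c d) X q i"
    by (auto simp: pullback_equations_def)
  have q: "q = q_of y"
    using yq(2,3) by (auto simp: q_of_def coord_tuples_def mf_dim_def fun_eq_iff)
  have y: "y = y_of X q"
    using yq(1,4) by (auto simp: y_of_def spoints_def coord_tuples_def mf_dim_def fun_eq_iff)
  have e1: "q_of (y_of X q) = q" by (simp only: y[symmetric] q[symmetric])
  have e2: "q_of (y_of X (q_sol X)) = q_sol X" using q_sol_fixed[OF X] unfolding y_sol_def by (rule sym)
  have sq: "small_tuple ks2 q" using small_q_of[OF yq(1)] q by simp
  have "eps_cong n (q i) (q_sol X i)" for n i
  proof (induction n arbitrary: i)
    case (Suc n)
    have "eps_cong (Suc n) (q_of (y_of X q) i) (q_of (y_of X (q_sol X)) i)"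
      by (intro step_cong X sq small_q_sol Suc)
    thus ?case by (simp only: e1 e2)
  qed (simp add: eps_cong_def)
  hence q': "q = q_sol X" by (intro ext eps_cong_eqI)
  have "y = y_sol X" unfolding y_sol_def q'[symmetric] by (rule y)
  thus "y = y_sol X \<and> q = q_sol X" using q' by blast
qed

section \<open>The solution as a superfunction of x\<close>

lemma representable_gf_args:
  assumes q: "\<And>i. i < mf_dim M2 \<Longrightarrow> representable ks1 U1 (ks2 ! i = Odd) (\<lambda>X. q X i)" and j: "j < length gk"
  shows "representable ks1 U1 (gk ! j = Odd) (\<lambda>X. gf_args M1 X (q X) j)"
proof (cases "j < mf_dim M1")
  case True
  thus ?thesis using representable_coord[OF nf1 openin_overlap, of j]
    by (simp add: gf_args_def gf_kinds_nth mf_dim_def)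
next
  case False
  then obtain i where "j = mf_dim M1 + i" "i < mf_dim M2"
    using gf_index_cases[OF j[unfolded length_gf_kinds]] by metis
  thus ?thesis using q[of i] by (simp add: gf_args_def gf_kinds_Odd)
qed

lemma representable_gf_eval:
  assumes q: "\<And>i. i < mf_dim M2 \<Longrightarrow> representable ks1 U1 (ks2 ! i = Odd) (\<lambda>X. q X i)"
    and sq: "\<And>X. X \<in> spoints ks1 U1 \<Longrightarrow> small_tuple ks2 (q X)"
    and F: "smooth_sfun gk U1 F" "sfun_parity gk U1 b F"
  shows "representable ks1 U1 b (\<lambda>X. gf_eval M1 M2 F X (q X))"
  unfolding gf_eval_def
  by (rule representable_compose[OF nf1 openin_overlap openin_overlap_gf F representable_gf_args[OF q]])
    (use gf_args_spoints[OF _ sq nf1] in auto)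

lemma representable_y_of:
  assumes q: "\<And>i. i < mf_dim M2 \<Longrightarrow> representable ks1 U1 (ks2 ! i = Odd) (\<lambda>X. q X i)"
    and sq: "\<And>X. X \<in> spoints ks1 U1 \<Longrightarrow> small_tuple ks2 (q X)" and i: "i < mf_dim M2"
  shows "representable ks1 U1 (ks2 ! i = Odd) (\<lambda>X. y_of X (q X) i)"
proof -
  have i': "mf_dim M1 + i < length gk" using i by (simp add: length_gf_kinds)
  have "representable ks1 U1 (ks2 ! i = Odd) (\<lambda>X. gf_eval M1 M2 (gf_dq M1 M2 i (S c d)) X (q X))"
    unfolding gf_dq_def
    by (rule representable_gf_eval[OF q sq])
      (use smooth_sfun_left_deriv[OF openin_overlap_gf generating_function_chart(1) i']
        sfun_parity_left_deriv[OF openin_overlap_gf generating_function_chart(2) i'] i in \<open>auto simp: gf_kinds_Odd\<close>)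
  from representable_sign_mult[OF nf1 openin_overlap this] show ?thesis
    using i by (simp add: y_of_def gf_y_def)
qed

lemma representable_q_iter:
  "i < mf_dim M2 \<Longrightarrow> representable ks1 U1 (ks2 ! i = Odd) (\<lambda>X. q_iter n X i)"
proof (induction n arbitrary: i)
  case 0
  show ?case by (simp add: q_iter_simps representable_const[OF nf1 openin_overlap])
next
  case (Suc n)
  have i: "i < length ks2" using Suc by (simp add: mf_dim_def)
  have "representable ks1 U1 (ks2 ! i = Odd) (\<lambda>X. seval ks2 (left_deriv ks2 i (eps_times g d)) (y_of X (q_iter n X)))"
    by (rule representable_compose[OF nf1 openin_overlap openin_U2])
      (use smooth_sfun_left_deriv[OF openin_U2 g_facts(1) i] sfun_parity_left_deriv[OF openin_U2 g_facts(2) i]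
        representable_y_of[OF Suc.IH small_q_iter] y_of_spoints[OF _ small_q_iter] in \<open>auto simp: mf_dim_def\<close>)
  thus ?case using Suc.prems by (simp add: q_iter_simps q_of_def)
qed

lemma representable_q_sol: "i < mf_dim M2 \<Longrightarrow> representable ks1 U1 (ks2 ! i = Odd) (\<lambda>X. q_sol X i)"
  by (rule representable_limit[OF nf1 openin_overlap representable_q_iter q_sol_cong])

lemma representable_y_sol: "i < mf_dim M2 \<Longrightarrow> representable ks1 U1 (ks2 ! i = Odd) (\<lambda>X. y_sol X i)"
  unfolding y_sol_def by (rule representable_y_of[OF representable_q_sol small_q_sol])

section \<open>The local expression of f and its derivative\<close>

definition pullback_value :: "(nat \<Rightarrow> scalar) \<Rightarrow> scalar" where
  "pullback_value X = seval ks2 (eps_times g d) (y_sol X) + gf_eval M1 M2 (S c d) X (q_sol X)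
     - (\<Sum>i<mf_dim M2. y_sol X i * q_sol X i)"

lemma y_sol_spoints: "X \<in> spoints ks1 U1 \<Longrightarrow> y_sol X \<in> spoints ks2 U2"
  unfolding y_sol_def by (rule y_of_spoints[OF _ small_q_sol])

lemma representable_pullback_value: "representable ks1 U1 False pullback_value"
proof -
  note nfU = nf1 openin_overlap
  have "representable ks1 U1 False (\<lambda>X. seval ks2 (eps_times g d) (y_sol X))"
    by (rule representable_compose[OF nfU openin_U2 g_facts])
      (use representable_y_sol y_sol_spoints in \<open>auto simp: mf_dim_def\<close>)
  moreover have "representable ks1 U1 False (\<lambda>X. gf_eval M1 M2 (S c d) X (q_sol X))"
    by (rule representable_gf_eval[OF representable_q_sol small_q_sol generating_function_chart(1,2)])
  moreover have "representable ks1 U1 False (\<lambda>X. \<Sum>i<mf_dim M2. y_sol X i * q_sol X i)"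
  proof (rule representable_sum[OF nfU])
    fix i assume "i \<in> {..<mf_dim M2}"
    hence i: "i < mf_dim M2" by simp
    from representable_mult[OF nfU representable_y_sol[OF i] representable_q_sol[OF i]]
    show "representable ks1 U1 False (\<lambda>X. y_sol X i * q_sol X i)" by simp
  qed simp
  ultimately show ?thesis
    unfolding pullback_value_def by (intro representable_diff[OF nfU] representable_add[OF nfU])
qed

text \<open>
  The variations of \<open>y\<close> and \<open>q\<close> cancel: \<open>\<delta>y\<^sup>i \<partial>g/\<partial>y\<^sup>i = \<delta>y\<^sup>i q\<^sub>i\<close> and
  \<open>\<delta>q\<^sub>i \<partial>S/\<partial>q\<^sub>i = (-1)\<^sup>i \<delta>q\<^sub>i y\<^sup>i = y\<^sup>i \<delta>q\<^sub>i\<close>.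
\<close>

lemma has_partials_pullback_value:
  "has_partials ks1 U1 pullback_value (\<lambda>a X. gf_eval M1 M2 (gf_dx M1 M2 a (S c d)) X (q_sol X))"
  unfolding has_partials_def
proof (intro allI impI)
  fix X X' t
  assume dX: "\<forall>a<length ks1. has_sderiv (\<lambda>s. X s a) (X' a) t"
    and ev: "eventually (\<lambda>s. X s \<in> spoints ks1 U1) (nhds t)"
  have Xt: "X t \<in> spoints ks1 U1" using ev eventually_nhds_x_imp_x by blast
  let ?n1 = "mf_dim M1" and ?n2 = "mf_dim M2"
  \<comment> \<open>Representability provides velocities \<open>v\<close> of \<open>y\<close> and
    \<open>w\<close> of \<open>q\<close>. Their values never have to be computed, as they cancel in
    the end.\<close>
  have ex: "\<exists>D. has_sderiv (\<lambda>s. V (X s)) D t" if V: "representable ks1 U1 b V" for b V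
  proof -
    obtain D where "has_partials ks1 U1 V D" using representable_partials[OF openin_overlap V] by blast
    from has_partialsD[OF this _ ev] dX show ?thesis by blast
  qed
  obtain v where v: "\<And>i. i < ?n2 \<Longrightarrow> has_sderiv (\<lambda>s. y_sol (X s) i) (v i) t"
    using ex[OF representable_y_sol] by metis
  obtain w where w: "\<And>i. i < ?n2 \<Longrightarrow> has_sderiv (\<lambda>s. q_sol (X s) i) (w i) t"
    using ex[OF representable_q_sol] by metis
  have wp: "has_parity (ks2 ! i = Odd) (w i)" if i: "i < ?n2" for i
  proof (rule has_sderiv_parity[OF w[OF i]])
    show "eventually (\<lambda>s. has_parity (ks2 ! i = Odd) (q_sol (X s) i)) (nhds t)"
      using ev by eventually_elim (rule representable_parity[OF openin_overlap representable_q_sol[OF i]])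
  qed
  have evy: "eventually (\<lambda>s. y_sol (X s) \<in> spoints ks2 U2) (nhds t)"
    using ev by eventually_elim (rule y_sol_spoints)
  have "has_sderiv (\<lambda>s. seval ks2 (eps_times g d) (y_sol (X s)))
      (\<Sum>i<length ks2. v i * seval ks2 (left_deriv ks2 i (eps_times g d)) (y_sol (X t))) t"
    by (rule has_partialsD[OF has_partials_seval[OF openin_U2 g_facts(1)] _ evy]) (simp add: v mf_dim_def)
  also have "(\<Sum>i<length ks2. v i * seval ks2 (left_deriv ks2 i (eps_times g d)) (y_sol (X t))) =
      (\<Sum>i<?n2. v i * q_sol (X t) i)"
    using fun_cong[OF q_sol_fixed[OF Xt]] by (simp add: q_of_def mf_dim_def)
  finally have 1: "has_sderiv (\<lambda>s. seval ks2 (eps_times g d) (y_sol (X s))) (\<Sum>i<?n2. v i * q_sol (X t) i) t" .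
  let ?z' = "\<lambda>j. if j < ?n1 then X' j else w (j - ?n1)"
  let ?E = "\<lambda>F. gf_eval M1 M2 F (X t) (q_sol (X t))"
  have evz: "eventually (\<lambda>s. gf_args M1 (X s) (q_sol (X s)) \<in> spoints gk U1) (nhds t)"
    using ev by eventually_elim (rule gf_args_spoints[OF _ small_q_sol nf1])
  have "has_sderiv (\<lambda>s. gf_eval M1 M2 (S c d) (X s) (q_sol (X s)))
      (\<Sum>j<length gk. ?z' j * seval gk (left_deriv gk j (S c d)) (gf_args M1 (X t) (q_sol (X t)))) t"
    unfolding gf_eval_def
  proof (rule has_partialsD[OF has_partials_seval[OF openin_overlap_gf generating_function_chart(1)] _ evz])
    fix j assume j: "j < length gk"
    show "has_sderiv (\<lambda>s. gf_args M1 (X s) (q_sol (X s)) j) (?z' j) t"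
      using dX w[of "j - ?n1"] j by (simp add: gf_args_def length_gf_kinds mf_dim_def)
  qed
  also have "(\<Sum>j<length gk. ?z' j * seval gk (left_deriv gk j (S c d)) (gf_args M1 (X t) (q_sol (X t)))) =
      (\<Sum>a<?n1. X' a * ?E (gf_dx M1 M2 a (S c d))) + (\<Sum>i<?n2. w i * ?E (gf_dq M1 M2 i (S c d)))"
    unfolding length_gf_kinds lessThan_atLeast0
    by (subst sum.atLeastLessThan_concat[symmetric, of 0 ?n1])
      (simp_all add: gf_eval_def gf_dx_def gf_dq_def sum.atLeastLessThan_shift_0[of _ ?n1] add.commute)
  also have "(\<Sum>i<?n2. w i * ?E (gf_dq M1 M2 i (S c d))) = (\<Sum>i<?n2. y_sol (X t) i * w i)"
  proof (rule sum.cong)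
    fix i assume "i \<in> {..<?n2}"
    hence i: "i < ?n2" by simp
    have "y_sol (X t) i = (- 1) ^ par ks2 i * ?E (gf_dq M1 M2 i (S c d))"
      using i by (simp add: y_sol_def y_of_def gf_y_def)
    hence e: "(- 1) ^ par ks2 i * y_sol (X t) i = ?E (gf_dq M1 M2 i (S c d))"
      by (cases "even (par ks2 i)") (simp_all add: mult.assoc [symmetric])
    have "y_sol (X t) i * w i = (- 1) ^ (of_bool (ks2 ! i = Odd) * of_bool (ks2 ! i = Odd)) * (w i * y_sol (X t) i)"
      by (rule supercommute[OF representable_parity[OF openin_overlap representable_y_sol[OF i] Xt] wp[OF i]])
    also have "\<dots> = w i * ((- 1) ^ par ks2 i * y_sol (X t) i)"
      by (simp add: par_def)
    finally show "w i * ?E (gf_dq M1 M2 i (S c d)) = y_sol (X t) i * w i" by (simp add: e)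
  qed simp
  finally have 2: "has_sderiv (\<lambda>s. gf_eval M1 M2 (S c d) (X s) (q_sol (X s)))
      ((\<Sum>a<?n1. X' a * ?E (gf_dx M1 M2 a (S c d))) + (\<Sum>i<?n2. y_sol (X t) i * w i)) t" .
  have 3: "has_sderiv (\<lambda>s. \<Sum>i<?n2. y_sol (X s) i * q_sol (X s) i)
      (\<Sum>i<?n2. v i * q_sol (X t) i + y_sol (X t) i * w i) t"
    by (intro has_sderiv_sum has_sderiv_mult v w) simp_all
  from has_sderiv_diff[OF has_sderiv_add[OF 1 2] 3]
  show "has_sderiv (\<lambda>s. pullback_value (X s)) (\<Sum>a<length ks1. X' a * ?E (gf_dx M1 M2 a (S c d))) t"
    unfolding pullback_value_def by (simp add: sum.distrib mf_dim_def)
qed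

end

section \<open>Points and covectors on a supermanifold\<close>

lemma change_coords_facts:
  assumes M: "supermanifold M" and c: "c \<in> mf_charts M" and c': "c' \<in> mf_charts M" and a: "a < mf_dim M"
  defines "U \<equiv> mf_coord M c ` (mf_dom M c \<inter> mf_dom M c')"
  shows "openin_body (mf_kinds M) U" "smooth_sfun (mf_kinds M) U (mf_trans M c c' a)"
    "sfun_parity (mf_kinds M) U (mf_kinds M ! a = Odd) (mf_trans M c c' a)"
    "a \<in> even_idx (mf_kinds M) \<Longrightarrow> m \<in> mf_dom M c \<inter> mf_dom M c' \<Longrightarrow>
      sbody (mf_trans M c c' a (mf_coord M c m) (\<lambda>_. 0)) = mf_coord M c' m a"
proof -
  show "openin_body (mf_kinds M) U"
    unfolding U_def using chart_facts(1)[OF M c] chart_facts(1)[OF M c'] by (intro chart_image_open[OF M c]) auto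
  have "\<forall>c\<in>mf_charts M. \<forall>c'\<in>mf_charts M.
        let U = mf_coord M c ` (mf_dom M c \<inter> mf_dom M c') in
        \<forall>a<mf_dim M.
          smooth_sfun (mf_kinds M) U (mf_trans M c c' a) \<and>
          sfun_parity (mf_kinds M) U (mf_kinds M ! a = Odd) (mf_trans M c c' a) \<and>
          real_sfun (mf_kinds M) U (mf_trans M c c' a) \<and>
          (a \<in> even_idx (mf_kinds M) \<longrightarrow> (\<forall>m\<in>mf_dom M c \<inter> mf_dom M c'.
             sbody (mf_trans M c c' a (mf_coord M c m) (\<lambda>_. 0)) = mf_coord M c' m a))"
    using M unfolding supermanifold_def by (elim conjE)
  from bspec[OF bspec[OF this c] c', unfolded Let_def, rule_format, OF a]
  show "smooth_sfun (mf_kinds M) U (mf_trans M c c' a)"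
    "sfun_parity (mf_kinds M) U (mf_kinds M ! a = Odd) (mf_trans M c c' a)"
    "a \<in> even_idx (mf_kinds M) \<Longrightarrow> m \<in> mf_dom M c \<inter> mf_dom M c' \<Longrightarrow>
      sbody (mf_trans M c c' a (mf_coord M c m) (\<lambda>_. 0)) = mf_coord M c' m a"
    unfolding U_def by simp_all
qed

lemma change_coords_cocycle:
  assumes M: "supermanifold M" and m: "m \<in> topspace (mf_top M)"
    and c: "c \<in> charts_at M m" "c' \<in> charts_at M m" "c'' \<in> charts_at M m"
    and X: "X \<in> spoints (mf_kinds M) {mf_coord M c m}"
  shows "change_coords M c c X = X"
    "change_coords M c' c'' (change_coords M c c' X) = change_coords M c c'' X"
proof -
  have "\<forall>m\<in>topspace (mf_top M). \<forall>c\<in>charts_at M m. \<forall>c'\<in>charts_at M m. \<forall>c''\<in>charts_at M m.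
        \<forall>X\<in>spoints (mf_kinds M) {mf_coord M c m}.
          change_coords M c c X = X \<and>
          change_coords M c' c'' (change_coords M c c' X) = change_coords M c c'' X"
    using M unfolding supermanifold_def by (elim conjE)
  from bspec[OF bspec[OF bspec[OF bspec[OF bspec[OF this m] c(1)] c(2)] c(3)] X]
  show "change_coords M c c X = X"
    "change_coords M c' c'' (change_coords M c c' X) = change_coords M c c'' X" by simp_all
qed

lemma charts_atD: "c \<in> charts_at M m \<Longrightarrow> c \<in> mf_charts M" "c \<in> charts_at M m \<Longrightarrow> m \<in> mf_dom M c"
  by (simp_all add: charts_at_def)

lemma change_coords_spoints:
  assumes M: "supermanifold M" and c: "c \<in> charts_at M m" "c' \<in> charts_at M m"
    and X: "X \<in> spoints (mf_kinds M) {mf_coord M c m}"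
  shows "change_coords M c c' X \<in> spoints (mf_kinds M) {mf_coord M c' m}"
proof -
  let ?ks = "mf_kinds M"
  note facts = change_coords_facts[OF M charts_atD(1)[OF c(1)] charts_atD(1)[OF c(2)]]
  have m: "m \<in> mf_dom M c \<inter> mf_dom M c'" using c by (simp add: charts_at_def)
  have X': "X \<in> spoints ?ks (mf_coord M c ` (mf_dom M c \<inter> mf_dom M c'))"
    by (rule spoints_mono[OF X]) (use m in auto)
  have par: "has_parity (?ks ! a = Odd) (change_coords M c c' X a)" if "a < mf_dim M" for a
    using has_parity_seval[OF facts(1)[OF that] facts(3)[OF that] X'] that by (simp add: change_coords_def)
  have b: "mf_coord M c' m \<in> body_space ?ks"
    using openin_body_subset[OF chart_facts(2)[OF M charts_atD(1)[OF c(2)]]] m by auto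
  have "sbody (change_coords M c c' X a) = mf_coord M c' m a" if "a \<in> even_idx ?ks" for a
  proof -
    have a: "a < mf_dim M" using even_idx_less[OF that] by (simp add: mf_dim_def)
    show ?thesis using facts(4)[OF a that m] a spoints_body[OF X] by (simp add: change_coords_def sbody_seval)
  qed
  hence "body_vec ?ks (change_coords M c c' X) = mf_coord M c' m"
    using b by (auto simp: body_vec_def body_space_def)
  moreover have "?ks ! a \<noteq> Formal" if "a < length ?ks" for a
    using supermanifold_no_formal[OF M] that nth_mem by metis
  ultimately show ?thesis
    using par by (auto simp: spoints_def coord_tuples_def mf_dim_def change_coords_def)
qed

text \<open>A point is a compatible family over all charts; this is the family forced by its
  coordinates \<open>T\<close> in the chart \<open>c\<close>.\<close>

definition extend_point :: "('p, 'c) smanifold \<Rightarrow> 'p \<Rightarrow> 'c \<Rightarrow> (nat \<Rightarrow> scalar) \<Rightarrow> 'c \<Rightarrow> nat \<Rightarrow> scalar" where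
  "extend_point M m c T = (\<lambda>c'. if c' \<in> charts_at M m then change_coords M c c' T else (\<lambda>_. 0))"

lemma extend_point:
  assumes M: "supermanifold M" and m: "m \<in> topspace (mf_top M)" and c: "c \<in> charts_at M m"
    and T: "T \<in> spoints (mf_kinds M) {mf_coord M c m}"
  shows "(m, extend_point M m c T) \<in> mf_points M" "extend_point M m c T c = T"
  using change_coords_spoints[OF M c _ T] change_coords_cocycle[OF M m c _ _ T] c m
  by (simp_all add: mf_points_def extend_point_def)

lemma chart_topspace:
  assumes "supermanifold M" "c \<in> mf_charts M" "m \<in> mf_dom M c"
  shows "m \<in> topspace (mf_top M)" "c \<in> charts_at M m"
  using openin_subset[OF chart_facts(1)[OF assms(1,2)]] assms by (auto simp: charts_at_def)

lemma charts_at_nonempty: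
  assumes "supermanifold M" "m \<in> topspace (mf_top M)"
  obtains c where "c \<in> charts_at M m"
proof -
  have "(\<Union>c\<in>mf_charts M. mf_dom M c) = topspace (mf_top M)"
    using assms(1) unfolding supermanifold_def by (elim conjE)
  thus thesis using assms(2) that by (auto simp: charts_at_def)
qed

definition jacobian :: "('p, 'c) smanifold \<Rightarrow> 'c \<Rightarrow> 'c \<Rightarrow> nat \<Rightarrow> nat \<Rightarrow> (nat \<Rightarrow> scalar) \<Rightarrow> scalar" where
  "jacobian M c c' a b X = seval (mf_kinds M) (left_deriv (mf_kinds M) a (mf_trans M c c' b)) X"

context
  fixes M :: "('p, 'c) smanifold" and m :: 'p
  assumes M: "supermanifold M" and m: "m \<in> topspace (mf_top M)"
begin

text \<open>Everything in this context is taken over the single underlying point \<open>m\<close>.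
  The set \<open>{mf_coord M c m}\<close> need not be open, but partial derivatives are already
  determined by soul directions, and domains of triple overlaps need not be tracked.\<close>

lemma has_partials_change_coords:
  assumes c: "c \<in> charts_at M m" "c' \<in> charts_at M m" and b: "b < mf_dim M"
  shows "has_partials (mf_kinds M) {mf_coord M c m} (\<lambda>X. change_coords M c c' X b) (\<lambda>a. jacobian M c c' a b)"
proof -
  note facts = change_coords_facts[OF M charts_atD(1)[OF c(1)] charts_atD(1)[OF c(2)] b]
  have "has_partials (mf_kinds M) {mf_coord M c m} (seval (mf_kinds M) (mf_trans M c c' b)) (\<lambda>a. jacobian M c c' a b)"
    unfolding jacobian_def
    by (rule has_partials_subset[OF has_partials_seval[OF facts(1,2)]]) (use c in \<open>auto simp: charts_at_def\<close>)
  thus ?thesis using b by (simp add: change_coords_def)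
qed

lemma has_partials_along_change:
  assumes c: "c \<in> charts_at M m" "c' \<in> charts_at M m"
    and F: "has_partials (mf_kinds M) {mf_coord M c' m} V D"
  shows "has_partials (mf_kinds M) {mf_coord M c m} (\<lambda>X. V (change_coords M c c' X))
    (\<lambda>a X. \<Sum>b<mf_dim M. jacobian M c c' a b X * D b (change_coords M c c' X))"
  using has_partials_compose[OF F, where U = "{mf_coord M c m}" and ks = "mf_kinds M" and Y = "change_coords M c c'"
      and D = "\<lambda>b a. jacobian M c c' a b"]
    has_partials_change_coords[OF c] change_coords_spoints[OF M c]
  by (simp add: mf_dim_def)

lemma jacobian_self:
  assumes c: "c \<in> charts_at M m" and X: "X \<in> spoints (mf_kinds M) {mf_coord M c m}" and ab: "a < mf_dim M" "b < mf_dim M"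
  shows "jacobian M c c a b X = (if a = b then 1 else 0)"
proof (rule has_partials_eq[OF has_partials_change_coords[OF c c ab(2)] has_partials_coord X])
  show "a < length (mf_kinds M)" "b < length (mf_kinds M)" using ab by (simp_all add: mf_dim_def)
  fix Z assume "Z \<in> spoints (mf_kinds M) {body_vec (mf_kinds M) X}"
  hence "Z \<in> spoints (mf_kinds M) {mf_coord M c m}" using spoints_body[OF X] by simp
  thus "change_coords M c c Z b = Z b" using change_coords_cocycle(1)[OF M m c c c] by simp
qed

text \<open>The derivative of the cocycle identity, by uniqueness of partial derivatives.\<close>

lemma jacobian_chain:
  assumes c: "c \<in> charts_at M m" "c' \<in> charts_at M m" "c'' \<in> charts_at M m"
    and X: "X \<in> spoints (mf_kinds M) {mf_coord M c m}" and ab: "a < mf_dim M" "e < mf_dim M"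
  shows "(\<Sum>b<mf_dim M. jacobian M c c' a b X * jacobian M c' c'' b e (change_coords M c c' X)) =
    jacobian M c c'' a e X"
proof (rule has_partials_eq[OF has_partials_along_change[OF c(1,2) has_partials_change_coords[OF c(2,3) ab(2)]]
      has_partials_change_coords[OF c(1,3) ab(2)] X])
  show "a < length (mf_kinds M)" using ab by (simp add: mf_dim_def)
  fix Z assume "Z \<in> spoints (mf_kinds M) {body_vec (mf_kinds M) X}"
  hence "Z \<in> spoints (mf_kinds M) {mf_coord M c m}" using spoints_body[OF X] by simp
  thus "change_coords M c' c'' (change_coords M c c' Z) e = change_coords M c c'' Z e"
    using change_coords_cocycle(2)[OF M m c] by simp
qed

lemma has_parity_jacobian:
  assumes c: "c \<in> charts_at M m" "c' \<in> charts_at M m" and X: "X \<in> spoints (mf_kinds M) {mf_coord M c m}"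
    and ab: "a < mf_dim M" "b < mf_dim M"
  shows "has_parity (((mf_kinds M) ! b = Odd) \<noteq> ((mf_kinds M) ! a = Odd)) (jacobian M c c' a b X)"
  unfolding jacobian_def
proof -
  note facts = change_coords_facts[OF M charts_atD(1)[OF c(1)] charts_atD(1)[OF c(2)] ab(2)]
  show "has_parity (((mf_kinds M) ! b = Odd) \<noteq> ((mf_kinds M) ! a = Odd)) (seval (mf_kinds M) (left_deriv (mf_kinds M) a (mf_trans M c c' b)) X)"
    by (rule has_parity_seval[OF facts(1) sfun_parity_left_deriv[OF facts(1,3)]])
      (use ab c spoints_mono[OF X] in \<open>auto simp: mf_dim_def charts_at_def\<close>)
qed

definition extend_covector :: "('c \<Rightarrow> nat \<Rightarrow> scalar) \<Rightarrow> 'c \<Rightarrow> (nat \<Rightarrow> scalar) \<Rightarrow> 'c \<Rightarrow> nat \<Rightarrow> scalar" where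
  "extend_covector X c p = (\<lambda>c' a. if c' \<in> charts_at M m \<and> a < mf_dim M
     then \<Sum>b<mf_dim M. jacobian M c' c a b (X c') * p b else 0)"

text \<open>Compatibility between any two charts reduces to the chain rule for Jacobians, with
  \<open>c\<close> as the third chart.\<close>

lemma extend_covector:
  assumes X: "(m, X) \<in> mf_points M" and c: "c \<in> charts_at M m" and p: "p \<in> coord_tuples (mf_kinds M)"
  shows "(m, X, extend_covector X c p) \<in> cotangent_bundle M" "extend_covector X c p c = p"
proof -
  let ?P = "extend_covector X c p"
  have Xs: "X c' \<in> spoints (mf_kinds M) {mf_coord M c' m}" if "c' \<in> charts_at M m" for c'
    by (rule mf_points_spoints[OF X that])
  have Xc: "X c'' = change_coords M c' c'' (X c')" if "c' \<in> charts_at M m" "c'' \<in> charts_at M m" for c' c''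
    using X that unfolding mf_points_def by blast
  show "?P c = p"
  proof
    fix a show "?P c a = p a"
    proof (cases "a < mf_dim M")
      case True
      have "(\<Sum>b<mf_dim M. jacobian M c c a b (X c) * p b) = (\<Sum>b<mf_dim M. if b = a then p a else 0)"
        by (rule sum.cong) (auto simp: jacobian_self[OF c Xs[OF c] True])
      thus ?thesis using True c by (simp add: extend_covector_def)
    next
      case False
      thus ?thesis using p by (simp add: extend_covector_def coord_tuples_def mf_dim_def)
    qed
  qed
  have "?P c' \<in> coord_tuples (mf_kinds M)" if c': "c' \<in> charts_at M m" for c'
  proof -
    have "has_parity ((mf_kinds M) ! a = Odd) (\<Sum>b<mf_dim M. jacobian M c' c a b (X c') * p b)" if a: "a < mf_dim M" for a
    proof (rule has_parity_sum)
      fix b assume "b \<in> {..<mf_dim M}"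
      hence b: "b < mf_dim M" by simp
      have "has_parity ((mf_kinds M) ! b = Odd) (p b)" using p b by (simp add: coord_tuples_def mf_dim_def)
      from has_parity_mult[OF has_parity_jacobian[OF c' c Xs[OF c'] a b] this]
      show "has_parity ((mf_kinds M) ! a = Odd) (jacobian M c' c a b (X c') * p b)"
        by (cases "(mf_kinds M) ! a = Odd"; cases "(mf_kinds M) ! b = Odd") simp_all
    qed
    thus ?thesis using c' by (simp add: coord_tuples_def extend_covector_def mf_dim_def)
  qed
  moreover have "?P c' a = (\<Sum>b<mf_dim M. seval (mf_kinds M) (left_deriv (mf_kinds M) a (mf_trans M c' c'' b)) (X c') * ?P c'' b)"
    if c': "c' \<in> charts_at M m" "c'' \<in> charts_at M m" and a: "a < mf_dim M" for c' c'' a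
  proof -
    have "(\<Sum>b<mf_dim M. jacobian M c' c'' a b (X c') * ?P c'' b) =
        (\<Sum>b<mf_dim M. \<Sum>e<mf_dim M. jacobian M c' c'' a b (X c') * jacobian M c'' c b e (X c'') * p e)"
      using c' by (simp add: extend_covector_def sum_distrib_left mult.assoc)
    also have "\<dots> = (\<Sum>e<mf_dim M. (\<Sum>b<mf_dim M. jacobian M c' c'' a b (X c') * jacobian M c'' c b e (X c'')) * p e)"
      by (subst sum.swap) (simp add: sum_distrib_right)
    also have "\<dots> = (\<Sum>e<mf_dim M. jacobian M c' c a e (X c') * p e)"
      unfolding Xc[OF c'] by (intro sum.cong refl) (simp add: jacobian_chain[OF c' c Xs[OF c'(1)] a])
    also have "\<dots> = ?P c' a" using c' a by (simp add: extend_covector_def)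
    finally show ?thesis by (simp add: jacobian_def)
  qed
  moreover have "?P c' = (\<lambda>_. 0)" if "c' \<notin> charts_at M m" for c'
    using that by (simp add: extend_covector_def fun_eq_iff)
  ultimately show "(m, X, ?P) \<in> cotangent_bundle M"
    using X by (simp add: cotangent_bundle_def)
qed

text \<open>The derivative of the chart independence of \<open>h\<close>. The latter is available at
  every tuple of coordinates over \<open>m\<close>, since each extends to a point.\<close>

lemma deriv_change_coords:
  assumes h: "smooth_function M h" and X: "(m, X) \<in> mf_points M" and c: "c \<in> charts_at M m" "c' \<in> charts_at M m"
    and a: "a < mf_dim M"
  shows "seval (mf_kinds M) (left_deriv (mf_kinds M) a (h c)) (X c) =
    (\<Sum>b<mf_dim M. jacobian M c c' a b (X c) * seval (mf_kinds M) (left_deriv (mf_kinds M) b (h c')) (X c'))"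
proof -
  have hp: "has_partials (mf_kinds M) {mf_coord M c m} (seval (mf_kinds M) (h c)) (\<lambda>a. seval (mf_kinds M) (left_deriv (mf_kinds M) a (h c)))"
    if "c \<in> charts_at M m" for c
  proof (rule has_partials_subset[OF has_partials_seval])
    show "openin_body (mf_kinds M) (mf_coord M c ` mf_dom M c)" by (rule chart_facts(2)[OF M charts_atD(1)[OF that]])
    show "smooth_sfun (mf_kinds M) (mf_coord M c ` mf_dom M c) (h c)"
      using h charts_atD(1)[OF that] by (simp add: smooth_function_def)
  qed (use that in \<open>auto simp: charts_at_def\<close>)
  have Xc: "X c' = change_coords M c c' (X c)" using X c unfolding mf_points_def by blast
  have Xs: "X c \<in> spoints (mf_kinds M) {mf_coord M c m}" by (rule mf_points_spoints[OF X c(1)])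
  show ?thesis unfolding Xc
  proof (rule has_partials_eq[OF hp[OF c(1)] has_partials_along_change[OF c hp[OF c(2)]] Xs])
    show "a < length (mf_kinds M)" using a by (simp add: mf_dim_def)
    fix Z assume "Z \<in> spoints (mf_kinds M) {body_vec (mf_kinds M) (X c)}"
    hence Z: "Z \<in> spoints (mf_kinds M) {mf_coord M c m}" using spoints_body[OF Xs] by simp
    have "\<forall>(m, X)\<in>mf_points M. \<forall>c\<in>charts_at M m. \<forall>c'\<in>charts_at M m.
        seval (mf_kinds M) (h c) (X c) = seval (mf_kinds M) (h c') (X c')"
      using h by (simp add: smooth_function_def)
    from bspec[OF bspec[OF bspec[OF this extend_point(1)[OF M m c(1) Z], unfolded prod.case] c(1)] c(2)]
    show "seval (mf_kinds M) (h c) Z = seval (mf_kinds M) (h c') (change_coords M c c' Z)"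
      using extend_point(2)[OF M m c(1) Z] c(2) by (simp add: extend_point_def)
  qed
qed

text \<open>Covectors and derivatives of a function transform with the same Jacobian, so one chart
  is enough.\<close>

lemma graph_derivI:
  assumes h: "smooth_function M h" and P: "(m, X, P) \<in> cotangent_bundle M" and c: "c \<in> charts_at M m"
    and eq: "\<And>a. a < mf_dim M \<Longrightarrow> P c a = seval (mf_kinds M) (left_deriv (mf_kinds M) a (h c)) (X c)"
  shows "(m, X, P) \<in> graph_deriv M h"
proof -
  have X: "(m, X) \<in> mf_points M" using P by (simp add: cotangent_bundle_def)
  have "P c' a = seval (mf_kinds M) (left_deriv (mf_kinds M) a (h c')) (X c')" if c': "c' \<in> charts_at M m" and a: "a < mf_dim M" for c' a
  proof -
    have "P c' a = (\<Sum>b<mf_dim M. jacobian M c' c a b (X c') * P c b)"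
      using P c c' a by (simp add: cotangent_bundle_def jacobian_def)
    also have "\<dots> = (\<Sum>b<mf_dim M. jacobian M c' c a b (X c') * seval (mf_kinds M) (left_deriv (mf_kinds M) b (h c)) (X c))"
      by (simp add: eq)
    also have "\<dots> = seval (mf_kinds M) (left_deriv (mf_kinds M) a (h c')) (X c')"
      by (rule deriv_change_coords[OF h X c' c a, symmetric])
    finally show ?thesis .
  qed
  thus ?thesis using P by (simp add: graph_deriv_def)
qed

end

section \<open>The graph of a derivative is Lagrangian\<close>

lemma continuous_on_body_map:
  assumes "\<And>a. a < length ks \<Longrightarrow> smooth_sfun ks U (F a)"
  shows "continuous_on U (body_map ks F)"
proof (rule continuous_on_coordinatewise_then_product)
  fix a show "continuous_on U (\<lambda>t. body_map ks F t a)"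
  proof (cases "a \<in> even_idx ks")
    case True
    thus ?thesis
      using smooth_real_continuous[OF smooth_sfun_coeff[OF assms[OF even_idx_less[OF True]] zero_admissible, of 0 "{}"]]
      by (simp add: body_map_def sbody_def)
  qed (simp add: body_map_def)
qed

lemma left_deriv_commute_seval:
  assumes U: "openin_body ks U" and F: "smooth_sfun ks U F" and X: "X \<in> spoints ks U"
    and a: "a < length ks" and b: "b < length ks"
  shows "seval ks (left_deriv ks a (left_deriv ks b F)) X =
    (- 1) ^ (par ks a * par ks b) * seval ks (left_deriv ks b (left_deriv ks a F)) X"
proof -
  have s: "smooth_sfun ks U (left_deriv ks i F)" if "i < length ks" for i
    by (rule smooth_sfun_left_deriv[OF U F that])
  show ?thesis
    by (rule has_partials_commute[where D = "\<lambda>a. seval ks (left_deriv ks a F)"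
          and E = "\<lambda>a b. seval ks (left_deriv ks b (left_deriv ks a F))",
          OF has_partials_seval[OF U F] has_partials_seval[OF U s[OF a]] has_partials_seval[OF U s[OF b]]
            has_partials_seval[OF U smooth_sfun_left_deriv[OF U s[OF a] b]]
            has_partials_seval[OF U smooth_sfun_left_deriv[OF U s[OF b] a]] X a b])
qed

text \<open>The graph is parametrised by the base coordinates. The superfunctions \<open>x a\<close>
  are supplied by the recognition theorem; their derivatives are found from their values at points,
  not from explicit coefficients.\<close>

lemma graph_param:
  assumes nf: "Formal \<notin> set ks" and U: "openin_body ks U"
    and f: "smooth_sfun ks U f" "sfun_parity ks U False f"
  obtains x where "embedding_param ks U x (\<lambda>a. left_deriv ks a f)" "isotropic_param ks U x (\<lambda>a. left_deriv ks a f)"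
    "\<And>a T. a < length ks \<Longrightarrow> T \<in> spoints ks U \<Longrightarrow> seval ks (x a) T = T a"
proof -
  have "\<exists>F. a < length ks \<longrightarrow> smooth_sfun ks U F \<and> sfun_parity ks U (ks ! a = Odd) F \<and> (\<forall>X\<in>spoints ks U. X a = seval ks F X)" for a
    using representable_coord[OF nf U] unfolding representable_def by blast
  hence "\<forall>a. \<exists>F. a < length ks \<longrightarrow> smooth_sfun ks U F \<and> sfun_parity ks U (ks ! a = Odd) F \<and> (\<forall>X\<in>spoints ks U. X a = seval ks F X)"
    by blast
  from choice[OF this] obtain x where
    "\<forall>a. a < length ks \<longrightarrow> smooth_sfun ks U (x a) \<and> sfun_parity ks U (ks ! a = Odd) (x a) \<and> (\<forall>X\<in>spoints ks U. X a = seval ks (x a) X)"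
    by blast
  hence x: "\<And>a. a < length ks \<Longrightarrow> smooth_sfun ks U (x a)" "\<And>a. a < length ks \<Longrightarrow> sfun_parity ks U (ks ! a = Odd) (x a)"
    "\<And>a X. a < length ks \<Longrightarrow> X \<in> spoints ks U \<Longrightarrow> seval ks (x a) X = X a" by auto
  let ?p = "\<lambda>a. left_deriv ks a f"
  have dx: "seval ks (left_deriv ks s (x a)) X = (if s = a then 1 else 0)"
    if a: "a < length ks" and s: "s < length ks" and X: "X \<in> spoints ks U" for a s X
    by (rule has_partials_eq[OF has_partials_seval[OF U x(1)[OF a]] has_partials_coord[OF a] X s])
      (rule x(3)[OF a spoints_same_body[OF _ X]])
  have p: "smooth_sfun ks U (?p a)" "sfun_parity ks U (ks ! a = Odd) (?p a)" if "a < length ks" for a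
    using smooth_sfun_left_deriv[OF U f(1) that] sfun_parity_left_deriv[OF U f(2) that] by simp_all
  have emb: "embedding_param ks U x ?p"
    unfolding embedding_param_def Let_def
  proof (intro conjI)
    show "\<forall>a<length ks. \<forall>F\<in>{x a, ?p a}. smooth_sfun ks U F \<and> sfun_parity ks U (ks ! a = Odd) F"
      using x p by simp
    let ?j = "\<lambda>t. (body_map ks x t, body_map ks ?p t)"
    have bx: "body_map ks x t = t" if t: "t \<in> U" for t
    proof
      fix a
      show "body_map ks x t a = t a"
      proof (cases "a \<in> even_idx ks")
        case True
        have "sbody (x a t (\<lambda>_. 0)) = sbody (seval ks (x a) (real_point t))"
          by (simp add: seval_real_point[OF U t, of "x a"])
        thus ?thesis using True x(3)[OF even_idx_less[OF True] real_point_spoints(1)[OF U t]]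
          by (simp add: body_map_def real_point_def)
      next
        case False
        thus ?thesis using openin_body_subset[OF U t] by (simp add: body_map_def body_space_def)
      qed
    qed
    \<comment> \<open>On underlying points the first component of the embedding is the identity, so
      the projection inverts it.\<close>
    have "homeomorphism U (?j ` U) ?j fst"
    proof (rule homeomorphismI)
      show "continuous_on U ?j"
        by (intro continuous_on_Pair continuous_on_body_map x(1) p(1))
      show "continuous_on (?j ` U) fst" by (intro continuous_intros)
    qed (auto simp: bx)
    thus "\<exists>h. homeomorphism U (?j ` U) ?j h" by blast
    show "\<forall>t\<in>U. \<forall>v :: nat \<Rightarrow> real. (\<forall>a<length ks. \<forall>F\<in>{x a, ?p a}.
        (\<Sum>s<length ks. v s * sbody (left_deriv ks s F t (\<lambda>_. 0))) = 0) \<longrightarrow> (\<forall>s<length ks. v s = 0)"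
    proof (intro ballI allI impI)
      fix t v a
      assume t: "t \<in> U" and v: "\<forall>a<length ks. \<forall>F\<in>{x a, ?p a}. (\<Sum>s<length ks. v s * sbody (left_deriv ks s F t (\<lambda>_. 0))) = 0"
        and a: "a < length ks"
      have "v s * sbody (left_deriv ks s (x a) t (\<lambda>_. 0)) = (if s = a then v a else 0)" if s: "s < length ks" for s
        using dx[OF a s real_point_spoints(1)[OF U t]] by (simp add: seval_real_point[OF U t, of "left_deriv ks s (x a)"])
      hence "(\<Sum>s<length ks. v s * sbody (left_deriv ks s (x a) t (\<lambda>_. 0))) = (\<Sum>s<length ks. if s = a then v a else 0)"
        by (intro sum.cong) auto
      thus "v a = 0" using v a by simp
    qed
  qed
  have iso: "isotropic_param ks U x ?p"
    unfolding isotropic_param_def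
  proof (intro ballI allI impI)
    fix T s r assume T: "T \<in> spoints ks U" and s: "s < length ks" and r: "r < length ks"
    \<comment> \<open>The derivative of \<open>x a\<close> is a Kronecker delta, so only
      \<open>a = r\<close> survives and leaves a second derivative of \<open>f\<close>;
      symmetrization then cancels the two orders in each of the four parity cases.\<close>
    have om: "pullback_omega ks x ?p s r T = (- 1) ^ ((par ks s + par ks r) * (par ks r + 1)) *
        seval ks (left_deriv ks s (?p r)) T" if s: "s < length ks" and r: "r < length ks" for s r
    proof -
      have "pullback_omega ks x ?p s r T = (\<Sum>a<length ks. if a = r then
          (- 1) ^ ((par ks s + par ks r) * (par ks r + 1)) * seval ks (left_deriv ks s (?p r)) T else 0)"
        unfolding pullback_omega_def by (intro sum.cong refl) (use dx[OF _ r T] in auto)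
      thus ?thesis using r by simp
    qed
    have pr: "par ks i = 0 \<or> par ks i = 1" for i by (auto simp: par_def)
    show "pullback_omega ks x ?p s r T + (- 1) ^ ((par ks s + 1) * (par ks r + 1)) * pullback_omega ks x ?p r s T = 0"
      unfolding om[OF s r] om[OF r s]
      using left_deriv_commute_seval[OF U f(1) T s r] pr[of s] pr[of r] by (auto simp: numeral_2_eq_2)
  qed
  show thesis by (rule that[OF emb iso x(3)])
qed

lemma graph_deriv_lagrangian:
  assumes M: "supermanifold M" and f: "smooth_function M f"
  shows "lagrangian_submanifold M (graph_deriv M f)"
  unfolding lagrangian_submanifold_def
proof (intro conjI)
  show "graph_deriv M f \<subseteq> cotangent_bundle M" by (auto simp: graph_deriv_def)
  let ?ks = "mf_kinds M" and ?B = "body_space (mf_kinds M)"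
  show "\<forall>(m, X, P)\<in>graph_deriv M f. \<forall>c\<in>charts_at M m.
        let ks = mf_kinds M; B = body_space ks in
        \<exists>N W x p.
          openin (top_of_set (B \<times> B)) N \<and> N \<subseteq> (mf_coord M c ` mf_dom M c) \<times> B \<and>
          (body_vec ks (X c), body_vec ks (P c)) \<in> N \<and>
          openin (top_of_set B) W \<and>
          embedding_param ks W x p \<and> isotropic_param ks W x p \<and>
          {(X' c, P' c) | m' X' P'. (m', X', P') \<in> graph_deriv M f \<and> c \<in> charts_at M m' \<and>
             (body_vec ks (X' c), body_vec ks (P' c)) \<in> N} =
          {(\<lambda>a. if a < length ks then seval ks (x a) T else 0,
            \<lambda>a. if a < length ks then seval ks (p a) T else 0) | T. T \<in> spoints ks W}"
  proof (rule ballI, unfold split_paired_all prod.case, rule ballI)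
    fix m X P c assume L: "(m, X, P) \<in> graph_deriv M f" and c: "c \<in> charts_at M m"
    let ?U = "mf_coord M c ` mf_dom M c"
    have cM: "c \<in> mf_charts M" by (rule charts_atD(1)[OF c])
    have U: "openin_body ?ks ?U" by (rule chart_facts(2)[OF M cM])
    have fc: "smooth_sfun ?ks ?U (f c)" "sfun_parity ?ks ?U False (f c)"
      using f cM by (simp_all add: smooth_function_def)
    let ?p = "\<lambda>a. left_deriv ?ks a (f c)"
    obtain x where x: "embedding_param ?ks ?U x ?p" "isotropic_param ?ks ?U x ?p"
      "\<And>a T. a < length ?ks \<Longrightarrow> T \<in> spoints ?ks ?U \<Longrightarrow> seval ?ks (x a) T = T a"
      using graph_param[OF supermanifold_no_formal[OF M] U fc] by blast
    have bB: "body_vec ?ks Z \<in> ?B" for Z by (auto simp: body_vec_def body_space_def)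
    have sp: "Z c \<in> spoints ?ks ?U" if "(n, Z, R) \<in> graph_deriv M f" "c \<in> charts_at M n" for n Z R
      using mf_points_spoints[of n Z M c] that
      by (auto simp: graph_deriv_def cotangent_bundle_def charts_at_def intro: spoints_mono)
    \<comment> \<open>No shrinking is necessary: over the whole chart domain and for all bodies of
      the momenta the graph is one parametrised piece.\<close>
    let ?N = "?U \<times> ?B"
    have T0: "T a = 0" if "T \<in> spoints ?ks ?U" "\<not> a < length ?ks" for T a
      using that by (simp add: spoints_def coord_tuples_def)
    let ?L = "{(X' c, P' c) | m' X' P'. (m', X', P') \<in> graph_deriv M f \<and> c \<in> charts_at M m' \<and>
             (body_vec ?ks (X' c), body_vec ?ks (P' c)) \<in> ?N}"
    let ?R = "{(\<lambda>a. if a < length ?ks then seval ?ks (x a) T else 0,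
            \<lambda>a. if a < length ?ks then seval ?ks (?p a) T else 0) | T. T \<in> spoints ?ks ?U}"
    have "?L = ?R"
    proof (intro equalityI subsetI)
      fix z assume "z \<in> ?L"
      then obtain n Z R where z: "z = (Z c, R c)" "(n, Z, R) \<in> graph_deriv M f" "c \<in> charts_at M n" by blast
      note Zc = sp[OF z(2,3)]
      have "R c a = (if a < length ?ks then seval ?ks (?p a) (Z c) else 0)" for a
        using z(2,3) by (auto simp: graph_deriv_def cotangent_bundle_def coord_tuples_def mf_dim_def)
      moreover have "Z c a = (if a < length ?ks then seval ?ks (x a) (Z c) else 0)" for a
        using x(3)[OF _ Zc] T0[OF Zc] by simp
      ultimately have "z = (\<lambda>a. if a < length ?ks then seval ?ks (x a) (Z c) else 0,
            \<lambda>a. if a < length ?ks then seval ?ks (?p a) (Z c) else 0)"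
        unfolding z(1) by (auto simp: fun_eq_iff)
      thus "z \<in> ?R" using Zc by blast
    next
      fix z assume "z \<in> ?R"
      then obtain T where T: "T \<in> spoints ?ks ?U" and z: "z = (\<lambda>a. if a < length ?ks then seval ?ks (x a) T else 0,
            \<lambda>a. if a < length ?ks then seval ?ks (?p a) T else 0)" by blast
      obtain n where n: "n \<in> mf_dom M c" "body_vec ?ks T = mf_coord M c n" using spoints_body[OF T] by auto
      note nt = chart_topspace[OF M cM n(1)]
      have T': "T \<in> spoints ?ks {mf_coord M c n}" using spoints_self[OF T] n by simp
      let ?Z = "extend_point M n c T"
      note Z = extend_point[OF M nt T']
      define p where "p = (\<lambda>a. if a < length ?ks then seval ?ks (?p a) T else 0)"
      have "p \<in> coord_tuples ?ks"
        using has_parity_seval[OF U sfun_parity_left_deriv[OF U fc(2)] T] by (simp add: p_def coord_tuples_def)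
      note R = extend_covector[OF M nt(1) Z(1) nt(2) this]
      let ?R = "extend_covector M n ?Z c p"
      have "(n, ?Z, ?R) \<in> graph_deriv M f"
        by (rule graph_derivI[OF M nt(1) f R(1) nt(2)]) (simp only: R(2) Z(2), simp add: p_def mf_dim_def)
      moreover have "z = (?Z c, ?R c)"
        unfolding z R(2) Z(2) using x(3)[OF _ T] T0[OF T] by (auto simp: fun_eq_iff p_def)
      moreover have "(body_vec ?ks (?Z c), body_vec ?ks (?R c)) \<in> ?N"
        using bB spoints_body[OF T] by (simp add: Z(2))
      ultimately show "z \<in> ?L" using nt(2) by blast
    qed
    moreover have "openin (top_of_set (?B \<times> ?B)) ?N"
      by (rule openin_Times[OF U]) simp
    moreover have "(body_vec ?ks (X c), body_vec ?ks (P c)) \<in> ?N"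
      using spoints_body[OF sp[OF L c]] bB by simp
    ultimately show "let ks = mf_kinds M; B = body_space ks in
        \<exists>N W x p.
          openin (top_of_set (B \<times> B)) N \<and> N \<subseteq> (mf_coord M c ` mf_dom M c) \<times> B \<and>
          (body_vec ks (X c), body_vec ks (P c)) \<in> N \<and>
          openin (top_of_set B) W \<and>
          embedding_param ks W x p \<and> isotropic_param ks W x p \<and>
          {(X' c, P' c) | m' X' P'. (m', X', P') \<in> graph_deriv M f \<and> c \<in> charts_at M m' \<and>
             (body_vec ks (X' c), body_vec ks (P' c)) \<in> N} =
          {(\<lambda>a. if a < length ks then seval ks (x a) T else 0,
            \<lambda>a. if a < length ks then seval ks (p a) T else 0) | T. T \<in> spoints ks W}"
      unfolding Let_def using U x(1,2)
      by (intro exI[of _ ?N] exI[of _ ?U] exI[of _ x] exI[of _ ?p] conjI order_refl)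
  qed
qed

section \<open>The generalized pullback\<close>

lemma cotangent_bundle_point: "(m, X, P) \<in> cotangent_bundle M \<Longrightarrow> (m, X) \<in> mf_points M"
  unfolding cotangent_bundle_def by blast

lemma cotangent_bundle_covector:
  "(m, X, P) \<in> cotangent_bundle M \<Longrightarrow> c \<in> charts_at M m \<Longrightarrow> P c \<in> coord_tuples (mf_kinds M)"
  unfolding cotangent_bundle_def by blast

lemma mf_points_topspace: "(m, X) \<in> mf_points M \<Longrightarrow> m \<in> topspace (mf_top M)"
  unfolding mf_points_def by blast

lemma graph_derivD:
  assumes "(m, X, P) \<in> graph_deriv M f"
  shows "(m, X, P) \<in> cotangent_bundle M"
    "c \<in> charts_at M m \<Longrightarrow> a < mf_dim M \<Longrightarrow> P c a = seval (mf_kinds M) (left_deriv (mf_kinds M) a (f c)) (X c)"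
  using assms unfolding graph_deriv_def by blast+

lemma smooth_function_invariant:
  assumes "smooth_function M h" "(m, X) \<in> mf_points M" "c \<in> charts_at M m" "c' \<in> charts_at M m"
  shows "seval (mf_kinds M) (h c) (X c) = seval (mf_kinds M) (h c') (X c')"
proof -
  have "\<forall>(m, X)\<in>mf_points M. \<forall>c\<in>charts_at M m. \<forall>c'\<in>charts_at M m.
      seval (mf_kinds M) (h c) (X c) = seval (mf_kinds M) (h c') (X c')"
    using assms(1) by (simp add: smooth_function_def)
  from bspec[OF bspec[OF bspec[OF this assms(2), unfolded prod.case] assms(3)] assms(4)] show ?thesis .
qed

lemma smooth_function_eps_times:
  assumes "smooth_function M g"
  shows "smooth_function M (eps_times g)"
  unfolding smooth_function_def
proof (intro conjI ballI)
  fix c assume "c \<in> mf_charts M"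
  thus "smooth_sfun (mf_kinds M) (mf_coord M c ` mf_dom M c) (eps_times g c)"
    "sfun_parity (mf_kinds M) (mf_coord M c ` mf_dom M c) False (eps_times g c)"
    using assms by (simp_all add: smooth_function_def eps_times_def smooth_sfun_eps_mult sfun_parity_eps_mult)
next
  fix p assume p: "p \<in> mf_points M"
  obtain m X where pm: "p = (m, X)" by (cases p)
  have "seval (mf_kinds M) (eps_times g c) (X c) = seval (mf_kinds M) (eps_times g c') (X c')"
    if "c \<in> charts_at M m" "c' \<in> charts_at M m" for c c'
    using smooth_function_invariant[OF assms p[unfolded pm] that] by (simp add: eps_times_def seval_eps_mult)
  thus "case p of (m, X) \<Rightarrow> \<forall>c\<in>charts_at M m. \<forall>c'\<in>charts_at M m.
      seval (mf_kinds M) (eps_times g c) (X c) = seval (mf_kinds M) (eps_times g c') (X c')"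
    unfolding pm prod.case by blast
qed

context
  fixes M1 :: "('p, 'c) smanifold" and M2 :: "('q, 'd) smanifold"
    and \<phi> :: "'p \<Rightarrow> 'q" and S :: "'c \<Rightarrow> 'd \<Rightarrow> sfun"
    and \<Phi> :: "(('p, 'c) cotpoint \<times> ('q, 'd) cotpoint) set" and g :: "'d \<Rightarrow> sfun"
  assumes M1: "supermanifold M1" and M2: "supermanifold M2"
    and rel: "canonical_relation M1 M2 \<phi> S \<Phi>" and g: "smooth_function M2 g"
begin

private abbreviation (input) "U c d \<equiv> mf_coord M1 c ` overlap M1 M2 \<phi> c d"
private abbreviation (input) "ysol \<equiv> y_sol M1 M2 S g"
private abbreviation (input) "qsol \<equiv> q_sol M1 M2 S g"
private abbreviation (input) "fval \<equiv> pullback_value M1 M2 S g"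

private lemma gen: "generating_function M1 M2 \<phi> S"
  using rel by (simp add: canonical_relation_def)

private lemmas geps = smooth_function_eps_times[OF g]

section \<open>The relation and the generating function in chosen charts\<close>

lemma relation_iff:
  assumes "(m, X, P) \<in> cotangent_bundle M1" "(n, Y, Q) \<in> cotangent_bundle M2" "c \<in> charts_at M1 m" "d \<in> charts_at M2 n"
  shows "((m, X, P), (n, Y, Q)) \<in> \<Phi> \<longleftrightarrow>
          n = \<phi> m \<and> (\<forall>i<mf_dim M2. sbody (Q d i) = 0) \<and>
          (\<forall>a<mf_dim M1. P c a = gf_eval M1 M2 (gf_dx M1 M2 a (S c d)) (X c) (Q d)) \<and>
          (\<forall>i<mf_dim M2. Y d i = gf_y M1 M2 (S c d) (X c) (Q d) i)"
proof -
  have "\<forall>(m, X, P)\<in>cotangent_bundle M1. \<forall>(n, Y, Q)\<in>cotangent_bundle M2.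
        \<forall>c\<in>charts_at M1 m. \<forall>d\<in>charts_at M2 n.
        ((m, X, P), (n, Y, Q)) \<in> \<Phi> \<longleftrightarrow>
          n = \<phi> m \<and> (\<forall>i<mf_dim M2. sbody (Q d i) = 0) \<and>
          (\<forall>a<mf_dim M1. P c a = gf_eval M1 M2 (gf_dx M1 M2 a (S c d)) (X c) (Q d)) \<and>
          (\<forall>i<mf_dim M2. Y d i = gf_y M1 M2 (S c d) (X c) (Q d) i)"
    using rel unfolding canonical_relation_def by (elim conjE)
  from bspec[OF bspec[OF bspec[OF bspec[OF this assms(1), unfolded prod.case] assms(2), unfolded prod.case] assms(3)] assms(4)]
  show ?thesis .
qed

lemma S_transformation:
  assumes "(m, X) \<in> mf_points M1" "(\<phi> m, Y, Q) \<in> cotangent_bundle M2" "c \<in> charts_at M1 m" "c' \<in> charts_at M1 m"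
    "d \<in> charts_at M2 (\<phi> m)" "d' \<in> charts_at M2 (\<phi> m)"
    "\<forall>i<mf_dim M2. sbody (Q d i) = 0" "\<forall>i<mf_dim M2. Y d i = gf_y M1 M2 (S c d) (X c) (Q d) i"
  shows "gf_eval M1 M2 (S c' d') (X c') (Q d') = gf_eval M1 M2 (S c d) (X c) (Q d)
          - (\<Sum>i<mf_dim M2. Y d i * Q d i) + (\<Sum>i<mf_dim M2. Y d' i * Q d' i)"
proof -
  have "\<forall>(m, X)\<in>mf_points M1. \<forall>(n, Y, Q)\<in>cotangent_bundle M2.
        \<forall>c\<in>charts_at M1 m. \<forall>c'\<in>charts_at M1 m. \<forall>d\<in>charts_at M2 n. \<forall>d'\<in>charts_at M2 n.
        n = \<phi> m \<and> (\<forall>i<mf_dim M2. sbody (Q d i) = 0) \<and>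
        (\<forall>i<mf_dim M2. Y d i = gf_y M1 M2 (S c d) (X c) (Q d) i) \<longrightarrow>
        gf_eval M1 M2 (S c' d') (X c') (Q d') =
          gf_eval M1 M2 (S c d) (X c) (Q d)
          - (\<Sum>i<mf_dim M2. Y d i * Q d i) + (\<Sum>i<mf_dim M2. Y d' i * Q d' i)"
    using gen unfolding generating_function_def by (elim conjE)
  from bspec[OF bspec[OF bspec[OF bspec[OF bspec[OF bspec[OF this assms(1), unfolded prod.case] assms(2), unfolded prod.case]
          assms(3)] assms(4)] assms(5)] assms(6)] assms(7,8)
  show ?thesis by blast
qed

lemma \<phi>_topspace: "m \<in> topspace (mf_top M1) \<Longrightarrow> \<phi> m \<in> topspace (mf_top M2)"
  using gen unfolding generating_function_def by (auto dest: continuous_map_funspace)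

lemma point_overlap:
  assumes X: "(m, X) \<in> mf_points M1" and c: "c \<in> charts_at M1 m" and d: "d \<in> charts_at M2 (\<phi> m)"
  shows "m \<in> overlap M1 M2 \<phi> c d" "X c \<in> spoints (mf_kinds M1) (U c d)"
proof -
  show m: "m \<in> overlap M1 M2 \<phi> c d" using c d by (simp add: overlap_def charts_at_def)
  show "X c \<in> spoints (mf_kinds M1) (U c d)"
    by (rule spoints_mono[OF mf_points_spoints[OF X c]]) (use m in auto)
qed

text \<open>Existence: the solution in one pair of charts is extended to points of both cotangent
  bundles, and their being related is then verified in that pair of charts alone.\<close>

lemma related_points:
  assumes X: "(m, X) \<in> mf_points M1" and c: "c \<in> charts_at M1 m" and d: "d \<in> charts_at M2 (\<phi> m)"
  obtains Y Q P where "(\<phi> m, Y, Q) \<in> graph_deriv M2 (eps_times g)" "(m, X, P) \<in> cotangent_bundle M1"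
    "((m, X, P), (\<phi> m, Y, Q)) \<in> \<Phi>" "Y d = ysol c d (X c)" "Q d = qsol c d (X c)"
    "\<And>a. a < mf_dim M1 \<Longrightarrow> P c a = gf_eval M1 M2 (gf_dx M1 M2 a (S c d)) (X c) (qsol c d (X c))"
proof -
  have m: "m \<in> topspace (mf_top M1)" by (rule mf_points_topspace[OF X])
  note \<phi>m = \<phi>_topspace[OF m]
  note cd = charts_atD(1)[OF c] charts_atD(1)[OF d]
  note ov = point_overlap[OF X c d]
  note L = M1 M2 gen g cd
  let ?y = "ysol c d (X c)" and ?q = "qsol c d (X c)"
  have eqs: "pullback_equations M1 M2 S (eps_times g) c d (X c) ?y ?q"
    using pullback_equations_iff[OF L ov(2)] by blast
  have sq: "small_tuple (mf_kinds M2) ?q" by (rule small_q_sol[OF L ov(2)])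
  have y: "?y \<in> spoints (mf_kinds M2) {mf_coord M2 d (\<phi> m)}"
    unfolding y_sol_def[OF L] by (rule y_of_body[OF L ov(1) mf_points_spoints[OF X c] sq])
  note Y = extend_point[OF M2 \<phi>m d y]
  have "?q \<in> coord_tuples (mf_kinds M2)" using sq by (simp add: small_tuple_def)
  note Q = extend_covector[OF M2 \<phi>m Y(1) d this]
  let ?Y = "extend_point M2 (\<phi> m) d ?y"
  let ?Q = "extend_covector M2 (\<phi> m) ?Y d ?q"
  have graph: "(\<phi> m, ?Y, ?Q) \<in> graph_deriv M2 (eps_times g)"
    by (rule graph_derivI[OF M2 \<phi>m geps Q(1) d]) (use eqs in \<open>simp add: Q(2) Y(2) pullback_equations_def\<close>)
  define p where "p = (\<lambda>a. if a < mf_dim M1 then gf_eval M1 M2 (gf_dx M1 M2 a (S c d)) (X c) ?q else 0)"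
  have "p \<in> coord_tuples (mf_kinds M1)"
  proof -
    have "has_parity (mf_kinds M1 ! a = Odd) (gf_eval M1 M2 (gf_dx M1 M2 a (S c d)) (X c) ?q)" if a: "a < mf_dim M1" for a
    proof -
      have "a < length (gf_kinds M1 M2)" using a by (simp add: length_gf_kinds)
      from has_parity_seval[OF openin_overlap_gf[OF L] sfun_parity_left_deriv[OF openin_overlap_gf[OF L] generating_function_chart(2)[OF L] this]
          gf_args_spoints[OF ov(2) sq supermanifold_no_formal[OF M1]]]
      show ?thesis using a by (simp add: gf_eval_def gf_dx_def gf_kinds_nth)
    qed
    thus ?thesis by (simp add: p_def coord_tuples_def mf_dim_def)
  qed
  note P = extend_covector[OF M1 m X c this]
  let ?P = "extend_covector M1 m X c p"
  have Pc: "?P c a = gf_eval M1 M2 (gf_dx M1 M2 a (S c d)) (X c) ?q" if "a < mf_dim M1" for a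
    using that unfolding P(2) by (simp add: p_def)
  have "((m, X, ?P), (\<phi> m, ?Y, ?Q)) \<in> \<Phi>"
    unfolding relation_iff[OF P(1) Q(1) c d] Q(2) Y(2)
    using Pc sq eqs by (simp add: small_tuple_def pullback_equations_def mf_dim_def)
  from that[OF graph P(1) this Y(2) Q(2) Pc] show thesis .
qed

text \<open>Membership in \<open>\<Phi>\<close> and in the graph gives the pullback equations in
  every pair of charts, so one related pair carries the local solutions of all charts at
  once.\<close>

lemma related_points_solution:
  assumes YQ: "(\<phi> m, Y, Q) \<in> graph_deriv M2 (eps_times g)" and P: "(m, X, P) \<in> cotangent_bundle M1"
    and r: "((m, X, P), (\<phi> m, Y, Q)) \<in> \<Phi>" and c: "c \<in> charts_at M1 m" and d: "d \<in> charts_at M2 (\<phi> m)"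
  shows "Y d = ysol c d (X c)" "Q d = qsol c d (X c)"
proof -
  have X: "(m, X) \<in> mf_points M1" by (rule cotangent_bundle_point[OF P])
  have T: "(\<phi> m, Y, Q) \<in> cotangent_bundle M2" and Qd: "\<And>i. i < mf_dim M2 \<Longrightarrow>
      Q d i = seval (mf_kinds M2) (left_deriv (mf_kinds M2) i (eps_times g d)) (Y d)"
    using graph_derivD[OF YQ] d by blast+
  have "(\<phi> m, Y) \<in> mf_points M2" "Q d \<in> coord_tuples (mf_kinds M2)"
    using cotangent_bundle_point[OF T] cotangent_bundle_covector[OF T d] by blast+
  moreover from mf_points_spoints[OF this(1) d]
  have "Y d \<in> spoints (mf_kinds M2) (mf_coord M2 d ` mf_dom M2 d)"
    by (rule spoints_mono) (use d in \<open>auto simp: charts_at_def\<close>)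
  ultimately have "pullback_equations M1 M2 S (eps_times g) c d (X c) (Y d) (Q d)"
    using relation_iff[OF P T c d] r Qd unfolding pullback_equations_def by blast
  thus "Y d = ysol c d (X c)" "Q d = qsol c d (X c)"
    using pullback_equations_iff[OF M1 M2 gen g charts_atD(1)[OF c] charts_atD(1)[OF d] point_overlap(2)[OF X c d]]
    by blast+
qed

text \<open>A single related pair realises the solutions in both pairs of charts. There the terms
  \<open>y * q\<close> cancel the correction in the transformation law of \<open>S\<close>, and
  \<open>g\<close> has the same value in both charts.\<close>

lemma pullback_value_invariant:
  assumes X: "(m, X) \<in> mf_points M1" and c: "c \<in> charts_at M1 m" "c' \<in> charts_at M1 m"
    and d: "d \<in> charts_at M2 (\<phi> m)" "d' \<in> charts_at M2 (\<phi> m)"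
  shows "fval c d (X c) = fval c' d' (X c')"
proof -
  obtain Y Q P where R: "(\<phi> m, Y, Q) \<in> graph_deriv M2 (eps_times g)" "(m, X, P) \<in> cotangent_bundle M1"
    "((m, X, P), (\<phi> m, Y, Q)) \<in> \<Phi>" by (rule related_points[OF X c(1) d(1)])
  have T: "(\<phi> m, Y, Q) \<in> cotangent_bundle M2" by (rule graph_derivD(1)[OF R(1)])
  have Y: "(\<phi> m, Y) \<in> mf_points M2" by (rule cotangent_bundle_point[OF T])
  note s = related_points_solution[OF R c(1) d(1)] and s' = related_points_solution[OF R c(2) d(2)]
  have "gf_eval M1 M2 (S c' d') (X c') (Q d') = gf_eval M1 M2 (S c d) (X c) (Q d)
          - (\<Sum>i<mf_dim M2. Y d i * Q d i) + (\<Sum>i<mf_dim M2. Y d' i * Q d' i)"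
    by (rule S_transformation[OF X T c d]) (use relation_iff[OF R(2) T c(1) d(1)] R(3) in blast)+
  moreover have "seval (mf_kinds M2) (eps_times g d) (Y d) = seval (mf_kinds M2) (eps_times g d') (Y d')"
    by (rule smooth_function_invariant[OF geps Y d])
  ultimately show ?thesis
    unfolding pullback_value_def[OF M1 M2 gen g charts_atD(1)[OF c(1)] charts_atD(1)[OF d(1)]]
      pullback_value_def[OF M1 M2 gen g charts_atD(1)[OF c(2)] charts_atD(1)[OF d(2)]]
      s[symmetric] s'[symmetric] by simp
qed

text \<open>The underlying point \<open>m\<close> is recovered from the body of \<open>T\<close>,
  and some chart around \<open>\<phi> m\<close> is picked; chart independence makes the choice
  irrelevant.\<close>

definition local_value :: "'c \<Rightarrow> (nat \<Rightarrow> scalar) \<Rightarrow> scalar" where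
  "local_value c T = fval c (SOME d. \<exists>m\<in>mf_dom M1 c. mf_coord M1 c m = body_vec (mf_kinds M1) T \<and> d \<in> charts_at M2 (\<phi> m)) T"

lemma local_value_eq:
  assumes c: "c \<in> mf_charts M1" and T: "T \<in> spoints (mf_kinds M1) (U c d)" and d: "d \<in> mf_charts M2"
  shows "local_value c T = fval c d T"
proof -
  let ?P = "\<lambda>d. \<exists>m\<in>mf_dom M1 c. mf_coord M1 c m = body_vec (mf_kinds M1) T \<and> d \<in> charts_at M2 (\<phi> m)"
  obtain m where m: "m \<in> mf_dom M1 c" "body_vec (mf_kinds M1) T = mf_coord M1 c m" "d \<in> charts_at M2 (\<phi> m)"
    using spoints_body[OF T] d by (auto simp: overlap_def charts_at_def)
  have "?P d" using m by auto
  hence "?P (SOME d. ?P d)" by (rule someI)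
  then obtain m' where "m' \<in> mf_dom M1 c" "mf_coord M1 c m' = mf_coord M1 c m" "(SOME d. ?P d) \<in> charts_at M2 (\<phi> m')"
    using m(2) by auto
  moreover from this m(1) have "m' = m" using chart_inj[OF M1 c] by (auto dest: inj_onD)
  ultimately have e: "(SOME d. ?P d) \<in> charts_at M2 (\<phi> m)" by simp
  note mt = chart_topspace[OF M1 c m(1)]
  have "T \<in> spoints (mf_kinds M1) {mf_coord M1 c m}" using spoints_self[OF T] m(2) by simp
  note X = extend_point[OF M1 mt this]
  from pullback_value_invariant[OF X(1) mt(2,2) e m(3)] show ?thesis
    unfolding local_value_def X(2) .
qed

text \<open>A chart \<open>d\<close> covers only the part of the domain of \<open>c\<close> that
  \<open>\<phi>\<close> maps into it, so representability is proved on these parts and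
  glued.\<close>

lemma representable_local_value:
  assumes c: "c \<in> mf_charts M1"
  shows "representable (mf_kinds M1) (mf_coord M1 c ` mf_dom M1 c) False (local_value c)"
proof (rule representable_local[OF supermanifold_no_formal[OF M1] chart_facts(2)[OF M1 c]])
  fix x assume "x \<in> mf_coord M1 c ` mf_dom M1 c"
  then obtain m where m: "m \<in> mf_dom M1 c" "x = mf_coord M1 c m" by blast
  obtain d where d: "d \<in> charts_at M2 (\<phi> m)"
    using charts_at_nonempty[OF M2 \<phi>_topspace[OF chart_topspace(1)[OF M1 c m(1)]]] by blast
  note L = M1 M2 gen g c charts_atD(1)[OF d]
  have "representable (mf_kinds M1) (U c d) False (local_value c)"
    by (rule representable_cong[OF representable_pullback_value[OF L]]) (rule local_value_eq[OF c _ charts_atD(1)[OF d]])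
  moreover have "x \<in> U c d" using m d by (auto simp: overlap_def charts_at_def)
  moreover have "U c d \<subseteq> mf_coord M1 c ` mf_dom M1 c" by (auto simp: overlap_def)
  ultimately show "\<exists>U'. openin_body (mf_kinds M1) U' \<and> x \<in> U' \<and> U' \<subseteq> mf_coord M1 c ` mf_dom M1 c \<and>
      representable (mf_kinds M1) U' False (local_value c)"
    using openin_overlap[OF L] by blast
qed

lemma generalized_pullback:
  obtains f where "smooth_function M1 f"
    "\<And>c T. c \<in> mf_charts M1 \<Longrightarrow> T \<in> spoints (mf_kinds M1) (mf_coord M1 c ` mf_dom M1 c) \<Longrightarrow>
      seval (mf_kinds M1) (f c) T = local_value c T"
proof -
  let ?ks = "mf_kinds M1" and ?V = "\<lambda>c. mf_coord M1 c ` mf_dom M1 c"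
  have "\<exists>F. c \<in> mf_charts M1 \<longrightarrow> smooth_sfun ?ks (?V c) F \<and> sfun_parity ?ks (?V c) False F \<and>
      (\<forall>T\<in>spoints ?ks (?V c). local_value c T = seval ?ks F T)" for c
    using representable_local_value unfolding representable_def by blast
  hence "\<forall>c. \<exists>F. c \<in> mf_charts M1 \<longrightarrow> smooth_sfun ?ks (?V c) F \<and> sfun_parity ?ks (?V c) False F \<and>
      (\<forall>T\<in>spoints ?ks (?V c). local_value c T = seval ?ks F T)" by blast
  from choice[OF this] obtain f where f: "\<forall>c. c \<in> mf_charts M1 \<longrightarrow> smooth_sfun ?ks (?V c) (f c) \<and>
      sfun_parity ?ks (?V c) False (f c) \<and> (\<forall>T\<in>spoints ?ks (?V c). local_value c T = seval ?ks (f c) T)" by blast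
  hence ev: "seval ?ks (f c) T = local_value c T" if "c \<in> mf_charts M1" "T \<in> spoints ?ks (?V c)" for c T
    using that by simp
  have val: "seval ?ks (f c) (X c) = fval c d (X c)"
    if X: "(m, X) \<in> mf_points M1" and c: "c \<in> charts_at M1 m" and d: "d \<in> charts_at M2 (\<phi> m)" for m X c d
  proof -
    have "X c \<in> spoints ?ks (?V c)"
      by (rule spoints_mono[OF mf_points_spoints[OF X c]]) (use c in \<open>auto simp: charts_at_def\<close>)
    thus ?thesis
      using ev[OF charts_atD(1)[OF c]] local_value_eq[OF charts_atD(1)[OF c] point_overlap(2)[OF X c d] charts_atD(1)[OF d]]
      by simp
  qed
  have "smooth_function M1 f"
    unfolding smooth_function_def
  proof (intro conjI ballI)
    fix p assume p: "p \<in> mf_points M1"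
    obtain m X where pm: "p = (m, X)" by (cases p)
    have X: "(m, X) \<in> mf_points M1" using p pm by simp
    have "m \<in> topspace (mf_top M1)" by (rule mf_points_topspace[OF X])
    then obtain d where d: "d \<in> charts_at M2 (\<phi> m)" using charts_at_nonempty[OF M2 \<phi>_topspace] by blast
    have "seval ?ks (f c) (X c) = seval ?ks (f c') (X c')" if c: "c \<in> charts_at M1 m" "c' \<in> charts_at M1 m" for c c'
      unfolding val[OF X c(1) d] val[OF X c(2) d] by (rule pullback_value_invariant[OF X c d d])
    thus "case p of (m, X) \<Rightarrow> \<forall>c\<in>charts_at M1 m. \<forall>c'\<in>charts_at M1 m.
        seval ?ks (f c) (X c) = seval ?ks (f c') (X c')" unfolding pm prod.case by blast
  qed (use f in blast)+
  from that[OF this ev] show thesis .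
qed

text \<open>\<open>f\<close> and the local expression agree at all points over one underlying point,
  so uniqueness of partial derivatives transfers the derivative already computed.\<close>

lemma deriv_pullback:
  assumes f: "smooth_function M1 f"
    "\<And>c T. c \<in> mf_charts M1 \<Longrightarrow> T \<in> spoints (mf_kinds M1) (mf_coord M1 c ` mf_dom M1 c) \<Longrightarrow>
      seval (mf_kinds M1) (f c) T = local_value c T"
    and c: "c \<in> mf_charts M1" and d: "d \<in> mf_charts M2" and T: "T \<in> spoints (mf_kinds M1) (U c d)" and a: "a < mf_dim M1"
  shows "seval (mf_kinds M1) (left_deriv (mf_kinds M1) a (f c)) T =
    gf_eval M1 M2 (gf_dx M1 M2 a (S c d)) T (qsol c d T)"
proof (rule has_partials_eq[OF has_partials_subset[OF has_partials_seval[OF chart_facts(2)[OF M1 c]]]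
      has_partials_pullback_value[OF M1 M2 gen g c d] T])
  show "smooth_sfun (mf_kinds M1) (mf_coord M1 c ` mf_dom M1 c) (f c)"
    using f(1) c by (simp add: smooth_function_def)
  show UU: "U c d \<subseteq> mf_coord M1 c ` mf_dom M1 c" by (auto simp: overlap_def)
  show "a < length (mf_kinds M1)" using a by (simp add: mf_dim_def)
  fix Z assume "Z \<in> spoints (mf_kinds M1) {body_vec (mf_kinds M1) T}"
  from spoints_same_body[OF this T] have Z: "Z \<in> spoints (mf_kinds M1) (U c d)" .
  show "seval (mf_kinds M1) (f c) Z = fval c d Z"
    using f(2)[OF c spoints_mono[OF Z UU]] local_value_eq[OF c Z d] by simp
qed

text \<open>A related covector is the derivative of \<open>S\<close> in \<open>x\<close> at the
  local solution, which is the derivative of \<open>f\<close>. Conversely, a covector in the graph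
  has the same components as the one built over its base point by \<open>related_points\<close>,
  hence is related to the same element of the graph for \<epsilon>g.\<close>

lemma relation_image_eq_graph:
  assumes f: "smooth_function M1 f"
    "\<And>c T. c \<in> mf_charts M1 \<Longrightarrow> T \<in> spoints (mf_kinds M1) (mf_coord M1 c ` mf_dom M1 c) \<Longrightarrow>
      seval (mf_kinds M1) (f c) T = local_value c T"
  shows "relation_image \<Phi> (graph_deriv M2 (eps_times g)) = graph_deriv M1 f"
proof (intro equalityI subsetI)
  fix z assume "z \<in> relation_image \<Phi> (graph_deriv M2 (eps_times g))"
  then obtain w where w: "(z, w) \<in> \<Phi>" "w \<in> graph_deriv M2 (eps_times g)" by (auto simp: relation_image_def)
  obtain m X P where z: "z = (m, X, P)" by (cases z)
  obtain n Y Q where w': "w = (n, Y, Q)" by (cases w)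
  have T: "(n, Y, Q) \<in> cotangent_bundle M2" using w(2) unfolding w' by (rule graph_derivD(1))
  have "\<Phi> \<subseteq> cotangent_bundle M1 \<times> cotangent_bundle M2" using rel by (simp add: canonical_relation_def)
  hence P: "(m, X, P) \<in> cotangent_bundle M1" using w(1) z by blast
  have X: "(m, X) \<in> mf_points M1" by (rule cotangent_bundle_point[OF P])
  have m: "m \<in> topspace (mf_top M1)" by (rule mf_points_topspace[OF X])
  have n': "n \<in> topspace (mf_top M2)" by (rule mf_points_topspace[OF cotangent_bundle_point[OF T]])
  obtain c where c: "c \<in> charts_at M1 m" using charts_at_nonempty[OF M1 m] by blast
  obtain d where d: "d \<in> charts_at M2 n" using charts_at_nonempty[OF M2 n'] by blast
  note R = relation_iff[OF P T c d, THEN iffD1, OF w(1)[unfolded z w']]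
  have n: "n = \<phi> m" using R by blast
  have d': "d \<in> charts_at M2 (\<phi> m)" using d n by simp
  note s = related_points_solution[OF w(2)[unfolded w' n] P w(1)[unfolded z w' n] c d']
  show "z \<in> graph_deriv M1 f"
    unfolding z
  proof (rule graph_derivI[OF M1 m f(1) P c])
    fix a assume a: "a < mf_dim M1"
    show "P c a = seval (mf_kinds M1) (left_deriv (mf_kinds M1) a (f c)) (X c)"
      using R a s deriv_pullback[OF f charts_atD(1)[OF c] charts_atD(1)[OF d] point_overlap(2)[OF X c d'] a] by simp
  qed
next
  fix z assume zf: "z \<in> graph_deriv M1 f"
  obtain m X P where z: "z = (m, X, P)" by (cases z)
  have P: "(m, X, P) \<in> cotangent_bundle M1" using zf unfolding z by (rule graph_derivD(1))
  have X: "(m, X) \<in> mf_points M1" by (rule cotangent_bundle_point[OF P])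
  have m: "m \<in> topspace (mf_top M1)" by (rule mf_points_topspace[OF X])
  obtain c where c: "c \<in> charts_at M1 m" using charts_at_nonempty[OF M1 m] by blast
  obtain d where d: "d \<in> charts_at M2 (\<phi> m)" using charts_at_nonempty[OF M2 \<phi>_topspace[OF m]] by blast
  obtain Y Q P' where R: "(\<phi> m, Y, Q) \<in> graph_deriv M2 (eps_times g)" "(m, X, P') \<in> cotangent_bundle M1"
    "((m, X, P'), (\<phi> m, Y, Q)) \<in> \<Phi>" "Q d = qsol c d (X c)" by (rule related_points[OF X c d])
  have T: "(\<phi> m, Y, Q) \<in> cotangent_bundle M2" by (rule graph_derivD(1)[OF R(1)])
  have "P c a = gf_eval M1 M2 (gf_dx M1 M2 a (S c d)) (X c) (Q d)" if a: "a < mf_dim M1" for a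
    using graph_derivD(2)[OF zf[unfolded z] c a]
      deriv_pullback[OF f charts_atD(1)[OF c] charts_atD(1)[OF d] point_overlap(2)[OF X c d] a]
    by (simp add: R(4))
  hence "((m, X, P), (\<phi> m, Y, Q)) \<in> \<Phi>"
    using relation_iff[OF R(2) T c d] R(3) relation_iff[OF P T c d] by blast
  thus "z \<in> relation_image \<Phi> (graph_deriv M2 (eps_times g))"
    unfolding z relation_image_def using R(1) by force
qed

lemma generalized_pullback_graph:
  "let \<Lambda> = relation_image \<Phi> (graph_deriv M2 (eps_times g)) in
    lagrangian_submanifold M1 \<Lambda> \<and>
    (\<exists>f :: 'c \<Rightarrow> sfun. smooth_function M1 f \<and> \<Lambda> = graph_deriv M1 f \<and>
      (\<forall>(m, X)\<in>mf_points M1. \<forall>c\<in>charts_at M1 m. \<forall>d\<in>charts_at M2 (\<phi> m).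
        (\<exists>!(y, q). pullback_equations M1 M2 S (eps_times g) c d (X c) y q) \<and>
        (\<forall>y q. pullback_equations M1 M2 S (eps_times g) c d (X c) y q \<longrightarrow>
          seval (mf_kinds M1) (f c) (X c) =
            seval (mf_kinds M2) (eps_times g d) y + gf_eval M1 M2 (S c d) (X c) q
            - (\<Sum>i<mf_dim M2. y i * q i))))"
proof -
  obtain f where f: "smooth_function M1 f"
    "\<And>c T. c \<in> mf_charts M1 \<Longrightarrow> T \<in> spoints (mf_kinds M1) (mf_coord M1 c ` mf_dom M1 c) \<Longrightarrow>
      seval (mf_kinds M1) (f c) T = local_value c T"
    by (rule generalized_pullback) blast
  have eq: "relation_image \<Phi> (graph_deriv M2 (eps_times g)) = graph_deriv M1 f"
    by (rule relation_image_eq_graph[OF f(1)]) (rule f(2))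
  have sol: "(\<exists>!(y, q). pullback_equations M1 M2 S (eps_times g) c d (X c) y q) \<and>
        (\<forall>y q. pullback_equations M1 M2 S (eps_times g) c d (X c) y q \<longrightarrow>
          seval (mf_kinds M1) (f c) (X c) =
            seval (mf_kinds M2) (eps_times g d) y + gf_eval M1 M2 (S c d) (X c) q
            - (\<Sum>i<mf_dim M2. y i * q i))"
    if X: "(m, X) \<in> mf_points M1" and c: "c \<in> charts_at M1 m" and d: "d \<in> charts_at M2 (\<phi> m)" for m X c d
  proof -
    note cd = charts_atD(1)[OF c] charts_atD(1)[OF d]
    note ov = point_overlap(2)[OF X c d]
    have iff: "pullback_equations M1 M2 S (eps_times g) c d (X c) y q \<longleftrightarrow> y = ysol c d (X c) \<and> q = qsol c d (X c)" for y q
      by (rule pullback_equations_iff[OF M1 M2 gen g cd ov])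
    have "X c \<in> spoints (mf_kinds M1) (mf_coord M1 c ` mf_dom M1 c)"
      by (rule spoints_mono[OF ov]) (auto simp: overlap_def)
    hence "seval (mf_kinds M1) (f c) (X c) = fval c d (X c)"
      using f(2)[OF cd(1)] local_value_eq[OF cd(1) ov cd(2)] by simp
    thus ?thesis unfolding iff by (auto simp: pullback_value_def[OF M1 M2 gen g cd])
  qed
  show ?thesis
    unfolding Let_def eq
  proof (intro conjI exI[of _ f])
    show "lagrangian_submanifold M1 (graph_deriv M1 f)" by (rule graph_deriv_lagrangian[OF M1 f(1)])
    show "\<forall>(m, X)\<in>mf_points M1. \<forall>c\<in>charts_at M1 m. \<forall>d\<in>charts_at M2 (\<phi> m).
        (\<exists>!(y, q). pullback_equations M1 M2 S (eps_times g) c d (X c) y q) \<and>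
        (\<forall>y q. pullback_equations M1 M2 S (eps_times g) c d (X c) y q \<longrightarrow>
          seval (mf_kinds M1) (f c) (X c) =
            seval (mf_kinds M2) (eps_times g d) y + gf_eval M1 M2 (S c d) (X c) q
            - (\<Sum>i<mf_dim M2. y i * q i))"
      by (rule ballI, unfold split_paired_all prod.case, intro ballI, rule sol)
  qed (rule f(1) refl)+
qed

end

theorem mainTheorem1:
  fixes M1 :: "('p, 'c) smanifold" and M2 :: "('q, 'd) smanifold"
    and \<phi> :: "'p \<Rightarrow> 'q" and S :: "'c \<Rightarrow> 'd \<Rightarrow> sfun"
    and \<Phi> :: "(('p, 'c) cotpoint \<times> ('q, 'd) cotpoint) set"
    and g :: "'d \<Rightarrow> sfun"
  assumes "supermanifold M1" and "supermanifold M2"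
    and "canonical_relation M1 M2 \<phi> S \<Phi>"
    and "smooth_function M2 g" and "eps_free_function M2 g"
  shows "let \<Lambda> = relation_image \<Phi> (graph_deriv M2 (eps_times g)) in
    lagrangian_submanifold M1 \<Lambda> \<and>
    (\<exists>f :: 'c \<Rightarrow> sfun. smooth_function M1 f \<and> \<Lambda> = graph_deriv M1 f \<and>
      (\<forall>(m, X)\<in>mf_points M1. \<forall>c\<in>charts_at M1 m. \<forall>d\<in>charts_at M2 (\<phi> m).
        (\<exists>!(y, q). pullback_equations M1 M2 S (eps_times g) c d (X c) y q) \<and>
        (\<forall>y q. pullback_equations M1 M2 S (eps_times g) c d (X c) y q \<longrightarrow>
          seval (mf_kinds M1) (f c) (X c) =
            seval (mf_kinds M2) (eps_times g d) y + gf_eval M1 M2 (S c d) (X c) q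
            - (\<Sum>i<mf_dim M2. y i * q i))))"
  by (rule generalized_pullback_graph[OF assms(1-4)])

end
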